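(* For every $M\in\mathrm{SO}_0$ there exists an element $s\in\mathrm{Spin}(m|2n)(\Lambda_N)$ such that $h(s)=M$.
   Context: Let $m,n,N\in\mathbb N=\{1,2,\dots\}$. $\Lambda_N$ is the real Grassmann algebra generated by anticommuting $f_1,\dots,f_N$, with basis $f_A$, $A\subset\{1,\dots,N\}$; $\Lambda_N^{(ev)}$ and $\Lambda_N^{(odd)}$ are the spans of the $f_A$ with $|A|$ even, resp. odd. $\mathcal C_{m,2n}$ is the real unital associative algebra generated by $e_1,\dots,e_m,e'_1,\dots,e'_{2n}$ with relations $e_je_k+e_ke_j=-2\delta_{j,k}$, $e_je'_k+e'_ke_j=0$, $e'_je'_k-e'_ke'_j=g_{j,k}$, where $g_{2j,2k}=g_{2j-1,2k-1}=0$, $g_{2j-1,2k}=-g_{2k,2j-1}=\delta_{j,k}$ ($1\le j,k\le n$). Elements of $\Lambda_N$ commute with elements of $\mathcal C_{m,2n}$ in $\Lambda_N\otimes\mathcal C_{m,2n}$. $\mathbf S$ is a finite set of more than one independent supervector variables $\mathbf x=\sum_{j=1}^m x_je_j+\sum_{j=1}^{2n}x'_je'_j$ with commuting $x_j$ and anticommuting $x'_j$ (the $x'_j$ also anticommute with the $f_k$; all $x_j,x'_j$ commute with $\mathcal C_{m,2n}$). $\mathbb R_{m|2n}^{(2)E}(\Lambda_N)$ (extended superbivectors) is the space of elements $B=\sum_{j<k}b_{j,k}e_je_k+\sum_{j,k}b'_{j,k}e_je'_k+\sum_{j\le k}B_{j,k}\,e'_j\odot e'_k$ with $b_{j,k},B_{j,k}\in\Lambda_N^{(ev)}$,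 $b'_{j,k}\in\Lambda_N^{(odd)}$, $e'_j\odot e'_k=\frac12(e'_je'_k+e'_ke'_j)$. Exponentials: let $V$ be the real vector space with basis $f_1,\dots,f_N,e_1,\dots,e_m,e'_1,\dots,e'_{2n}$, $T(V)$ its tensor algebra and $I\subset T(V)$ the two-sided ideal generated by $f_j\otimes f_k+f_k\otimes f_j$, $f_j\otimes e_k-e_k\otimes f_j$, $f_j\otimes e'_k-e'_k\otimes f_j$, $e_j\otimes e_k+e_k\otimes e_j+2\delta_{j,k}$, $e_j\otimes e'_k+e'_k\otimes e_j$, $e'_j\otimes e'_k-e'_k\otimes e'_j-g_{j,k}$. $T(V)/I$ is regarded as the extension of $\Lambda_N\otimes\mathcal C_{m,2n}$ that also contains infinite sums of terms $a\,e_{j_1}\cdots e_{j_k}e_1'^{\alpha_1}\cdots e_{2n}'^{\alpha_{2n}}$ ($a\in\Lambda_N$), and the exponential $e^{B}=\sum_{j\ge0}B^j/j!$ of any $B\in\Lambda_N\otimes\mathcal C_{m,2n}$ is taken there. $\mathrm{Spin}(m|2n)(\Lambda_N)=\{e^{B_1}\cdots e^{B_k}:B_1,\dots,B_k\in\mathbb R_{m|2n}^{(2)E}(\Lambda_N),\ k\in\mathbb N\}\subset T(V)/I$. The group homomorphism $h$ from $\mathrm{Spin}(m|2n)(\Lambda_N)$ to $\mathrm{SO}_0$ is determined by $h(e^B)[\mathbf x]=e^B\mathbf xe^{-B}$, $B\in\mathbb R_{m|2n}^{(2)E}(\Lambda_N)$, $\mathbf x\in\mathbf S$; $h(s)$ is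 identified with the supermatrix representing this linear action on the coordinate column $(x_1,\dots,x_m,x'_1,\dots,x'_{2n})^T$. $\mathrm{Mat}(m|2n)(\Lambda_N)$ is the algebra of supermatrices $M=\begin{pmatrix}A&B'\\C'&D\end{pmatrix}$ with $A,D$ ($m\times m$, $2n\times2n$) over $\Lambda_N^{(ev)}$ and $B',C'$ over $\Lambda_N^{(odd)}$; $M^{ST}=\begin{pmatrix}A^T&C'^T\\-B'^T&D^T\end{pmatrix}$; $\mathrm{sdet}(M)=\det(A-B'D^{-1}C')\det(D)^{-1}$ for invertible $M$. $\Omega_{2n}$ is block diagonal with $n$ blocks $\begin{pmatrix}0&1\\-1&0\end{pmatrix}$, $\mathbf Q=\begin{pmatrix}I_m&0\\0&-\frac12\Omega_{2n}\end{pmatrix}$, and $\mathrm{SO}_0=\{M\in\mathrm{Mat}(m|2n)(\Lambda_N):M^{ST}\mathbf QM=\mathbf Q,\ \mathrm{sdet}(M)=1\}$.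
   Formalization: Exponentials are formal sums of elements of T(V)/I with the Cauchy product, not identified further, and only s x s^{-1} is summed; as infinite sums of ordered monomials e^B need not exist: exp(t/2(e'_1²+e'_2²)) has constant term (cos t)^{-1/2}, divergent for t>π/2. *)

theory Defs
  imports "HOL-Analysis.Analysis" "HOL-Library.Poly_Mapping"
    "HOL-Computational_Algebra.Formal_Power_Series"
begin

text \<open>The index set \<open>{1,\<dots>,2n}\<close>: \<open>Od j\<close> stands for \<open>2j-1\<close> and \<open>Ev j\<close> for \<open>2j\<close>,
  with the order of the integers they stand for.\<close>

datatype 'n dbl = Od 'n | Ev 'n

instance dbl :: (finite) finite
proof
  have "x \<in> range Od \<union> range Ev" for x :: "'a::finite dbl"
    by (cases x) auto
  then have "(UNIV :: 'a::finite dbl set) = range Od \<union> range Ev"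
    by blast
  moreover have "finite (range Od \<union> range Ev :: 'a::finite dbl set)"
    by (intro finite_UnI finite_imageI finite)
  ultimately show "finite (UNIV :: 'a::finite dbl set)" by metis
qed

fun half :: "'n dbl \<Rightarrow> 'n" where
  "half (Od j) = j"
| "half (Ev j) = j"

fun is_Ev :: "'n dbl \<Rightarrow> bool" where
  "is_Ev (Od j) = False"
| "is_Ev (Ev j) = True"

instantiation dbl :: (linorder) linorder
begin

definition "(p :: 'a dbl) \<le> q \<longleftrightarrow>
  half p < half q \<or> half p = half q \<and> (is_Ev p \<longrightarrow> is_Ev q)"
definition "(p :: 'a dbl) < q \<longleftrightarrow> p \<le> q \<and> \<not> q \<le> p"

instance
proof
  fix x y z :: "'a dbl"
  show "(x < y) = (x \<le> y \<and> \<not> y \<le> x)" by (simp add: less_dbl_def)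
  show "x \<le> x" by (simp add: less_eq_dbl_def)
  show "x \<le> y \<Longrightarrow> y \<le> z \<Longrightarrow> x \<le> z" by (auto simp: less_eq_dbl_def)
  show "x \<le> y \<Longrightarrow> y \<le> x \<Longrightarrow> x = y"
    by (cases x; cases y) (auto simp: less_eq_dbl_def)
  show "x \<le> y \<or> y \<le> x" by (auto simp: less_eq_dbl_def)
qed

end

text \<open>\<open>gform\<close> is \<open>g\<close>; it is also the entry function of \<open>\<Omega>\<close>.\<close>

fun gform :: "'n dbl \<Rightarrow> 'n dbl \<Rightarrow> real" where
  "gform (Od j) (Ev k) = (if j = k then 1 else 0)"
| "gform (Ev j) (Od k) = (if j = k then -1 else 0)"
| "gform (Od j) (Od k) = 0"
| "gform (Ev j) (Ev k) = 0"

text \<open>The tensor algebra of the real vector space with basis \<open>'g\<close> is realised as the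
  monoid algebra of the free monoid of words over \<open>'g\<close>.\<close>

datatype 'g free_mon = FM "'g list"

instantiation free_mon :: (type) monoid_add
begin

definition "0 = FM []"
fun plus_free_mon :: "'a free_mon \<Rightarrow> 'a free_mon \<Rightarrow> 'a free_mon" where
  "FM u + FM v = FM (u @ v)"

instance
proof
  fix a b c :: "'a free_mon"
  show "a + b + c = a + (b + c)" by (cases a; cases b; cases c) simp
  show "0 + a = a" "a + 0 = a" by (cases a; simp add: zero_free_mon_def)+
qed

end

type_synonym 'g tensor = "'g free_mon \<Rightarrow>\<^sub>0 real"

definition tgen :: "'g \<Rightarrow> 'g tensor" where
  "tgen a = Poly_Mapping.single (FM [a]) 1"

definition tconst :: "real \<Rightarrow> 'g tensor" where
  "tconst c = Poly_Mapping.single 0 c"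

inductive_set gen_ideal :: "'a::ring_1 set \<Rightarrow> 'a set" for R where
  zero: "0 \<in> gen_ideal R"
| add: "x \<in> gen_ideal R \<Longrightarrow> y \<in> gen_ideal R \<Longrightarrow> x + y \<in> gen_ideal R"
| gen: "r \<in> R \<Longrightarrow> a * r * b \<in> gen_ideal R"

text \<open>The types \<open>'f\<close>, \<open>'m\<close>, \<open>'n\<close>, \<open>'s\<close> play the roles of \<open>{1,\<dots>,N}\<close>, \<open>{1,\<dots>,m}\<close>, \<open>{1,\<dots>,n}\<close>
  and of the set of supervector variables. Besides \<open>f\<^sub>j\<close>, \<open>e\<^sub>j\<close>, \<open>e'\<^sub>j\<close> there are, for every
  variable \<open>v\<close>, its commuting coordinates \<open>GX v j\<close> and its anticommuting coordinates
  \<open>GX' v p\<close>, so that \<open>T(V)/I\<close> and the supervectors live in one algebra.\<close>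

datatype ('f, 'm, 'n, 's) gen =
  GF 'f | GE 'm | GE' "'n dbl" | GX 's 'm | GX' 's "'n dbl"

inductive_set relators :: "('f, 'm, 'n, 's) gen tensor set" where
  ff: "tgen (GF j) * tgen (GF k) + tgen (GF k) * tgen (GF j) \<in> relators"
| fe: "tgen (GF j) * tgen (GE k) - tgen (GE k) * tgen (GF j) \<in> relators"
| fe': "tgen (GF j) * tgen (GE' q) - tgen (GE' q) * tgen (GF j) \<in> relators"
| ee: "tgen (GE j) * tgen (GE k) + tgen (GE k) * tgen (GE j)
        + tconst (if j = k then 2 else 0) \<in> relators"
| ee': "tgen (GE j) * tgen (GE' q) + tgen (GE' q) * tgen (GE j) \<in> relators"
| e'e': "tgen (GE' p) * tgen (GE' q) - tgen (GE' q) * tgen (GE' p)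
        - tconst (gform p q) \<in> relators"
| x_central: "tgen (GX v j) * tgen a - tgen a * tgen (GX v j) \<in> relators"
| x'f: "tgen (GX' v p) * tgen (GF k) + tgen (GF k) * tgen (GX' v p) \<in> relators"
| x'x': "tgen (GX' v p) * tgen (GX' w q) + tgen (GX' w q) * tgen (GX' v p) \<in> relators"
| x'e: "tgen (GX' v p) * tgen (GE k) - tgen (GE k) * tgen (GX' v p) \<in> relators"
| x'e': "tgen (GX' v p) * tgen (GE' q) - tgen (GE' q) * tgen (GX' v p) \<in> relators"

lemma gen_ideal_mult_left: "x \<in> gen_ideal R \<Longrightarrow> c * x \<in> gen_ideal R"
proof (induction rule: gen_ideal.induct)
  case zero then show ?case by (simp add: gen_ideal.zero)
next
  case (add x y) then show ?case by (simp add: distrib_left gen_ideal.add)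
next
  case (gen r a b)
  then have "(c * a) * r * b \<in> gen_ideal R" by (rule gen_ideal.gen)
  then show ?case by (simp add: mult.assoc)
qed

lemma gen_ideal_mult_right: "x \<in> gen_ideal R \<Longrightarrow> x * c \<in> gen_ideal R"
proof (induction rule: gen_ideal.induct)
  case zero then show ?case by (simp add: gen_ideal.zero)
next
  case (add x y) then show ?case by (simp add: distrib_right gen_ideal.add)
next
  case (gen r a b)
  then have "a * r * (b * c) \<in> gen_ideal R" by (rule gen_ideal.gen)
  then show ?case by (simp add: mult.assoc)
qed

lemma gen_ideal_uminus: "x \<in> gen_ideal R \<Longrightarrow> - x \<in> gen_ideal R"
  using gen_ideal_mult_left[of x R "-1"] by simp

lemma gen_ideal_diff: "x \<in> gen_ideal R \<Longrightarrow> y \<in> gen_ideal R \<Longrightarrow> x - y \<in> gen_ideal R"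
  using gen_ideal.add[of x R "- y"] gen_ideal_uminus[of y R] by simp

lemma gen_ideal_eqI: "x = y \<Longrightarrow> x - y \<in> gen_ideal R"
  by (simp add: gen_ideal.zero)

quotient_type ('f, 'm, 'n, 's) superalg =
  "('f, 'm, 'n, 's) gen tensor" / "\<lambda>x y. x - y \<in> gen_ideal relators"
proof (rule equivpI)
  show "reflp (\<lambda>x y :: ('f, 'm, 'n, 's) gen tensor. x - y \<in> gen_ideal relators)"
    by (simp add: reflp_def gen_ideal.zero)
  show "symp_on UNIV (\<lambda>x y :: ('f, 'm, 'n, 's) gen tensor. x - y \<in> gen_ideal relators)"
    unfolding symp_on_def using gen_ideal_uminus by fastforce
  show "transp (\<lambda>x y :: ('f, 'm, 'n, 's) gen tensor. x - y \<in> gen_ideal relators)"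
    unfolding transp_def using gen_ideal.add by fastforce
qed

lemma tconst_simps:
  "tconst 0 = 0" "tconst 1 = 1" "tconst (a + b) = tconst a + tconst b"
  "tconst a * tconst b = tconst (a * b)"
  by (simp_all add: tconst_def single_add mult_single)

lemma tensor_induct [case_names single sum]:
  assumes "\<And>w c. P (Poly_Mapping.single w c)"
    and "\<And>s t. P s \<Longrightarrow> P t \<Longrightarrow> P (s + t)"
  shows "P (t :: 'g tensor)"
proof (induction t rule: update_induct)
  case const
  show ?case using assms(1)[of 0 0] by simp
next
  case (update t w c)
  then have "Poly_Mapping.update w c t = t + Poly_Mapping.single w c"
    by (intro poly_mapping_eqI)
      (auto simp: lookup_update lookup_add lookup_single when_def in_keys_iff)
  with update assms show ?case by metis
qed

lemma tconst_central: "tconst c * x = x * tconst c"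
proof (induction x rule: tensor_induct)
  case (single k v)
  show ?case by (simp add: tconst_def mult_single mult.commute)
next
  case (sum f g)
  then show ?case by (simp add: algebra_simps)
qed

lemma tconst_shift: "s * (tconst c * t) = tconst c * (s * t)"
proof -
  have "s * (tconst c * t) = (s * tconst c) * t" by (simp only: mult.assoc)
  also have "\<dots> = (tconst c * s) * t" by (simp only: tconst_central[of c s])
  finally show ?thesis by (simp only: mult.assoc)
qed

instantiation superalg :: (type, type, type, type) real_algebra
begin

lift_definition zero_superalg :: "('a, 'b, 'c, 'd) superalg" is 0 .

lift_definition plus_superalg ::
  "('a, 'b, 'c, 'd) superalg \<Rightarrow> ('a, 'b, 'c, 'd) superalg \<Rightarrow> ('a, 'b, 'c, 'd) superalg"
  is "(+)"
proof -
  fix a b c d :: "('a, 'b, 'c, 'd) gen tensor"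
  assume "a - b \<in> gen_ideal relators" "c - d \<in> gen_ideal relators"
  then have "(a - b) + (c - d) \<in> gen_ideal relators" by (rule gen_ideal.add)
  then show "a + c - (b + d) \<in> gen_ideal relators" by (simp only: add_diff_add)
qed

lift_definition uminus_superalg :: "('a, 'b, 'c, 'd) superalg \<Rightarrow> ('a, 'b, 'c, 'd) superalg"
  is uminus
proof -
  fix a b :: "('a, 'b, 'c, 'd) gen tensor"
  assume "a - b \<in> gen_ideal relators"
  then show "- a - - b \<in> gen_ideal relators"
    unfolding minus_diff_minus by (rule gen_ideal_uminus)
qed

lift_definition minus_superalg ::
  "('a, 'b, 'c, 'd) superalg \<Rightarrow> ('a, 'b, 'c, 'd) superalg \<Rightarrow> ('a, 'b, 'c, 'd) superalg"
  is "(-)"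
proof -
  fix a b c d :: "('a, 'b, 'c, 'd) gen tensor"
  assume "a - b \<in> gen_ideal relators" "c - d \<in> gen_ideal relators"
  then have "(a - b) - (c - d) \<in> gen_ideal relators" by (rule gen_ideal_diff)
  then show "a - c - (b - d) \<in> gen_ideal relators" by (simp add: algebra_simps)
qed

lift_definition times_superalg ::
  "('a, 'b, 'c, 'd) superalg \<Rightarrow> ('a, 'b, 'c, 'd) superalg \<Rightarrow> ('a, 'b, 'c, 'd) superalg"
  is "(*)"
proof -
  fix a b c d :: "('a, 'b, 'c, 'd) gen tensor"
  assume "a - b \<in> gen_ideal relators" "c - d \<in> gen_ideal relators"
  then have "(a - b) * c + b * (c - d) \<in> gen_ideal relators"
    by (intro gen_ideal.add gen_ideal_mult_left gen_ideal_mult_right)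
  then show "a * c - b * d \<in> gen_ideal relators" by (simp add: algebra_simps)
qed

lift_definition scaleR_superalg ::
  "real \<Rightarrow> ('a, 'b, 'c, 'd) superalg \<Rightarrow> ('a, 'b, 'c, 'd) superalg"
  is "\<lambda>c x. tconst c * x"
  unfolding right_diff_distrib[symmetric] by (rule gen_ideal_mult_left)

instance
proof
  fix a b c :: "('a, 'b, 'c, 'd) superalg" and r s :: real
  show "a + b + c = a + (b + c)" by transfer (rule gen_ideal_eqI, rule add.assoc)
  show "a + b = b + a" by transfer (rule gen_ideal_eqI, rule add.commute)
  show "0 + a = a" by transfer (rule gen_ideal_eqI, rule add_0)
  show "- a + a = 0" by transfer (rule gen_ideal_eqI, rule left_minus)
  show "a - b = a + - b" by transfer (rule gen_ideal_eqI, rule diff_conv_add_uminus)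
  show "a * b * c = a * (b * c)" by transfer (rule gen_ideal_eqI, rule mult.assoc)
  show "(a + b) * c = a * c + b * c" by transfer (rule gen_ideal_eqI, rule distrib_right)
  show "a * (b + c) = a * b + a * c" by transfer (rule gen_ideal_eqI, rule distrib_left)
  show "r *\<^sub>R (a + b) = r *\<^sub>R a + r *\<^sub>R b"
    by transfer (rule gen_ideal_eqI, rule distrib_left)
  show "(r + s) *\<^sub>R a = r *\<^sub>R a + s *\<^sub>R a"
    by transfer (rule gen_ideal_eqI, simp only: tconst_simps distrib_right)
  show "r *\<^sub>R s *\<^sub>R a = (r * s) *\<^sub>R a"
    by transfer (rule gen_ideal_eqI, simp only: tconst_simps mult.assoc[symmetric])
  show "1 *\<^sub>R a = a" by transfer (rule gen_ideal_eqI, simp only: tconst_simps mult_1_left)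
  show "r *\<^sub>R a * b = r *\<^sub>R (a * b)" by transfer (rule gen_ideal_eqI, rule mult.assoc)
  show "a * r *\<^sub>R b = r *\<^sub>R (a * b)" by transfer (rule gen_ideal_eqI, rule tconst_shift)
qed

end

instantiation superalg :: (type, type, type, type) monoid_mult
begin

lift_definition one_superalg :: "('a, 'b, 'c, 'd) superalg" is 1 .

instance
proof
  fix a :: "('a, 'b, 'c, 'd) superalg"
  show "1 * a = a" by transfer (simp add: gen_ideal.zero)
  show "a * 1 = a" by transfer (simp add: gen_ideal.zero)
qed

end


text \<open>That the quotient is not trivial is seen on a representation: \<open>e\<^sub>j\<close> acts by a
  Jordan--Wigner operator, \<open>e'\<^sub>p\<close> by a derivative or a multiplication operator on power
  series, times the Clifford grading operator, and the other generators act by zero.\<close>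

definition jw :: "'m::linorder \<Rightarrow> 'm set \<Rightarrow> real" where
  "jw j J = (-1) ^ card {k \<in> J. k < j} * (if j \<in> J then 1 else -1)"

definition toggle :: "'m set \<Rightarrow> 'm \<Rightarrow> 'm set" where
  "toggle J j = (if j \<in> J then J - {j} else insert j J)"

type_synonym ('m, 'n) fock = "'m set \<Rightarrow> ('n \<Rightarrow> nat) \<Rightarrow> real"

fun weyl :: "'n dbl \<Rightarrow> (('n \<Rightarrow> nat) \<Rightarrow> real) \<Rightarrow> ('n \<Rightarrow> nat) \<Rightarrow> real" where
  "weyl (Od j) u \<alpha> = real (\<alpha> j + 1) * u (\<alpha>(j := \<alpha> j + 1))"
| "weyl (Ev j) u \<alpha> = (if \<alpha> j = 0 then 0 else u (\<alpha>(j := \<alpha> j - 1)))"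

fun fock_op :: "('f, 'm::{finite,linorder}, 'n, 's) gen \<Rightarrow> ('m, 'n) fock \<Rightarrow> ('m, 'n) fock" where
  "fock_op (GE j) \<psi> = (\<lambda>J \<alpha>. jw j J * \<psi> (toggle J j) \<alpha>)"
| "fock_op (GE' p) \<psi> = (\<lambda>J \<alpha>. (-1) ^ card J * weyl p (\<psi> J) \<alpha>)"
| "fock_op _ \<psi> = (\<lambda>J \<alpha>. 0)"

fun fock_word :: "('f, 'm::{finite,linorder}, 'n, 's) gen free_mon \<Rightarrow> ('m, 'n) fock \<Rightarrow> ('m, 'n) fock" where
  "fock_word (FM w) = foldr fock_op w"

definition fock_act :: "('f, 'm::{finite,linorder}, 'n, 's) gen tensor \<Rightarrow> ('m, 'n) fock \<Rightarrow> ('m, 'n) fock" where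
  "fock_act t \<psi> = (\<lambda>J \<alpha>. Sum_any (\<lambda>w. Poly_Mapping.lookup t w * fock_word w \<psi> J \<alpha>))"

lemma fock_word_add: "fock_word (u + v) \<psi> = fock_word u (fock_word v \<psi>)"
  by (cases u; cases v) simp

lemma weyl_lin:
  "weyl p (\<lambda>\<alpha>. c * u \<alpha> + d * v \<alpha>) \<beta> = c * weyl p u \<beta> + d * weyl p v \<beta>"
  by (cases p) (simp_all add: algebra_simps)

lemma fock_op_lin:
  "fock_op g (\<lambda>J \<alpha>. c * \<psi> J \<alpha> + d * \<eta> J \<alpha>)
    = (\<lambda>J \<alpha>. c * fock_op g \<psi> J \<alpha> + d * fock_op g \<eta> J \<alpha>)"
  by (cases g) (simp_all add: fun_eq_iff weyl_lin algebra_simps)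

lemma fock_word_lin:
  "fock_word w (\<lambda>J \<alpha>. c * \<psi> J \<alpha> + d * \<eta> J \<alpha>)
    = (\<lambda>J \<alpha>. c * fock_word w \<psi> J \<alpha> + d * fock_word w \<eta> J \<alpha>)"
proof (cases w)
  case (FM u)
  have "foldr fock_op u (\<lambda>J \<alpha>. c * \<psi> J \<alpha> + d * \<eta> J \<alpha>)
    = (\<lambda>J \<alpha>. c * foldr fock_op u \<psi> J \<alpha> + d * foldr fock_op u \<eta> J \<alpha>)"
    by (induction u) (simp_all add: fock_op_lin)
  with FM show ?thesis by simp
qed

lemma fin_lookup: "finite {w. Poly_Mapping.lookup t w * h w \<noteq> (0::real)}"
  by (rule finite_subset[OF _ finite_lookup[of t]]) auto

lemma fock_act_0: "fock_act 0 \<psi> = (\<lambda>J \<alpha>. 0)"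
  by (simp add: fock_act_def)

lemma fock_act_add: "fock_act (s + t) \<psi> = (\<lambda>J \<alpha>. fock_act s \<psi> J \<alpha> + fock_act t \<psi> J \<alpha>)"
  by (simp add: fock_act_def lookup_add distrib_right Sum_any.distrib fin_lookup)

lemma fock_act_uminus: "fock_act (- t) \<psi> = (\<lambda>J \<alpha>. - fock_act t \<psi> J \<alpha>)"
proof -
  have "(\<lambda>J \<alpha>. fock_act t \<psi> J \<alpha> + fock_act (- t) \<psi> J \<alpha>) = (\<lambda>J \<alpha>. 0)"
    using fock_act_add[of t "- t" \<psi>] by (simp add: fock_act_0)
  then show ?thesis
    by (simp add: fun_eq_iff add_eq_0_iff)
qed

lemma fock_act_diff: "fock_act (s - t) \<psi> = (\<lambda>J \<alpha>. fock_act s \<psi> J \<alpha> - fock_act t \<psi> J \<alpha>)"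
  using fock_act_add[of s "- t" \<psi>] by (simp add: fock_act_uminus)

lemma fock_act_single:
  "fock_act (Poly_Mapping.single w c) \<psi> = (\<lambda>J \<alpha>. c * fock_word w \<psi> J \<alpha>)"
proof -
  have "Sum_any (\<lambda>v. Poly_Mapping.lookup (Poly_Mapping.single w c) v * h v) = c * h w" for h :: "_ \<Rightarrow> real"
  proof -
    have "Sum_any (\<lambda>v. Poly_Mapping.lookup (Poly_Mapping.single w c) v * h v)
        = (\<Sum>v\<in>{w}. Poly_Mapping.lookup (Poly_Mapping.single w c) v * h v)"
      by (rule Sum_any.expand_superset) (auto simp: lookup_single when_def)
    then show ?thesis by simp
  qed
  then show ?thesis by (simp add: fock_act_def)
qed

lemma fock_act_lin:
  "fock_act t (\<lambda>J \<alpha>. c * \<psi> J \<alpha> + d * \<eta> J \<alpha>)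
    = (\<lambda>J \<alpha>. c * fock_act t \<psi> J \<alpha> + d * fock_act t \<eta> J \<alpha>)"
proof (induction t rule: tensor_induct)
  case (single k v)
  then show ?case by (simp add: fock_act_single fock_word_lin fun_eq_iff algebra_simps)
next
  case (sum f g)
  then show ?case by (simp add: fock_act_add fun_eq_iff algebra_simps)
qed

lemma fock_act_mult: "fock_act (s * t) \<psi> = fock_act s (fock_act t \<psi>)"
proof (induction s rule: tensor_induct)
  case (single k v)
  show ?case
  proof (induction t rule: tensor_induct)
    case (single k' v')
    have "fock_word k (\<lambda>J \<alpha>. v' * fock_word k' \<psi> J \<alpha>)
        = (\<lambda>J \<alpha>. v' * fock_word k (fock_word k' \<psi>) J \<alpha>)"
      using fock_word_lin[of k v' "fock_word k' \<psi>" 0] by simp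
    then show ?case by (simp add: mult_single fock_act_single fock_word_add fun_eq_iff)
  next
    case (sum f g)
    show ?case
      using fock_act_lin[of "Poly_Mapping.single k v" 1 "fock_act f \<psi>" 1 "fock_act g \<psi>"]
      by (simp add: distrib_left fock_act_add sum)
  qed
next
  case (sum f g)
  then show ?case by (simp add: distrib_right fock_act_add)
qed

lemma fock_act_tgen: "fock_act (tgen a) \<psi> = fock_op a \<psi>"
  by (simp add: tgen_def fock_act_single)

lemma fock_act_tconst: "fock_act (tconst c) \<psi> = (\<lambda>J \<alpha>. c * \<psi> J \<alpha>)"
  by (simp add: tconst_def fock_act_single zero_free_mon_def)

lemma toggle_simps:
  "toggle (toggle J j) j = J" "toggle (toggle J j) k = toggle (toggle J k) j"
  by (auto simp: toggle_def)

lemma card_toggle: "(-1::real) ^ card (toggle J j) = - ((-1) ^ card (J :: 'm::finite set))"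
proof (cases "j \<in> J")
  case True
  then have "card J = Suc (card (J - {j}))" by (intro card.remove) simp_all
  then have "(-1::real) ^ card J = - ((-1) ^ card (J - {j}))" by (simp only: power_Suc mult_minus1)
  moreover have "toggle J j = J - {j}" using True by (simp add: toggle_def)
  ultimately show ?thesis by (simp only: minus_minus)
next
  case False
  then show ?thesis by (simp add: toggle_def)
qed

lemma jw_toggle_self: "jw j J * jw j (toggle J j) = -1"
proof -
  have "{k \<in> toggle J j. k < j} = {k \<in> J. k < j}" by (auto simp: toggle_def)
  moreover have "j \<in> toggle J j \<longleftrightarrow> j \<notin> J" by (auto simp: toggle_def)
  ultimately show ?thesis by (cases "j \<in> J") (simp_all add: jw_def)
qed

lemma jw_toggle_less:
  fixes J :: "'m::{finite,linorder} set"
  assumes "j < k"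
  shows "jw k (toggle J j) = - jw k J" "jw j (toggle J k) = jw j J"
proof -
  have "{l \<in> toggle J j. l < k} = toggle {l \<in> J. l < k} j"
    using assms by (auto simp: toggle_def)
  moreover have "k \<in> toggle J j \<longleftrightarrow> k \<in> J" using assms by (auto simp: toggle_def)
  ultimately show "jw k (toggle J j) = - jw k J" by (simp add: jw_def card_toggle)
  have "{l \<in> toggle J k. l < j} = {l \<in> J. l < j}"
    using assms by (auto simp: toggle_def)
  moreover have "j \<in> toggle J k \<longleftrightarrow> j \<in> J" using assms by (auto simp: toggle_def)
  ultimately show "jw j (toggle J k) = jw j J" by (simp add: jw_def)
qed

lemma jw_anticomm:
  fixes J :: "'m::{finite,linorder} set"
  assumes "j \<noteq> k"
  shows "jw j J * jw k (toggle J j) = - (jw k J * jw j (toggle J k))"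
  using assms jw_toggle_less[of j k J] jw_toggle_less[of k j J] by (cases "j < k") auto

lemma fock_op_zero: "fock_op g (\<lambda>J \<alpha>. 0) = (\<lambda>J \<alpha>. 0)"
  using fock_op_lin[of g 0 "\<lambda>J \<alpha>. 0" 0 "\<lambda>J \<alpha>. 0"] by simp

lemma weyl_scale: "weyl p (\<lambda>\<beta>. c * u \<beta>) \<alpha> = c * weyl p u \<alpha>"
  by (cases p) simp_all

lemma weyl_commutator: "weyl p (weyl q u) \<alpha> - weyl q (weyl p u) \<alpha> = gform p q * u \<alpha>"
proof (cases p; cases q)
  fix j k assume pq: "p = Od j" "q = Od k"
  show ?thesis
    using pq fun_upd_twist[of j k \<alpha> "\<alpha> j + 1" "\<alpha> k + 1"] by (cases "j = k") simp_all
next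
  fix j k assume pq: "p = Od j" "q = Ev k"
  show ?thesis
    using pq fun_upd_twist[of j k \<alpha> "\<alpha> j + 1" "\<alpha> k - 1"]
    by (cases "j = k") (simp_all add: algebra_simps)
next
  fix j k assume pq: "p = Ev j" "q = Od k"
  show ?thesis
    using pq fun_upd_twist[of j k \<alpha> "\<alpha> j - 1" "\<alpha> k + 1"]
    by (cases "j = k") (simp_all add: algebra_simps)
next
  fix j k assume pq: "p = Ev j" "q = Ev k"
  show ?thesis
    using pq fun_upd_twist[of j k \<alpha> "\<alpha> j - 1" "\<alpha> k - 1"] by (cases "j = k") simp_all
qed

lemma fock_relators: "r \<in> relators \<Longrightarrow> fock_act r \<psi> = (\<lambda>J \<alpha>. 0)"
proof (induction rule: relators.induct)
  case (ee j k)
  show ?case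
  proof (cases "j = k")
    case True
    have "jw k J * (jw k (toggle J k) * a) = - a" for J and a :: real
      using jw_toggle_self[of k J] by (metis mult.assoc mult_minus1)
    with True show ?thesis
      by (simp add: fock_act_add fock_act_mult fock_act_tgen fock_act_tconst toggle_simps fun_eq_iff)
  next
    case False
    have "jw j J * (jw k (toggle J j) * a) = - (jw k J * (jw j (toggle J k) * a))"
      for J and a :: real
      using jw_anticomm[OF False, of J] by (metis mult.assoc mult_minus_left)
    with False show ?thesis
      by (simp add: fock_act_add fock_act_mult fock_act_tgen fock_act_tconst
          toggle_simps(2)[of _ k j] fun_eq_iff)
  qed
next
  case (ee' j q)
  show ?case
    by (simp add: fock_act_add fock_act_mult fock_act_tgen card_toggle weyl_scale fun_eq_iff)
next
  case (e'e' p q)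
  have "(-1) ^ card J * ((-1) ^ card J * a) = a" for J :: "'b set" and a :: real
    by (rule left_minus_one_mult_self)
  then show ?case
    using weyl_commutator[of p q]
    by (simp add: fock_act_diff fock_act_mult fock_act_tgen fock_act_tconst weyl_scale
        fun_eq_iff)
qed (simp_all add: fock_act_add fock_act_diff fock_act_mult fock_act_tgen fock_op_zero)

lemma fock_gen_ideal: "x \<in> gen_ideal relators \<Longrightarrow> fock_act x \<psi> = (\<lambda>J \<alpha>. 0)"
proof (induction arbitrary: \<psi> rule: gen_ideal.induct)
  case zero
  show ?case by (rule fock_act_0)
next
  case (add x y)
  then show ?case by (simp add: fock_act_add)
next
  case (gen r a b)
  then show ?case
    using fock_act_lin[of a 0 "\<lambda>J \<alpha>. 0" 0 "\<lambda>J \<alpha>. 0"] by (simp add: fock_act_mult fock_relators)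
qed

instance superalg :: (type, "{finite,linorder}", type, type) real_algebra_1
proof
  have "fock_act (1 :: ('a, 'b, 'c, 'd) gen tensor) (\<lambda>J \<alpha>. 1) = (\<lambda>J \<alpha>. 1)"
    using fock_act_tconst[of 1 "\<lambda>J \<alpha>. 1"] by (simp add: tconst_simps)
  then have "fock_act (1 :: ('a, 'b, 'c, 'd) gen tensor) (\<lambda>J \<alpha>. 1) \<noteq> (\<lambda>J \<alpha>. 0)"
    by (simp add: fun_eq_iff)
  then have *: "(1 :: ('a, 'b, 'c, 'd) gen tensor) \<notin> gen_ideal relators"
    using fock_gen_ideal by blast
  have "(0 :: ('a, 'b, 'c, 'd) gen tensor) - 1 \<notin> gen_ideal relators"
  proof
    assume "(0 :: ('a, 'b, 'c, 'd) gen tensor) - 1 \<in> gen_ideal relators"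
    then have "- (0 - (1 :: ('a, 'b, 'c, 'd) gen tensor)) \<in> gen_ideal relators"
      by (rule gen_ideal_uminus)
    with * show False by simp
  qed
  then show "(0 :: ('a, 'b, 'c, 'd) superalg) \<noteq> 1"
    by transfer
qed

definition sgen :: "('f, 'm, 'n, 's) gen \<Rightarrow> ('f, 'm, 'n, 's) superalg" where
  "sgen a = abs_superalg (tgen a)"

definition f_mono :: "'f::{finite,linorder} set \<Rightarrow> ('f, 'm, 'n, 's) superalg" where
  "f_mono A = prod_list (map (\<lambda>k. sgen (GF k)) (sorted_list_of_set A))"

definition grass_ev :: "('f::{finite,linorder}, 'm, 'n, 's) superalg set" where
  "grass_ev = span {f_mono A | A. even (card A)}"

definition grass_odd :: "('f::{finite,linorder}, 'm, 'n, 's) superalg set" where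
  "grass_odd = span {f_mono A | A. odd (card A)}"

abbreviation e_gen :: "'m \<Rightarrow> ('f, 'm, 'n, 's) superalg" where
  "e_gen j \<equiv> sgen (GE j)"

abbreviation e'_gen :: "'n dbl \<Rightarrow> ('f, 'm, 'n, 's) superalg" where
  "e'_gen p \<equiv> sgen (GE' p)"

fun unit_vec :: "'m + 'n dbl \<Rightarrow> ('f, 'm, 'n, 's) superalg" where
  "unit_vec (Inl j) = e_gen j"
| "unit_vec (Inr p) = e'_gen p"

fun coord :: "'s \<Rightarrow> 'm + 'n dbl \<Rightarrow> ('f, 'm, 'n, 's) superalg" where
  "coord v (Inl j) = sgen (GX v j)"
| "coord v (Inr p) = sgen (GX' v p)"

definition supervector :: "'s \<Rightarrow> ('f, 'm::finite, 'n::finite, 's) superalg" where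
  "supervector v = (\<Sum>i\<in>UNIV. coord v i * unit_vec i)"

definition bivectors ::
  "('f::{finite,linorder}, 'm::{finite,linorder}, 'n::{finite,linorder}, 's) superalg set" where
  "bivectors =
    {(\<Sum>(j, k) \<in> {(j, k). j < k}. b j k * e_gen j * e_gen k)
     + (\<Sum>j\<in>UNIV. \<Sum>q\<in>UNIV. b' j q * e_gen j * e'_gen q)
     + (\<Sum>(p, q) \<in> {(p, q). p \<le> q}.
          c p q * ((1/2) *\<^sub>R (e'_gen p * e'_gen q + e'_gen q * e'_gen p)))
     | b b' c. (\<forall>j k. b j k \<in> grass_ev) \<and> (\<forall>j q. b' j q \<in> grass_odd)
        \<and> (\<forall>p q. c p q \<in> grass_ev)}"

text \<open>Infinite sums of elements of \<open>T(V)/I\<close> are formal sums \<open>\<Sum>\<^sub>d a\<^sub>d\<close> with summands in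
  \<open>T(V)/I\<close>, multiplied by the Cauchy product; they are the elements of type
  \<open>('f, 'm, 'n, 's) superalg fps\<close>, whose formal variable only keeps the summands apart.
  Summing the exponential series inside an algebra is not an option. For instance, the
  coefficient of \<open>1\<close> in \<open>exp (t/2 * (e'\<^sub>1\<^sup>2 + e'\<^sub>2\<^sup>2))\<close>, in terms of the ordered monomials, is
  the Taylor series of \<open>1/sqrt (cos t)\<close>, which diverges for \<open>t > \<pi>/2\<close>; and the ideal
  generated by the relators in the algebra of all formal tensor series contains \<open>1\<close>,
  because \<open>1 + e\<^sub>1 \<otimes> e\<^sub>1\<close> is invertible there.\<close>

definition superexp :: "('f, 'm::{finite,linorder}, 'n, 's) superalg \<Rightarrow> ('f, 'm, 'n, 's) superalg fps" where
  "superexp B = Abs_fps (\<lambda>d. B ^ d /\<^sub>R fact d)"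

text \<open>The formal sum \<open>u\<close> has the value \<open>a\<close>. If the summands lie in a finite-dimensional
  subspace, as for \<open>s x s\<^sup>-\<^sup>1\<close> below, this is ordinary convergence in that subspace.\<close>

definition has_value :: "('f, 'm, 'n, 's) superalg fps \<Rightarrow> ('f, 'm, 'n, 's) superalg \<Rightarrow> bool" where
  "has_value u a \<longleftrightarrow>
    (\<forall>\<phi> :: ('f, 'm, 'n, 's) superalg \<Rightarrow> real. linear \<phi> \<longrightarrow> (\<lambda>d. \<phi> (fps_nth u d)) sums \<phi> a)"

definition Spin ::
  "('f::{finite,linorder}, 'm::{finite,linorder}, 'n::{finite,linorder}, 's) superalg fps set" where
  "Spin = {prod_list (map superexp Bs) | Bs. Bs \<noteq> [] \<and> set Bs \<subseteq> bivectors}"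

definition ring_inv :: "'a::monoid_mult \<Rightarrow> 'a" where
  "ring_inv a = (THE b. a * b = 1 \<and> b * a = 1)"

type_synonym ('f, 'm, 'n, 's) smat = "('f, 'm, 'n, 's) superalg ^ ('m + 'n dbl) ^ ('m + 'n dbl)"

definition Mat :: "('f::{finite,linorder}, 'm::finite, 'n::finite, 's) smat set" where
  "Mat = {M. (\<forall>i j. M $ Inl i $ Inl j \<in> grass_ev) \<and> (\<forall>i q. M $ Inl i $ Inr q \<in> grass_odd)
    \<and> (\<forall>p j. M $ Inr p $ Inl j \<in> grass_odd) \<and> (\<forall>p q. M $ Inr p $ Inr q \<in> grass_ev)}"

definition supertranspose :: "('f, 'm::finite, 'n::finite, 's) smat \<Rightarrow> ('f, 'm, 'n, 's) smat" where
  "supertranspose M = (\<chi> i j. case (i, j) of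
      (Inr p, Inl l) \<Rightarrow> - M $ j $ i
    | _ \<Rightarrow> M $ j $ i)"

text \<open>The library's determinant needs a commutative ring type. Here it is only applied to
  matrices with entries in \<open>grass_ev\<close>, which commute with each other.\<close>

definition det_comm :: "'a::ring_1 ^ ('k::{finite,linorder}) ^ ('k::{finite,linorder}) \<Rightarrow> 'a" where
  "det_comm A = (\<Sum>p | p permutes (UNIV :: 'k set).
    of_int (sign p) * prod_list (map (\<lambda>i. A $ i $ p i) (sorted_list_of_set UNIV)))"

definition sdet ::
  "('f, 'm::{finite,linorder}, 'n::{finite,linorder}, 's) smat \<Rightarrow> ('f, 'm, 'n, 's) superalg" where
  "sdet M =
    (let A = (\<chi> i j. M $ Inl i $ Inl j);
         B' = (\<chi> i q. M $ Inl i $ Inr q);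
         C' = (\<chi> p j. M $ Inr p $ Inl j);
         D = (\<chi> p q. M $ Inr p $ Inr q)
     in det_comm (A - B' ** matrix_inv D ** C') * ring_inv (det_comm D))"

definition Q_mat :: "('f, 'm::{finite,linorder}, 'n::finite, 's) smat" where
  "Q_mat = (\<chi> i j. case (i, j) of
      (Inl k, Inl l) \<Rightarrow> (if k = l then 1 else 0)
    | (Inr p, Inr q) \<Rightarrow> of_real (- (1/2) * gform p q)
    | _ \<Rightarrow> 0)"

definition SO_0 ::
  "('f::{finite,linorder}, 'm::{finite,linorder}, 'n::{finite,linorder}, 's) smat set" where
  "SO_0 = {M \<in> Mat. supertranspose M ** Q_mat ** M = Q_mat \<and> sdet M = 1}"

definition mat_action ::
  "('f, 'm::finite, 'n::finite, 's) smat \<Rightarrow> 's \<Rightarrow> ('f, 'm, 'n, 's) superalg" where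
  "mat_action M v = (\<Sum>i\<in>UNIV. (\<Sum>k\<in>UNIV. M $ i $ k * coord v k) * unit_vec i)"

text \<open>This extends \<open>h(e\<^sup>B)[x] = e\<^sup>B x e\<^sup>-\<^sup>B\<close> multiplicatively, since
  \<open>(s t) x (s t)\<^sup>-\<^sup>1 = s (t x t\<^sup>-\<^sup>1) s\<^sup>-\<^sup>1\<close>.\<close>

definition spin_hom ::
  "('f::{finite,linorder}, 'm::{finite,linorder}, 'n::{finite,linorder}, 's) superalg fps
    \<Rightarrow> ('f, 'm, 'n, 's) smat" where
  "spin_hom s = (THE M. M \<in> Mat \<and>
    (\<forall>v. has_value (s * fps_const (supervector v) * ring_inv s) (mat_action M v)))"

end

theory Submission
  imports Defs
begin

text \<open>Let \<open>M\<close> be in \<open>SO_0\<close>. Setting all \<open>f\<^sub>k\<close> to zero turns \<open>M\<close> into a real block diagonal matrix, its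
  body, with blocks \<open>A\<close> and \<open>D\<close>. The relation \<open>M\<^sup>S\<^sup>T Q M = Q\<close> makes \<open>A\<close> orthogonal and \<open>D\<close>
  symplectic. A symplectic matrix has determinant \<open>1\<close>, so \<open>sdet M = 1\<close> leaves \<open>det A = 1\<close>
  (\<open>sdet_body\<close>). The two real groups are generated by one-parameter subgroups that are easy to
  exponentiate: plane rotations (\<open>special_orthogonal_rotations\<close>) and symplectic transvections
  (\<open>symplectic_transvections\<close>). After division by the body, \<open>M\<close> is the identity plus terms of
  positive degree in the \<open>f\<^sub>k\<close>. Such an isometry is a product of factors \<open>1 + L\<close>, where \<open>L\<close> is
  skew for \<open>Q\<close> and all its entries are real multiples of one monomial \<open>f\<^sub>A\<close>, so that \<open>L\<^sup>2 = 0\<close>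
  (\<open>spin_image_unipotent\<close>). Hence neither a logarithm nor the exponential of a general
  supermatrix occurs: the exponential series that are summed are those of matrices of square
  zero and of plane rotations, the latter being the series of sine and cosine.

  Every such generator comes from \<open>Spin\<close>. A supermatrix \<open>N\<close> that is skew for \<open>Q\<close> has a superbivector
  \<open>B\<close> with \<open>[B, x] = N x\<close> (\<open>infinitesimal_bivector_of\<close>). Formally
  \<open>e\<^sup>B x e\<^sup>-\<^sup>B = e\<^sup>a\<^sup>d\<^sup>B x\<close>, so the summands of \<open>e\<^sup>B x e\<^sup>-\<^sup>B\<close> are the \<open>N\<^sup>k x / k!\<close>, and multiplying by one more
  exponential amounts to a Cauchy product of supermatrices (\<open>realizes_exp_mult\<close>). Absolute
  convergence of the entries is preserved by Cauchy products, so the values multiply as well.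

  The supermatrix \<open>spin_hom s\<close> is a definite description. It is determined because a formal sum has at most
  one value (\<open>has_value_unique\<close>) and because a supermatrix in \<open>Mat\<close> can be recovered from its
  action on a supervector (\<open>mat_action_eqD\<close>). The latter says that the products
  \<open>f\<^sub>A x\<^sub>k e\<^sub>i\<close> are linearly independent in \<open>T(V)/I\<close>, which is seen on an explicit representation.\<close>

section \<open>Relations in the superalgebra\<close>

lemma abs_relator: "r \<in> relators \<Longrightarrow> abs_superalg r = 0"
  unfolding zero_superalg_def superalg.abs_eq_iff
  using gen_ideal.gen[of r relators 1 1] by simp

lemma abs_tconst:
  "abs_superalg (tconst c) = (c *\<^sub>R 1 :: ('f, 'm::{finite,linorder}, 'n, 's) superalg)"
  unfolding one_superalg_def scaleR_superalg.abs_eq by simp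

lemmas abs_hom = plus_superalg.abs_eq[symmetric] minus_superalg.abs_eq[symmetric]
  times_superalg.abs_eq[symmetric] sgen_def[symmetric]

lemma f_f: "sgen (GF j) * sgen (GF k) = - (sgen (GF k) * sgen (GF j))"
  using abs_relator[OF relators.ff[of j k]] by (simp add: abs_hom add_eq_0_iff2)

lemma f_e: "sgen (GE j) * sgen (GF k) = sgen (GF k) * sgen (GE j)"
  using abs_relator[OF relators.fe[of k j]] by (simp add: abs_hom) (erule sym)

lemma f_e': "sgen (GE' p) * sgen (GF k) = sgen (GF k) * sgen (GE' p)"
  using abs_relator[OF relators.fe'[of k p]] by (simp add: abs_hom) (erule sym)

lemma e_e: "sgen (GE j) * sgen (GE k) = - (sgen (GE k) * sgen (GE j)) -
  ((if j = k then 2 else 0) *\<^sub>R 1 :: ('f, 'm::{finite,linorder}, 'n, 's) superalg)"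
  using abs_relator[OF relators.ee[of j k, where ?'f='f and ?'n='n and ?'s='s]]
  unfolding abs_hom abs_tconst by (simp only: eq_diff_eq eq_neg_iff_add_eq_0 add.assoc add.commute add.left_commute)

lemma e_e': "sgen (GE' q) * sgen (GE j) = - (sgen (GE j) * sgen (GE' q))"
  using abs_relator[OF relators.ee'[of j q]] by (simp add: abs_hom add_eq_0_iff)

lemma e'_e': "sgen (GE' p) * sgen (GE' q) = sgen (GE' q) * sgen (GE' p) +
  (gform p q *\<^sub>R 1 :: ('f, 'm::{finite,linorder}, 'n, 's) superalg)"
  using abs_relator[OF relators.e'e'[of p q, where ?'f='f and ?'m='m and ?'s='s]]
  by (simp add: abs_hom abs_tconst algebra_simps)

lemma x_central: "sgen (GX v j) * sgen a = sgen a * sgen (GX v j)"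
  using abs_relator[OF relators.x_central[of v j a]] by (simp add: abs_hom)

lemma x'_f: "sgen (GX' v p) * sgen (GF k) = - (sgen (GF k) * sgen (GX' v p))"
  using abs_relator[OF relators.x'f[of v p k]] by (simp add: abs_hom add_eq_0_iff2)

lemma x'_e: "sgen (GX' v p) * sgen (GE k) = sgen (GE k) * sgen (GX' v p)"
  using abs_relator[OF relators.x'e[of v p k]] by (simp add: abs_hom)

lemma x'_e': "sgen (GX' v p) * sgen (GE' q) = sgen (GE' q) * sgen (GX' v p)"
  using abs_relator[OF relators.x'e'[of v p q]] by (simp add: abs_hom)

lemma f_square: "sgen (GF k) * sgen (GF k) = (0 :: ('f, 'm::{finite,linorder}, 'n, 's) superalg)"
proof -
  let ?x = "sgen (GF k) * sgen (GF k) :: ('f, 'm, 'n, 's) superalg"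
  have "?x + ?x = 0" using f_f[of k k] by (metis add.right_inverse)
  then have "2 *\<^sub>R ?x = 0" by (simp add: scaleR_2)
  then show ?thesis by simp
qed

section \<open>Grassmann monomials\<close>

abbreviation f_word :: "'f list \<Rightarrow> ('f, 'm::{finite,linorder}, 'n, 's) superalg" where
  "f_word ks \<equiv> prod_list (map (\<lambda>k. sgen (GF k)) ks)"

lemma f_word_repeat: "k \<in> set ks \<Longrightarrow> sgen (GF k) * f_word ks = 0"
proof (induction ks)
  case (Cons l ks)
  show ?case
  proof (cases "k = l")
    case True
    then show ?thesis by (simp add: mult.assoc[symmetric] f_square)
  next
    case False
    then have "sgen (GF k) * f_word ks = (0 :: ('a, 'b, 'c, 'd) superalg)" using Cons by simp
    then show ?thesis
      by (simp add: mult.assoc[symmetric] f_f[of k l]) (simp add: mult.assoc)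
  qed
qed simp

lemma f_word_insort:
  "\<exists>c::real. sgen (GF k) * f_word ks =
    c *\<^sub>R (f_word (insort k ks) :: ('f::linorder, 'm::{finite,linorder}, 'n, 's) superalg)"
proof (induction ks)
  case Nil
  show ?case by (rule exI[of _ 1]) simp
next
  case (Cons l ks)
  then obtain c :: real where c: "sgen (GF k) * f_word ks =
      c *\<^sub>R (f_word (insort k ks) :: ('f, 'm, 'n, 's) superalg)" by blast
  show ?case
  proof (cases "k \<le> l")
    case True
    then show ?thesis by (intro exI[of _ 1]) simp
  next
    case False
    have "sgen (GF k) * f_word (l # ks) =
        (- (sgen (GF l) * (sgen (GF k) * f_word ks)) :: ('f, 'm, 'n, 's) superalg)"
      by (simp add: mult.assoc[symmetric] f_f[of k l])
    also have "\<dots> = (- c) *\<^sub>R f_word (insort k (l # ks))"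
      using False c by simp
    finally show ?thesis by blast
  qed
qed

lemma f_mono_empty: "f_mono {} = (1 :: ('f::{finite,linorder}, 'm::{finite,linorder}, 'n, 's) superalg)"
  by (simp add: f_mono_def)

lemma f_mono_insert:
  fixes A :: "'f::{finite,linorder} set"
  shows "\<exists>c::real. sgen (GF k) * f_mono A =
    c *\<^sub>R (f_mono (insert k A) :: ('f, 'm::{finite,linorder}, 'n, 's) superalg)"
proof (cases "k \<in> A")
  case True
  then have "sgen (GF k) * f_mono A = (0 :: ('f, 'm, 'n, 's) superalg)"
    unfolding f_mono_def by (intro f_word_repeat) simp
  then show ?thesis by (intro exI[of _ 0]) simp
next
  case False
  then show ?thesis
    using f_word_insort[of k "sorted_list_of_set A"]
    by (simp add: f_mono_def sorted_list_of_set_insert)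
qed

lemma f_word_mono:
  fixes A :: "'f::{finite,linorder} set"
  shows "\<exists>c::real. f_word ks * f_mono A =
    c *\<^sub>R (f_mono (set ks \<union> A) :: ('f, 'm::{finite,linorder}, 'n, 's) superalg)"
proof (induction ks)
  case Nil
  show ?case by (rule exI[of _ 1]) simp
next
  case (Cons k ks)
  then obtain c :: real where
    c: "f_word ks * f_mono A = c *\<^sub>R (f_mono (set ks \<union> A) :: ('f, 'm, 'n, 's) superalg)" by blast
  obtain d :: real where d: "sgen (GF k) * f_mono (set ks \<union> A) =
      d *\<^sub>R (f_mono (insert k (set ks \<union> A)) :: ('f, 'm, 'n, 's) superalg)"
    using f_mono_insert by blast
  have "f_word (k # ks) * f_mono A
      = (c * d) *\<^sub>R (f_mono (set (k # ks) \<union> A) :: ('f, 'm, 'n, 's) superalg)"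
    by (simp add: mult.assoc c d)
  then show ?case by blast
qed

lemma f_mono_mult:
  fixes A B :: "'f::{finite,linorder} set"
  shows "\<exists>c::real. f_mono A * f_mono B =
    c *\<^sub>R (f_mono (A \<union> B) :: ('f, 'm::{finite,linorder}, 'n, 's) superalg)"
  using f_word_mono[of "sorted_list_of_set A" B] by (simp add: f_mono_def)

text \<open>The sign \<open>\<sigma>\<close> with which \<open>y\<close> moves past the \<open>f\<^sub>k\<close> is the parity of \<open>y\<close>, without a grading of the
  whole algebra.\<close>

definition f_sign_comm :: "real \<Rightarrow> ('f, 'm::{finite,linorder}, 'n, 's) superalg \<Rightarrow> bool" where
  "f_sign_comm \<sigma> y \<longleftrightarrow> (\<forall>k. y * sgen (GF k) = \<sigma> *\<^sub>R (sgen (GF k) * y))"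

lemma f_sign_comm_word:
  assumes "f_sign_comm \<sigma> y"
  shows "y * f_word ks = \<sigma> ^ length ks *\<^sub>R (f_word ks * y)"
proof (induction ks)
  case (Cons k ks)
  have "y * f_word (k # ks) = \<sigma> *\<^sub>R (sgen (GF k) * (y * f_word ks))"
    using assms by (simp add: f_sign_comm_def mult.assoc[symmetric])
  then show ?case by (simp add: Cons mult.assoc)
qed simp

lemma f_sign_comm_mono:
  fixes y :: "('f::{finite,linorder}, 'm::{finite,linorder}, 'n, 's) superalg"
  assumes "f_sign_comm \<sigma> y"
  shows "y * f_mono A = \<sigma> ^ card A *\<^sub>R (f_mono A * y)"
  using f_sign_comm_word[OF assms, of "sorted_list_of_set A"] by (simp add: f_mono_def)

lemma f_sign_comm_gens:
  "f_sign_comm (-1) (sgen (GF k))" "f_sign_comm 1 (sgen (GE j))" "f_sign_comm 1 (sgen (GE' p))"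
  "f_sign_comm 1 (sgen (GX v j))" "f_sign_comm (-1) (sgen (GX' v p))"
  by (auto simp: f_sign_comm_def f_e f_e' x_central x'_f intro: f_f)

lemma f_sign_comm_mult:
  assumes "f_sign_comm \<sigma> y" "f_sign_comm \<tau> z"
  shows "f_sign_comm (\<sigma> * \<tau>) (y * z)"
  unfolding f_sign_comm_def
proof
  fix k
  have "y * z * sgen (GF k) = \<tau> *\<^sub>R ((y * sgen (GF k)) * z)"
    using assms(2) by (simp add: f_sign_comm_def mult.assoc)
  also have "\<dots> = (\<sigma> * \<tau>) *\<^sub>R (sgen (GF k) * (y * z))"
    using assms(1) by (simp add: f_sign_comm_def mult.assoc)
  finally show "y * z * sgen (GF k) = (\<sigma> * \<tau>) *\<^sub>R (sgen (GF k) * (y * z))" .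
qed

lemma f_sign_comm_one: "f_sign_comm 1 1"
  by (simp add: f_sign_comm_def)

lemma f_sign_comm_f_word: "f_sign_comm ((-1) ^ length ks) (f_word ks)"
  by (induction ks) (auto intro: f_sign_comm_one f_sign_comm_mult[OF f_sign_comm_gens(1), simplified])

lemma f_sign_comm_f_mono: "f_sign_comm ((-1) ^ card A) (f_mono A)"
  using f_sign_comm_f_word[of "sorted_list_of_set A"] by (simp add: f_mono_def)

text \<open>If \<open>k\<close> lies in both sets, the two factors \<open>f\<^sub>k\<close> can be moved next to each other.\<close>

lemma f_mono_meet:
  fixes A B :: "'f::{finite,linorder} set"
  assumes "A \<inter> B \<noteq> {}"
  shows "f_mono A * f_mono B = (0 :: ('f, 'm::{finite,linorder}, 'n, 's) superalg)"
proof -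
  obtain k where k: "k \<in> A" "k \<in> B" using assms by auto
  have "f_word ks * f_mono B = (0 :: ('f, 'm, 'n, 's) superalg)" if "k \<in> set ks" for ks
    using that
  proof (induction ks)
    case (Cons l ks)
    show ?case
    proof (cases "k \<in> set ks")
      case True
      then show ?thesis using Cons.IH by (simp add: mult.assoc)
    next
      case False
      then have l: "l = k" using Cons.prems by simp
      have "sgen (GF k) * f_word ks
        = ((-1) ^ length ks) *\<^sub>R (f_word ks * sgen (GF k) :: ('f, 'm, 'n, 's) superalg)"
        using f_sign_comm_word[OF f_sign_comm_gens(1)] .
      moreover have "sgen (GF k) * f_mono B = (0 :: ('f, 'm, 'n, 's) superalg)"
        unfolding f_mono_def using k by (intro f_word_repeat) simp
      ultimately show ?thesis using l by (simp add: mult.assoc)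
    qed
  qed simp
  then show ?thesis using k unfolding f_mono_def[of A] by simp
qed

section \<open>Spans of Grassmann monomials\<close>

text \<open>The family \<open>U\<close> says which monomials may occur. Taking for \<open>U\<close> sets of a given parity gives
  the even and the odd part; taking families closed under supersets gives the nilpotent ideals
  along which isometries are reduced to the identity.\<close>

definition grass :: "'f::{finite,linorder} set set \<Rightarrow> ('f, 'm::{finite,linorder}, 'n, 's) superalg set" where
  "grass U = span (f_mono ` U)"

definition parity_sets :: "bool \<Rightarrow> 'f set set" where
  "parity_sets b = {A. odd (card A) = b}"

lemma grass_ev_eq: "grass_ev = grass (parity_sets False)"
  by (simp add: grass_ev_def grass_def parity_sets_def setcompr_eq_image)

lemma grass_odd_eq: "grass_odd = grass (parity_sets True)"
  by (simp add: grass_odd_def grass_def parity_sets_def setcompr_eq_image)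

lemma grass_0: "0 \<in> grass U"
  and grass_add: "a \<in> grass U \<Longrightarrow> b \<in> grass U \<Longrightarrow> a + b \<in> grass U"
  and grass_diff: "a \<in> grass U \<Longrightarrow> b \<in> grass U \<Longrightarrow> a - b \<in> grass U"
  and grass_minus: "a \<in> grass U \<Longrightarrow> - a \<in> grass U"
  and grass_scale: "a \<in> grass U \<Longrightarrow> c *\<^sub>R a \<in> grass U"
  and grass_mono: "A \<in> U \<Longrightarrow> f_mono A \<in> grass U"
  and grass_sum: "(\<And>i. i \<in> I \<Longrightarrow> h i \<in> grass U) \<Longrightarrow> sum h I \<in> grass U"
  unfolding grass_def
  by (auto intro: span_zero span_add span_diff span_neg span_scale span_base span_sum)

lemma grass_subset: "U \<subseteq> V \<Longrightarrow> a \<in> grass U \<Longrightarrow> a \<in> grass V"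
  unfolding grass_def by (meson image_mono span_mono subsetD)

lemma grass_induct [consumes 1, case_names zero add scale]:
  assumes "a \<in> grass U"
    and "P 0" and "\<And>a b. P a \<Longrightarrow> P b \<Longrightarrow> P (a + b)" and "\<And>c A. A \<in> U \<Longrightarrow> P (c *\<^sub>R f_mono A)"
  shows "P a"
  using assms(1) unfolding grass_def
proof (induction rule: span_induct_alt)
  case base
  show ?case by (rule assms(2))
next
  case (step c x y)
  then show ?case using assms(3,4) by blast
qed

lemma grass_mult:
  assumes "a \<in> grass U" "b \<in> grass V"
    and W: "\<And>A B. A \<in> U \<Longrightarrow> B \<in> V \<Longrightarrow> A \<inter> B = {} \<Longrightarrow> A \<union> B \<in> W"
  shows "a * b \<in> grass W"
  using assms(1)
proof (induction rule: grass_induct)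
  case (scale c A)
  show ?case
    using assms(2)
  proof (induction rule: grass_induct)
    case (scale d B)
    obtain e :: real where e: "f_mono A * f_mono B = e *\<^sub>R (f_mono (A \<union> B) :: ('a, 'b, 'c, 'd) superalg)"
      using f_mono_mult by blast
    show ?case
      using e W[OF \<open>A \<in> U\<close> \<open>B \<in> V\<close>] f_mono_meet[of A B, where ?'m='b and ?'n='c and ?'s='d]
      by (cases "A \<inter> B = {}") (auto simp: grass_0 intro!: grass_scale grass_mono)
  qed (auto simp: distrib_left intro: grass_add grass_0)
qed (auto simp: distrib_right intro: grass_add grass_0)

lemma f_sign_comm_grass:
  assumes "f_sign_comm \<sigma> y" "a \<in> grass U" "U \<subseteq> parity_sets b" "\<sigma> = 1 \<or> \<sigma> = - 1"
  shows "y * a = (if b then \<sigma> else 1) *\<^sub>R (a * y)"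
  using assms(2)
proof (induction rule: grass_induct)
  case (scale c A)
  have "\<sigma> ^ card A = (if b then \<sigma> else 1)"
    using assms(3,4) scale by (cases b) (auto simp: parity_sets_def subset_iff)
  then show ?case using f_sign_comm_mono[OF assms(1), of A] by simp
qed (auto simp: algebra_simps)

lemma f_sign_comm_of_grass:
  assumes "a \<in> grass U" "U \<subseteq> parity_sets b"
  shows "f_sign_comm (if b then -1 else 1) a"
  using assms(1)
proof (induction rule: grass_induct)
  case (scale c A)
  have "(-1::real) ^ card A = (if b then -1 else 1)"
    using assms(2) scale by (cases b) (auto simp: parity_sets_def subset_iff)
  then show ?case using f_sign_comm_f_mono[of A, where ?'b='b and ?'c='c and ?'d='d]
    by (simp add: f_sign_comm_def)
qed (auto simp: f_sign_comm_def algebra_simps)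

lemma grass_supercommute:
  assumes "a \<in> grass U" "U \<subseteq> parity_sets s" "b \<in> grass V" "V \<subseteq> parity_sets t"
  shows "a * b = (if s \<and> t then -1 else 1) *\<^sub>R (b * a)"
  using f_sign_comm_grass[OF f_sign_comm_of_grass[OF assms(1,2)] assms(3,4)] by simp

section \<open>Supermatrices supported on a family of monomials\<close>

definition entry_parity :: "'m + 'n dbl \<Rightarrow> 'm + 'n dbl \<Rightarrow> bool" where
  "entry_parity i j \<longleftrightarrow> isl i \<noteq> isl j"

text \<open>Each entry satisfies the condition of \<open>Mat\<close> on its parity and at the same time uses only monomials from
  \<open>U\<close>. Both conditions are put on the spanning set, so that an entry can be split into
  monomials of the right parity without knowing that the monomials are independent.\<close>

definition Mat_over :: "'f::{finite,linorder} set set \<Rightarrow> ('f, 'm::{finite,linorder}, 'n::{finite,linorder}, 's) smat set" where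
  "Mat_over U = {M. \<forall>i j. M $ i $ j \<in> grass (U \<inter> parity_sets (entry_parity i j))}"

lemma Mat_overD: "M \<in> Mat_over U \<Longrightarrow> M $ i $ j \<in> grass (U \<inter> parity_sets (entry_parity i j))"
  by (simp add: Mat_over_def)

lemma Mat_eq: "Mat = Mat_over UNIV"
proof -
  have all: "(\<forall>i j. P i j) \<longleftrightarrow> (\<forall>i j. P (Inl i) (Inl j)) \<and> (\<forall>i q. P (Inl i) (Inr q)) \<and>
     (\<forall>p j. P (Inr p) (Inl j)) \<and> (\<forall>p q. P (Inr p) (Inr q))"
    for P :: "'m + 'n dbl \<Rightarrow> 'm + 'n dbl \<Rightarrow> bool"
    by (metis sum.exhaust)
  show ?thesis
    unfolding Mat_def Mat_over_def all by (simp add: grass_ev_eq grass_odd_eq entry_parity_def)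
qed

lemma Mat_over_add: "M \<in> Mat_over U \<Longrightarrow> N \<in> Mat_over U \<Longrightarrow> M + N \<in> Mat_over U"
  and Mat_over_diff: "M \<in> Mat_over U \<Longrightarrow> N \<in> Mat_over U \<Longrightarrow> M - N \<in> Mat_over U"
  and Mat_over_scale: "M \<in> Mat_over U \<Longrightarrow> c *\<^sub>R M \<in> Mat_over U"
  and Mat_over_0: "0 \<in> Mat_over U"
  by (auto simp: Mat_over_def intro: grass_add grass_diff grass_scale grass_0)

lemma Mat_over_sum: "(\<And>i. i \<in> I \<Longrightarrow> h i \<in> Mat_over U) \<Longrightarrow> sum h I \<in> Mat_over U"
  by (auto simp: Mat_over_def sum_component intro: grass_sum)

lemma Mat_over_subset: "U \<subseteq> V \<Longrightarrow> M \<in> Mat_over U \<Longrightarrow> M \<in> Mat_over V"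
  unfolding Mat_over_def by (blast intro: grass_subset[rotated])

text \<open>Two monomials with a common factor multiply to zero, so only disjoint unions have to be in
  \<open>W\<close>. The parities add up because the parity of an entry is the sum of the parities of its
  row and its column.\<close>

lemma Mat_over_mult:
  assumes "M \<in> Mat_over U" "N \<in> Mat_over V"
    and "\<And>A B. A \<in> U \<Longrightarrow> B \<in> V \<Longrightarrow> A \<inter> B = {} \<Longrightarrow> A \<union> B \<in> W"
  shows "M ** N \<in> Mat_over W"
  unfolding Mat_over_def
proof (clarify)
  fix i j
  show "(M ** N) $ i $ j \<in> grass (W \<inter> parity_sets (entry_parity i j))"
    unfolding matrix_matrix_mult_def
  proof (simp, intro grass_sum)
    fix k
    show "M $ i $ k * N $ k $ j \<in> grass (W \<inter> parity_sets (entry_parity i j))"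
    proof (rule grass_mult[OF Mat_overD[OF assms(1)] Mat_overD[OF assms(2)]])
      fix A B :: "'a set"
      assume AB: "A \<in> U \<inter> parity_sets (entry_parity i k)" "B \<in> V \<inter> parity_sets (entry_parity k j)"
        "A \<inter> B = {}"
      then have "card (A \<union> B) = card A + card B" by (intro card_Un_disjoint) auto
      then show "A \<union> B \<in> W \<inter> parity_sets (entry_parity i j)"
        using AB assms(3) by (auto simp: parity_sets_def entry_parity_def)
    qed
  qed
qed

lemma Mat_mult:
  fixes M N :: "('f::{finite,linorder}, 'm::{finite,linorder}, 'n::{finite,linorder}, 's) smat"
  shows "M \<in> Mat \<Longrightarrow> N \<in> Mat \<Longrightarrow> M ** N \<in> Mat"
  unfolding Mat_eq by (rule Mat_over_mult) auto

lemma mat_1_over: "mat 1 \<in> Mat_over {{}}"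
  unfolding Mat_over_def
  by (auto simp: mat_def entry_parity_def parity_sets_def f_mono_empty[symmetric] intro: grass_mono grass_0)

lemma Mat_one:
  "(mat 1 :: ('f::{finite,linorder}, 'm::{finite,linorder}, 'n::{finite,linorder}, 's) smat) \<in> Mat"
  unfolding Mat_eq by (rule Mat_over_subset[OF _ mat_1_over]) simp

section \<open>Representations on spaces of real-valued functions\<close>

text \<open>One linear operator for each generator is the same as a representation of the tensor algebra.
  If the relators act as zero, it descends to the quotient.\<close>

locale linear_ops =
  fixes gop :: "'g \<Rightarrow> ('i \<Rightarrow> real) \<Rightarrow> 'i \<Rightarrow> real"
  assumes lin: "gop g (\<lambda>i. c * \<Psi> i + d * \<Phi> i) = (\<lambda>i. c * gop g \<Psi> i + d * gop g \<Phi> i)"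
begin

fun word :: "'g free_mon \<Rightarrow> ('i \<Rightarrow> real) \<Rightarrow> 'i \<Rightarrow> real" where
  "word (FM w) = foldr gop w"

definition tact :: "'g tensor \<Rightarrow> ('i \<Rightarrow> real) \<Rightarrow> 'i \<Rightarrow> real" where
  "tact t \<Psi> = (\<lambda>i. Sum_any (\<lambda>w. Poly_Mapping.lookup t w * word w \<Psi> i))"

lemma word_plus: "word (u + v) \<Psi> = word u (word v \<Psi>)"
  by (cases u; cases v) simp

lemma word_lin: "word w (\<lambda>i. c * \<Psi> i + d * \<Phi> i) = (\<lambda>i. c * word w \<Psi> i + d * word w \<Phi> i)"
proof (cases w)
  case (FM u)
  have "foldr gop u (\<lambda>i. c * \<Psi> i + d * \<Phi> i) = (\<lambda>i. c * foldr gop u \<Psi> i + d * foldr gop u \<Phi> i)"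
    by (induction u) (simp_all add: lin)
  with FM show ?thesis by simp
qed

lemma tact_zero: "tact 0 \<Psi> = (\<lambda>i. 0)"
  by (simp add: tact_def)

lemma tact_add: "tact (s + t) \<Psi> = (\<lambda>i. tact s \<Psi> i + tact t \<Psi> i)"
  by (simp add: tact_def lookup_add distrib_right Sum_any.distrib fin_lookup)

lemma tact_single: "tact (Poly_Mapping.single w c) \<Psi> = (\<lambda>i. c * word w \<Psi> i)"
proof
  fix i
  have "tact (Poly_Mapping.single w c) \<Psi> i
      = (\<Sum>v\<in>{w}. Poly_Mapping.lookup (Poly_Mapping.single w c) v * word v \<Psi> i)"
    unfolding tact_def by (rule Sum_any.expand_superset) (auto simp: lookup_single when_def)
  then show "tact (Poly_Mapping.single w c) \<Psi> i = c * word w \<Psi> i" by simp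
qed

lemma tact_lin: "tact t (\<lambda>i. c * \<Psi> i + d * \<Phi> i) = (\<lambda>i. c * tact t \<Psi> i + d * tact t \<Phi> i)"
  by (induction t rule: tensor_induct) (simp_all add: tact_single tact_add word_lin fun_eq_iff algebra_simps)

lemma tact_scale: "tact t (\<lambda>i. c * \<Psi> i) = (\<lambda>i. c * tact t \<Psi> i)"
  using tact_lin[of t c \<Psi> 0 \<Psi>] by simp

lemma tact_mult: "tact (s * t) \<Psi> = tact s (tact t \<Psi>)"
proof (induction s rule: tensor_induct)
  case (single u a)
  show ?case
  proof (induction t rule: tensor_induct)
    case (single v b)
    show ?case
      using word_lin[of u b "word v \<Psi>" 0 "word v \<Psi>"]
      by (simp add: mult_single tact_single word_plus fun_eq_iff)
  next
    case (sum t1 t2)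
    then show ?case
      using tact_lin[of "Poly_Mapping.single u a" 1 "tact t1 \<Psi>" 1 "tact t2 \<Psi>"]
      by (simp add: distrib_left tact_add)
  qed
qed (simp add: distrib_right tact_add)

lemma tact_tgen: "tact (tgen g) \<Psi> = gop g \<Psi>"
  by (simp add: tgen_def tact_single)

lemma tact_tconst: "tact (tconst c) \<Psi> = (\<lambda>i. c * \<Psi> i)"
  by (simp add: tconst_def tact_single zero_free_mon_def)

lemma tact_minus: "tact (- t) \<Psi> = (\<lambda>i. - tact t \<Psi> i)"
proof -
  have "- t = tconst (-1) * t"
    using tconst_simps(1,2) tconst_simps(3)[of 1 "-1"]
    by (metis add_eq_0_iff add.right_inverse mult_minus1)
  then show ?thesis by (simp add: tact_mult tact_tconst)
qed

lemma tact_diff: "tact (s - t) \<Psi> = (\<lambda>i. tact s \<Psi> i - tact t \<Psi> i)"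
  using tact_add[of s "- t" \<Psi>] by (simp add: tact_minus)

lemma tact_ideal:
  assumes "x \<in> gen_ideal R" and R: "\<And>r \<Psi>. r \<in> R \<Longrightarrow> tact r \<Psi> = (\<lambda>i. 0)"
  shows "tact x \<Psi> = (\<lambda>i. 0)"
  using assms(1)
proof (induction arbitrary: \<Psi> rule: gen_ideal.induct)
  case (gen r a b)
  then show ?case using tact_scale[of a 0 \<Psi>] by (simp add: tact_mult R)
qed (simp_all add: tact_zero tact_add)

end

locale superalg_rep = linear_ops gop
  for gop :: "('f, 'm::{finite,linorder}, 'n, 's) gen \<Rightarrow> ('i \<Rightarrow> real) \<Rightarrow> 'i \<Rightarrow> real" +
  assumes rel: "r \<in> relators \<Longrightarrow> tact r \<Psi> = (\<lambda>i. 0)"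
begin

definition act :: "('f, 'm, 'n, 's) superalg \<Rightarrow> ('i \<Rightarrow> real) \<Rightarrow> 'i \<Rightarrow> real" where
  "act a = tact (rep_superalg a)"

text \<open>The action is defined through a representative; two representatives differ by an element of the ideal,
  which acts as zero.\<close>

lemma act_abs: "act (abs_superalg t) \<Psi> = tact t \<Psi>"
proof -
  have "abs_superalg (rep_superalg (abs_superalg t)) = abs_superalg t"
    by (rule Quotient3_abs_rep[OF Quotient3_superalg])
  then have "tact (rep_superalg (abs_superalg t) - t) \<Psi> = (\<lambda>i. 0)"
    unfolding superalg.abs_eq_iff by (rule tact_ideal[OF _ rel])
  then show ?thesis by (simp add: act_def tact_diff fun_eq_iff)
qed

lemma abs_cases: obtains t where "a = abs_superalg t"
  using Quotient3_abs_rep[OF Quotient3_superalg, of a] by metis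

lemma act_mult: "act (a * b) \<Psi> = act a (act b \<Psi>)"
  by (cases a rule: abs_cases; cases b rule: abs_cases) (simp add: times_superalg.abs_eq act_abs tact_mult)

lemma act_add: "act (a + b) \<Psi> = (\<lambda>i. act a \<Psi> i + act b \<Psi> i)"
  by (cases a rule: abs_cases; cases b rule: abs_cases) (simp add: plus_superalg.abs_eq act_abs tact_add)

lemma act_scaleR: "act (c *\<^sub>R a) \<Psi> = (\<lambda>i. c * act a \<Psi> i)"
  by (cases a rule: abs_cases) (simp add: scaleR_superalg.abs_eq act_abs tact_mult tact_tconst)

lemma act_one: "act 1 \<Psi> = \<Psi>"
  using tact_tconst[of 1 \<Psi>] by (simp add: one_superalg_def act_abs tconst_simps)

lemma act_zero: "act 0 \<Psi> = (\<lambda>i. 0)"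
  by (simp add: zero_superalg_def act_abs tact_zero)

lemma act_diff: "act (a - b) \<Psi> = (\<lambda>i. act a \<Psi> i - act b \<Psi> i)"
  by (cases a rule: abs_cases; cases b rule: abs_cases) (simp add: minus_superalg.abs_eq act_abs tact_diff)

lemma act_sgen: "act (sgen g) \<Psi> = gop g \<Psi>"
  by (simp add: sgen_def act_abs tact_tgen)

lemma act_sum: "act (sum h I) \<Psi> = (\<lambda>i. \<Sum>x\<in>I. act (h x) \<Psi> i)"
  by (induction I rule: infinite_finite_induct) (simp_all add: act_zero act_add)

lemma act_scale: "act a (\<lambda>i. c * \<Psi> i) = (\<lambda>i. c * act a \<Psi> i)"
  unfolding act_def by (rule tact_scale)

end

section \<open>A representation that separates supermatrices\<close>

text \<open>A state \<open>(A, b, J, \<alpha>)\<close> indexes a basis element \<open>f\<^sub>A\<close> of the Grassmann algebra, a basis element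
  \<open>1\<close> or \<open>\<xi>\<close> of the Grassmann algebra on one more generator \<open>\<xi>\<close> (with \<open>b\<close> telling whether \<open>\<xi>\<close> occurs), a spinor and a monomial
  in \<open>n\<close> variables.\<close>

type_synonym ('f, 'm, 'n) state = "'f set \<times> bool \<times> 'm set \<times> ('n \<Rightarrow> nat)"

text \<open>Each \<open>f\<^sub>k\<close> acts by multiplication, \<open>e\<^sub>j\<close> by a Jordan--Wigner operator, \<open>e'\<^sub>p\<close> by a derivative or a
  multiplication, times the grading of the spinors. Among the coordinates of all supervectors, only those with index \<open>k0\<close> act by a non-zero
  operator: a commuting one as the number \<open>1\<close>, an anticommuting one as multiplication by \<open>\<xi>\<close>,
  where \<open>(-1)\<close> to the power \<open>card A\<close> is the sign of moving \<open>\<xi>\<close> past \<open>f\<^sub>A\<close>. So \<open>\<Sum> M\<^sub>i\<^sub>k x\<^sub>k e\<^sub>i\<close> acts through the column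
  \<open>k0\<close> of \<open>M\<close> only.\<close>

fun sep_op :: "'m + 'n dbl \<Rightarrow> ('f::{finite,linorder}, 'm::{finite,linorder}, 'n, 's) gen
    \<Rightarrow> (('f, 'm, 'n) state \<Rightarrow> real) \<Rightarrow> ('f, 'm, 'n) state \<Rightarrow> real" where
  "sep_op k0 (GF k) \<Psi> (A, b, J, \<alpha>) =
     (if k \<in> A then (-1) ^ card {l \<in> A. l < k} * \<Psi> (A - {k}, b, J, \<alpha>) else 0)"
| "sep_op k0 (GE j) \<Psi> (A, b, J, \<alpha>) = jw j J * \<Psi> (A, b, toggle J j, \<alpha>)"
| "sep_op k0 (GE' p) \<Psi> (A, b, J, \<alpha>) = (-1) ^ card J * weyl p (\<lambda>\<beta>. \<Psi> (A, b, J, \<beta>)) \<alpha>"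
| "sep_op k0 (GX v j) \<Psi> (A, b, J, \<alpha>) = (if k0 = Inl j then 1 else 0) * \<Psi> (A, b, J, \<alpha>)"
| "sep_op k0 (GX' v p) \<Psi> (A, b, J, \<alpha>) =
     (if k0 = Inr p \<and> b then (-1) ^ card A * \<Psi> (A, False, J, \<alpha>) else 0)"

lemma sep_op_lin:
  "sep_op k0 g (\<lambda>i. c * \<Psi> i + d * \<Phi> i) = (\<lambda>i. c * sep_op k0 g \<Psi> i + d * sep_op k0 g \<Phi> i)"
proof (rule ext)
  fix i :: "('a, 'b, 'c) state"
  obtain A b J \<alpha> where i: "i = (A, b, J, \<alpha>)" by (cases i)
  show "sep_op k0 g (\<lambda>i. c * \<Psi> i + d * \<Phi> i) i = c * sep_op k0 g \<Psi> i + d * sep_op k0 g \<Phi> i"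
    unfolding i by (cases g) (simp_all add: weyl_lin algebra_simps)
qed

interpretation sep: linear_ops "sep_op k0" for k0
  by standard (rule sep_op_lin)

lemma remove_sign:
  fixes A :: "'f::{finite,linorder} set"
  assumes "j < k" "j \<in> A" "k \<in> A"
  shows "(-1::real) ^ card {l \<in> A - {j}. l < k} = - ((-1) ^ card {l \<in> A. l < k})"
    and "{l \<in> A - {k}. l < j} = {l \<in> A. l < j}"
proof -
  have "{l \<in> A. l < k} = insert j {l \<in> A - {j}. l < k}" using assms by auto
  then have "card {l \<in> A. l < k} = Suc (card {l \<in> A - {j}. l < k})" by simp
  then show "(-1::real) ^ card {l \<in> A - {j}. l < k} = - ((-1) ^ card {l \<in> A. l < k})" by simp
  show "{l \<in> A - {k}. l < j} = {l \<in> A. l < j}" using assms by auto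
qed

lemma sep_ff: "sep_op k0 (GF j) (sep_op k0 (GF k) \<Psi>) (A, b, J, \<alpha>)
   + sep_op k0 (GF k) (sep_op k0 (GF j) \<Psi>) (A, b, J, \<alpha>) = 0"
proof -
  have *: "sep_op k0 (GF j) (sep_op k0 (GF k) \<Psi>) (A, b, J, \<alpha>)
   + sep_op k0 (GF k) (sep_op k0 (GF j) \<Psi>) (A, b, J, \<alpha>) = 0" if "j < k" for j k
    using that remove_sign[OF that, of A] by (auto simp: Diff_insert2[symmetric] insert_commute)
  consider "j < k" | "k < j" | "j = k" by fastforce
  then show ?thesis
    using *[of j k] *[of k j] by cases (auto simp: add.commute)
qed

lemma sep_relators:
  assumes "r \<in> relators"
  shows "sep.tact k0 r \<Psi> = (\<lambda>i. 0)"
proof -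
  have "sep.tact k0 r \<Psi> (A, b, J, \<alpha>) = 0" for A b J \<alpha>
    using assms
  proof cases
    case (ff j k)
    then show ?thesis
      using sep_ff[of k0 j k \<Psi> A b J \<alpha>]
      by (simp only: sep.tact_add sep.tact_mult sep.tact_tgen)
  next
    case (ee j k)
    show ?thesis
    proof (cases "j = k")
      case True
      have "jw k J * (jw k (toggle J k) * x) = - x" for x :: real
        using jw_toggle_self[of k J] by (metis mult.assoc mult_minus1)
      then show ?thesis using ee True
        by (simp add: sep.tact_add sep.tact_mult sep.tact_tgen sep.tact_tconst toggle_simps(1))
    next
      case False
      have "jw j J * (jw k (toggle J j) * x) = - (jw k J * (jw j (toggle J k) * x))" for x :: real
        using jw_anticomm[OF False, of J] by (metis mult.assoc mult_minus_left)
      then show ?thesis using ee False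
        by (simp add: sep.tact_add sep.tact_mult sep.tact_tgen sep.tact_tconst toggle_simps(2)[of _ k j])
    qed
  next
    case (e'e' p q)
    have "(-1) ^ card J * ((-1) ^ card J * x) = x" for x :: real
      by (rule left_minus_one_mult_self)
    then show ?thesis using e'e' weyl_commutator[of p q "\<lambda>\<beta>. \<Psi> (A, b, J, \<beta>)" \<alpha>]
      by (simp add: sep.tact_diff sep.tact_mult sep.tact_tgen sep.tact_tconst weyl_scale)
  next
    case (x_central v j a)
    then show ?thesis
      by (cases a) (auto simp: sep.tact_diff sep.tact_mult sep.tact_tgen weyl_scale)
  next
    case (x'f v p k)
    have "(-1::real) ^ card A = - ((-1) ^ card (A - {k}))" if "k \<in> A"
    proof -
      have "card A = Suc (card (A - {k}))" using that by (intro card.remove) simp_all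
      then show ?thesis by (simp only: power_Suc mult_minus1)
    qed
    then show ?thesis using x'f
      by (auto simp: sep.tact_add sep.tact_mult sep.tact_tgen)
  next
    case (ee' j q)
    then show ?thesis
      by (simp add: sep.tact_add sep.tact_mult sep.tact_tgen weyl_scale card_toggle)
  next
    case (x'e' v p q)
    then show ?thesis
      using weyl_scale[of q 0 "\<lambda>_. 0"]
      by (auto simp: sep.tact_diff sep.tact_mult sep.tact_tgen weyl_scale)
  next
    case (fe' k q)
    then show ?thesis
      using weyl_scale[of q 0 "\<lambda>_. 0"]
      by (auto simp: sep.tact_diff sep.tact_mult sep.tact_tgen weyl_scale)
  qed (auto simp: sep.tact_add sep.tact_diff sep.tact_mult sep.tact_tgen)
  then show ?thesis by auto
qed

interpretation sep: superalg_rep "sep_op k0" for k0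
  by standard (rule sep_relators)

abbreviation point :: "'i \<Rightarrow> 'i \<Rightarrow> real" where
  "point x \<equiv> (\<lambda>i. of_bool (i = x))"

lemma f_word_point:
  fixes k0 :: "'m::{finite,linorder} + 'n dbl" and ks :: "'f::{finite,linorder} list"
  assumes "distinct ks"
  shows "\<exists>c. c \<noteq> 0 \<and> sep.act k0 (f_word ks :: ('f, 'm, 'n, 's) superalg) (point ({}, b, J, \<alpha>))
    = (\<lambda>i. c * point (set ks, b, J, \<alpha>) i)"
  using assms
proof (induction ks)
  case Nil
  show ?case by (rule exI[of _ 1]) (simp add: sep.act_one)
next
  case (Cons k ks)
  have distinct_tail: "distinct ks" using Cons.prems by simp
  obtain c where c': "c \<noteq> 0 \<and> sep.act k0 (f_word ks :: ('f, 'm, 'n, 's) superalg) (point ({}, b, J, \<alpha>))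
    = (\<lambda>i. c * point (set ks, b, J, \<alpha>) i)"
    using Cons.IH[OF distinct_tail] by (elim exE)
  note c = conjunct1[OF c'] conjunct2[OF c']
  let ?d = "(-1::real) ^ card {l \<in> insert k (set ks). l < k}"
  have step: "sep_op k0 (GF k :: ('f, 'm, 'n, 's) gen) (point (set ks, b, J, \<alpha>))
    = (\<lambda>i. ?d * point (insert k (set ks), b, J, \<alpha>) i)"
  proof
    fix i :: "('f, 'm, 'n) state"
    obtain A b' J' \<alpha>' where i: "i = (A, b', J', \<alpha>')" by (cases i)
    have k: "insert k (set ks) - {k} = set ks" using Cons.prems by auto
    have "\<not> (k \<in> A \<and> A - {k} = set ks)" if "A \<noteq> insert k (set ks)" using that by blast
    then show "sep_op k0 (GF k :: ('f, 'm, 'n, 's) gen) (point (set ks, b, J, \<alpha>)) i = ?d * point (insert k (set ks), b, J, \<alpha>) i"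
      unfolding i using k by (cases "A = insert k (set ks)") simp_all
  qed
  have "sep.act k0 (f_word (k # ks) :: ('f, 'm, 'n, 's) superalg) (point ({}, b, J, \<alpha>))
    = (\<lambda>i. c * ?d * point (set (k # ks), b, J, \<alpha>) i)"
    by (simp only: list.map prod_list.Cons sep.act_mult c(2) sep.act_scale sep.act_sgen step list.set mult.assoc)
  moreover have "c * ?d \<noteq> 0" using c(1) by simp
  ultimately show ?case by (intro exI[of _ "c * ?d"] conjI)
qed

text \<open>The monomial \<open>f\<^sub>A\<close> leads from the state without \<open>f\<close> to the state \<open>A\<close>; different monomials give
  different states.\<close>

lemma f_mono_point:
  "\<exists>c. c \<noteq> 0 \<and> sep.act k0 (f_mono A) (point ({}, b, J, \<alpha>)) = (\<lambda>i. c * point (A, b, J, \<alpha>) i)"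
  using f_word_point[of "sorted_list_of_set A"] by (simp add: f_mono_def)

lemma grass_expand:
  fixes a :: "('f::{finite,linorder}, 'm::{finite,linorder}, 'n, 's) superalg"
  assumes "a \<in> grass U"
  shows "\<exists>c. (\<forall>A. A \<notin> U \<longrightarrow> c A = 0) \<and> a = (\<Sum>A\<in>UNIV. c A *\<^sub>R f_mono A)"
  using assms
proof (induction rule: grass_induct)
  case zero
  show ?case by (rule exI[of _ "\<lambda>_. 0"]) simp
next
  case (add a b)
  then obtain c d where "\<forall>A. A \<notin> U \<longrightarrow> c A = 0" "a = (\<Sum>A\<in>UNIV. c A *\<^sub>R f_mono A)"
    "\<forall>A. A \<notin> U \<longrightarrow> d A = 0" "b = (\<Sum>A\<in>UNIV. d A *\<^sub>R f_mono A)" by blast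
  then show ?case
    by (intro exI[of _ "\<lambda>A. c A + d A"]) (simp add: scaleR_add_left sum.distrib)
next
  case (scale c A)
  have "c *\<^sub>R f_mono A = (\<Sum>B\<in>UNIV. if B = A then c *\<^sub>R f_mono B else 0)" by simp
  also have "\<dots> = (\<Sum>B\<in>UNIV. (if B = A then c else 0) *\<^sub>R f_mono B)"
    by (rule sum.cong) auto
  finally show ?case using scale by (intro exI[of _ "\<lambda>B. if B = A then c else 0"]) auto
qed

lemma grass_support:
  fixes a :: "('f::{finite,linorder}, 'm::{finite,linorder}, 'n, 's) superalg"
  assumes "a \<in> grass U" "snd i \<noteq> (b, J, \<alpha>)"
  shows "sep.act k0 a (point ({}, b, J, \<alpha>)) i = 0"
  using assms(1)
proof (induction rule: grass_induct)
  case (scale c A)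
  obtain d where d: "d \<noteq> 0 \<and> sep.act k0 (f_mono A :: ('f, 'm, 'n, 's) superalg) (point ({}, b, J, \<alpha>)) = (\<lambda>i. d * point (A, b, J, \<alpha>) i)"
    using f_mono_point[of k0 A b J \<alpha>] by (elim exE)
  have "sep.act k0 (f_mono A :: ('f, 'm, 'n, 's) superalg) (point ({}, b, J, \<alpha>)) i = 0"
    using assms(2) by (cases i) (auto simp: conjunct2[OF d])
  then show ?case by (simp add: sep.act_scaleR)
qed (auto simp: sep.act_zero sep.act_add)

text \<open>The value at the state \<open>A\<close> is a non-zero multiple of the coefficient of \<open>f\<^sub>A\<close>.\<close>

lemma grass_faithful:
  fixes a :: "('f::{finite,linorder}, 'm::{finite,linorder}, 'n, 's) superalg"
  assumes a: "a \<in> grass U" and z: "\<And>A. sep.act k0 a (point ({}, b, J, \<alpha>)) (A, b, J, \<alpha>) = 0"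
  shows "a = 0"
proof -
  obtain c where c: "a = (\<Sum>A\<in>UNIV. c A *\<^sub>R f_mono A)" using grass_expand[OF a] by blast
  have "\<exists>d. \<forall>B. d B \<noteq> 0 \<and>
      sep.act k0 (f_mono B :: ('f, 'm, 'n, 's) superalg) (point ({}, b, J, \<alpha>)) = (\<lambda>i. d B * point (B, b, J, \<alpha>) i)"
    by (intro choice allI f_mono_point)
  then obtain d where d: "\<forall>B. d B \<noteq> 0 \<and>
      sep.act k0 (f_mono B :: ('f, 'm, 'n, 's) superalg) (point ({}, b, J, \<alpha>)) = (\<lambda>i. d B * point (B, b, J, \<alpha>) i)"
    by (elim exE)
  have "c A = 0" for A
  proof -
    have "0 = (\<Sum>B\<in>UNIV. c B * sep.act k0 (f_mono B :: ('f, 'm, 'n, 's) superalg) (point ({}, b, J, \<alpha>)) (A, b, J, \<alpha>))"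
      using z[of A] by (simp add: c sep.act_sum sep.act_scaleR)
    also have "\<dots> = (\<Sum>B\<in>UNIV. if B = A then c A * d A else 0)"
      unfolding conjunct2[OF spec[OF d]] by (intro sum.cong) auto
    finally show ?thesis using d by simp
  qed
  then show ?thesis by (simp add: c)
qed

text \<open>The state reached by \<open>e\<^sub>j\<close> or \<open>e'\<^sub>p\<close> from the state with empty \<open>J\<close> and all exponents equal to \<open>1\<close>.
  With exponents \<open>0\<close> the derivatives would give zero; with exponents \<open>1\<close> all \<open>e\<^sub>j\<close> and \<open>e'\<^sub>p\<close> lead to non-zero multiples of
  pairwise distinct states.\<close>

fun unit_state :: "'m + 'n dbl \<Rightarrow> 'm set \<times> ('n \<Rightarrow> nat)" where
  "unit_state (Inl j) = ({j}, \<lambda>_. 1)"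
| "unit_state (Inr (Od j)) = ({}, (\<lambda>_. 1)(j := 0))"
| "unit_state (Inr (Ev j)) = ({}, (\<lambda>_. 1)(j := 2))"

lemma inj_unit_state: "unit_state i = unit_state k \<Longrightarrow> i = k"
proof -
  have "j = k \<and> x = y" if "(\<lambda>_. 1)(j := x) = (\<lambda>_. 1)(k := y)" "x \<noteq> 1" "y \<noteq> 1" for j k :: 'b and x y :: nat
    using that by (auto simp: fun_eq_iff split: if_splits)
  then show "unit_state i = unit_state k \<Longrightarrow> i = k"
    by (cases i rule: unit_state.cases; cases k rule: unit_state.cases) force+
qed

lemma unit_vec_point:
  "\<exists>c. c \<noteq> 0 \<and> sep.act k0 (unit_vec i) (point (A, b, {}, \<lambda>_. 1))
    = (\<lambda>x. c * point (A, b, unit_state i) x)"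
proof (cases i rule: unit_state.cases)
  case (1 j)
  have "toggle J j = {} \<longleftrightarrow> J = {j}" for J by (auto simp: toggle_def)
  then have "sep_op k0 (GE j) (point (A, b, {}, \<lambda>_. 1))
    = (\<lambda>x. jw j {j} * point (A, b, {j}, \<lambda>_. 1) x)"
    by (auto simp: fun_eq_iff)
  then show ?thesis using 1 by (intro exI[of _ "jw j {j}"]) (simp add: sep.act_sgen jw_def)
next
  case (2 j)
  have "\<alpha>(j := Suc (\<alpha> j)) = (\<lambda>_. 1) \<longleftrightarrow> \<alpha> = (\<lambda>_. 1)(j := 0)" for \<alpha> :: "'c \<Rightarrow> nat"
    by (auto simp: fun_eq_iff split: if_splits)
  then have "sep_op k0 (GE' (Od j)) (point (A, b, {}, \<lambda>_. 1))
    = (\<lambda>x. 1 * point (A, b, {}, (\<lambda>_. 1)(j := 0)) x)"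
    by (auto simp: fun_eq_iff)
  then show ?thesis using 2 by (intro exI[of _ 1]) (simp add: sep.act_sgen)
next
  case (3 j)
  have "\<alpha> j \<noteq> 0 \<and> \<alpha>(j := \<alpha> j - Suc 0) = (\<lambda>_. 1) \<longleftrightarrow> \<alpha> = (\<lambda>_. 1)(j := 2)" for \<alpha> :: "'c \<Rightarrow> nat"
    by (auto simp: fun_eq_iff split: if_splits)
  then have "sep_op k0 (GE' (Ev j)) (point (A, b, {}, \<lambda>_. 1))
    = (\<lambda>x. 1 * point (A, b, {}, (\<lambda>_. 1)(j := 2)) x)"
    by (auto simp: fun_eq_iff)
  then show ?thesis using 3 by (intro exI[of _ 1]) (simp add: sep.act_sgen)
qed

lemma coord_point:
  fixes k0 :: "'m::{finite,linorder} + 'n dbl" and v :: 's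
  shows
  "\<exists>c. c \<noteq> 0 \<and> (\<forall>k. sep.act k0 (coord v k :: ('f, 'm, 'n, 's) superalg) (point (({} :: 'f::{finite,linorder} set), False, J, \<alpha>))
    = (\<lambda>x. (if k = k0 then c else 0) * point ({}, \<not> isl k0, J, \<alpha>) x))"
proof (rule exI[of _ 1], safe)
  fix k
  show "sep.act k0 (coord v k :: ('f, 'm, 'n, 's) superalg) (point ({}, False, J, \<alpha>))
    = (\<lambda>x. (if k = k0 then 1 else 0) * point ({}, \<not> isl k0, J, \<alpha>) x)"
  proof
    fix x :: "('f, 'm, 'n) state"
    obtain A b' J' \<alpha>' where x: "x = (A, b', J', \<alpha>')" by (cases x)
    show "sep.act k0 (coord v k :: ('f, 'm, 'n, 's) superalg) (point ({}, False, J, \<alpha>)) x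
      = (if k = k0 then 1 else 0) * point ({}, \<not> isl k0, J, \<alpha>) x"
      unfolding x by (cases k; cases k0) (simp_all add: sep.act_sgen)
  qed
qed simp

lemma sum_pick: "(\<Sum>k\<in>UNIV. (if k = k0 then d else 0) * g k) = d * g (k0 :: 'k::finite)"
  for d :: real
proof -
  have "(\<Sum>k\<in>UNIV. (if k = k0 then d else 0) * g k) = (\<Sum>k\<in>UNIV. if k = k0 then d * g k0 else 0)"
    by (rule sum.cong) auto
  then show ?thesis by simp
qed

text \<open>Apply the difference \<open>\<Sum> D\<^sub>i\<^sub>k x\<^sub>k e\<^sub>i\<close> to the state with empty \<open>A\<close> and \<open>J\<close>, without \<open>\<xi>\<close>, and with all exponents \<open>1\<close>. The coordinates
  single out the column \<open>k0\<close>, the \<open>e\<^sub>i\<close> move to distinct states and so separate the rows, and on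
  each of these states an element of the Grassmann algebra can be read off.\<close>

theorem mat_action_eqD:
  fixes M M' :: "('f::{finite,linorder}, 'm::{finite,linorder}, 'n::{finite,linorder}, 's) smat"
  assumes M: "M \<in> Mat" "M' \<in> Mat" and eq: "mat_action M v = mat_action M' v"
  shows "M = M'"
proof -
  let ?D = "M - M'"
  have D: "?D \<in> Mat_over UNIV" using M unfolding Mat_eq by (rule Mat_over_diff)
  have "mat_action ?D v = mat_action M v - mat_action M' v"
    by (simp add: mat_action_def left_diff_distrib sum_subtractf)
  then have z: "mat_action ?D v = 0" using eq by simp
  have "?D $ i0 $ k0 = 0" for i0 k0
  proof (rule grass_faithful[OF Mat_overD[OF D]])
    fix A
    let ?p = "\<lambda>i. point ({}, \<not> isl k0, unit_state i)"
    have "\<exists>c. \<forall>i. c i \<noteq> 0 \<and> sep.act k0 (unit_vec i :: ('f, 'm, 'n, 's) superalg) (point ({}, False, {}, \<lambda>_. 1))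
        = (\<lambda>x. c i * point ({}, False, unit_state i) x)"
      by (intro choice allI unit_vec_point)
    then obtain c where c': "\<forall>i. c i \<noteq> 0 \<and> sep.act k0 (unit_vec i :: ('f, 'm, 'n, 's) superalg) (point ({}, False, {}, \<lambda>_. 1))
        = (\<lambda>x. c i * point ({}, False, unit_state i) x)" by (elim exE)
    note c = conjunct1[OF spec[OF c']] conjunct2[OF spec[OF c']]
    have "\<exists>d. \<forall>i. d i \<noteq> 0 \<and> (\<forall>k. sep.act k0 (coord v k :: ('f, 'm, 'n, 's) superalg) (point ({}, False, unit_state i))
      = (\<lambda>x. (if k = k0 then d i else 0) * ?p i x))"
      using coord_point[of k0 v "fst (unit_state i)" "snd (unit_state i)" for i]
      by (intro choice allI) (simp only: prod.collapse)
    then obtain d where d': "\<forall>i. d i \<noteq> 0 \<and> (\<forall>k. sep.act k0 (coord v k :: ('f, 'm, 'n, 's) superalg) (point ({}, False, unit_state i))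
      = (\<lambda>x. (if k = k0 then d i else 0) * ?p i x))" by (elim exE)
    note d = conjunct1[OF spec[OF d']] spec[OF conjunct2[OF spec[OF d']]]
    have "0 = sep.act k0 (mat_action ?D v) (point ({}, False, {}, \<lambda>_. 1)) (A, \<not> isl k0, unit_state i0)"
      by (simp only: z sep.act_zero)
    also have "\<dots> = (\<Sum>i\<in>UNIV. c i * (d i * sep.act k0 (?D $ i $ k0) (?p i) (A, \<not> isl k0, unit_state i0)))"
      unfolding mat_action_def sep.act_sum sep.act_mult c(2) sep.act_scale d(2) sum_pick ..
    also have "\<dots> = (\<Sum>i\<in>UNIV. if i = i0 then
        c i0 * (d i0 * sep.act k0 (?D $ i0 $ k0) (?p i0) (A, \<not> isl k0, unit_state i0)) else 0)"
    proof (intro sum.cong refl)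
      fix i
      have "sep.act k0 (?D $ i $ k0) (?p i) (A, \<not> isl k0, unit_state i0) = 0" if "i \<noteq> i0"
      proof -
        have ne: "unit_state i0 \<noteq> unit_state i" using that inj_unit_state by metis
        show ?thesis
          using grass_support[OF Mat_overD[OF D, of i k0], of "(A, \<not> isl k0, unit_state i0)"
            "\<not> isl k0" "fst (unit_state i)" "snd (unit_state i)" k0] ne
          by auto
      qed
      then show "c i * (d i * sep.act k0 (?D $ i $ k0) (?p i) (A, \<not> isl k0, unit_state i0)) =
        (if i = i0 then
        c i0 * (d i0 * sep.act k0 (?D $ i0 $ k0) (?p i0) (A, \<not> isl k0, unit_state i0)) else 0)" by auto
    qed
    finally have "sep.act k0 (?D $ i0 $ k0) (?p i0) (A, \<not> isl k0, unit_state i0) = 0"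
      using c(1)[of i0] d(1)[of i0] by simp
    then show "sep.act k0 (?D $ i0 $ k0) (point ({}, \<not> isl k0, fst (unit_state i0), snd (unit_state i0)))
      (A, \<not> isl k0, fst (unit_state i0), snd (unit_state i0)) = 0" by simp
  qed
  then show ?thesis by (simp add: vec_eq_iff)
qed

text \<open>The state of top degree in the \<open>f\<^sub>k\<close> is killed by every \<open>f\<^sub>k\<close>. On it an element of the
  Grassmann algebra acts by its body alone.\<close>

lemma grass_top:
  fixes a :: "('f::{finite,linorder}, 'm::{finite,linorder}, 'n, 's) superalg"
  assumes "a \<in> grass U" "{} \<notin> U"
  shows "sep.act k0 a (point (UNIV, b, J, \<alpha>)) = (\<lambda>i. 0)"
  using assms(1)
proof (induction rule: grass_induct)
  case (scale c A)
  then have "A \<noteq> {}" using assms(2) by auto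
  have kill: "sep_op k0 (GF k :: ('f, 'm, 'n, 's) gen) (point (UNIV, b, J, \<alpha>)) = (\<lambda>i. 0)" for k
    by (auto simp: fun_eq_iff)
  have zero: "sep_op k0 (GF k :: ('f, 'm, 'n, 's) gen) (\<lambda>i. 0) = (\<lambda>i. 0)" for k
    by (auto simp: fun_eq_iff)
  have "sep.act k0 (f_word ks :: ('f, 'm, 'n, 's) superalg) (point (UNIV, b, J, \<alpha>)) = (\<lambda>i. 0)" if "ks \<noteq> []" for ks
    using that
  proof (induction ks)
    case (Cons k ks)
    then show ?case by (cases "ks = []") (simp_all add: sep.act_mult sep.act_sgen sep.act_one kill zero)
  qed simp
  then have "sep.act k0 (f_mono A :: ('f, 'm, 'n, 's) superalg) (point (UNIV, b, J, \<alpha>)) = (\<lambda>i. 0)"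
    using \<open>A \<noteq> {}\<close> unfolding f_mono_def by simp
  then show ?case by (simp add: sep.act_scaleR)
qed (auto simp: sep.act_zero sep.act_add)

lemma grass_body_zero:
  assumes "c *\<^sub>R (1 :: ('f::{finite,linorder}, 'm::{finite,linorder}, 'n, 's) superalg) \<in> grass U" "{} \<notin> U"
  shows "c = 0"
proof -
  have "sep.act (Inl undefined) (c *\<^sub>R (1 :: ('f, 'm, 'n, 's) superalg))
      (point (UNIV, True, {}, \<lambda>_. 0)) (UNIV, True, {}, \<lambda>_. 0) = 0"
    by (simp only: grass_top[OF assms])
  then show ?thesis by (simp add: sep.act_scaleR sep.act_one)
qed

section \<open>Absolutely convergent sums in a real algebra\<close>

text \<open>Convergence without a topology on the algebra: finite sums of absolutely convergent real series
  times fixed elements. Absolute convergence is what makes Cauchy products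
  converge to the product of the sums.\<close>

inductive abs_sums :: "(nat \<Rightarrow> 'a::real_algebra_1) \<Rightarrow> 'a \<Rightarrow> bool" where
  single: "summable (\<lambda>d. \<bar>c d\<bar>) \<Longrightarrow> abs_sums (\<lambda>d. c d *\<^sub>R t) (suminf c *\<^sub>R t)"
| add: "abs_sums u a \<Longrightarrow> abs_sums w b \<Longrightarrow> abs_sums (\<lambda>d. u d + w d) (a + b)"

lemma abs_sums_zero: "abs_sums (\<lambda>d. 0) 0"
  using abs_sums.single[of "\<lambda>d. 0" 0] by simp

lemma abs_sums_sum:
  "(\<And>i. i \<in> I \<Longrightarrow> abs_sums (u i) (a i)) \<Longrightarrow> abs_sums (\<lambda>d. \<Sum>i\<in>I. u i d) (sum a I)"
  by (induction I rule: infinite_finite_induct) (simp_all add: abs_sums_zero abs_sums.add)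

lemma abs_sums_delta: "abs_sums (\<lambda>d. if d = n then a else 0) a"
proof -
  have "(\<lambda>d. if d = n then 1 else 0 :: real) sums 1" by (rule sums_If_finite_set[of "{n}" "\<lambda>_. 1", simplified])
  moreover have "summable (\<lambda>d. \<bar>if d = n then 1 else 0 :: real\<bar>)"
    by (rule summable_finite[of "{n}"]) auto
  ultimately show ?thesis
    using abs_sums.single[of "\<lambda>d. if d = n then 1 else 0" a]
    by (simp add: sums_unique[symmetric] if_distrib[of "\<lambda>c. c *\<^sub>R a"] cong: if_cong)
qed

lemma abs_sums_right: "abs_sums u a \<Longrightarrow> abs_sums (\<lambda>d. u d * z) (a * z)"
  by (induction rule: abs_sums.induct) (auto simp: distrib_right intro: abs_sums.intros)

lemma abs_sums_cauchy:
  assumes "abs_sums u a" "abs_sums w b"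
  shows "abs_sums (\<lambda>d. \<Sum>i=0..d. u i * w (d - i)) (a * b)"
  using assms(1)
proof (induction rule: abs_sums.induct)
  case (single c t)
  show ?case
    using assms(2)
  proof (induction rule: abs_sums.induct)
    case (single c' t')
    let ?p = "\<lambda>d. \<Sum>i\<le>d. c i * c' (d - i)"
    have n: "summable (\<lambda>d. norm (c d))" "summable (\<lambda>d. norm (c' d))"
      using single \<open>summable (\<lambda>d. \<bar>c d\<bar>)\<close> by simp_all
    have "summable (\<lambda>d. \<Sum>i\<le>d. \<bar>c i\<bar> * \<bar>c' (d - i)\<bar>)"
      using n by (intro summable_Cauchy_product) simp_all
    then have "summable (\<lambda>d. \<bar>?p d\<bar>)"
      by (rule summable_comparison_test'[of _ 0]) (auto simp: abs_mult[symmetric])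
    then have "abs_sums (\<lambda>d. ?p d *\<^sub>R (t * t')) (suminf ?p *\<^sub>R (t * t'))"
      by (rule abs_sums.single)
    moreover have "suminf ?p = suminf c * suminf c'"
      using Cauchy_product_sums[OF n] by (simp add: sums_iff)
    ultimately show ?case
      by (simp add: scaleR_sum_left atLeast0AtMost mult.commute)
  next
    case (add u a w b)
    then show ?case by (simp add: distrib_left sum.distrib abs_sums.add)
  qed
next
  case (add u a w b)
  then show ?case by (simp add: distrib_right sum.distrib abs_sums.add)
qed

lemma abs_sums_linear:
  fixes \<phi> :: "'a::real_algebra_1 \<Rightarrow> real"
  assumes "abs_sums u a" "linear \<phi>"
  shows "(\<lambda>d. \<phi> (u d)) sums \<phi> a"
  using assms(1)
proof (induction rule: abs_sums.induct)
  case (single c t)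
  then have "c sums suminf c" by (intro summable_sums) (rule summable_rabs_cancel)
  then show ?case by (simp add: linear_scale[OF assms(2)] sums_mult2)
next
  case (add u a w b)
  then show ?case by (simp add: linear_add[OF assms(2)] sums_add)
qed

text \<open>Linear functionals separate the points of a real vector space.\<close>

lemma has_value_unique:
  assumes "has_value u a" "has_value u b"
  shows "a = b"
proof (rule ccontr)
  assume "a \<noteq> b"
  then have "independent {a - b}" by simp
  then obtain \<phi> :: "_ \<Rightarrow> real" where \<phi>: "linear \<phi>" "\<phi> (a - b) = 1"
    using linear_independent_extend[of "{a - b}" "\<lambda>_. 1::real"] by auto
  then have "\<phi> a = \<phi> b" using assms unfolding has_value_def by (blast intro: sums_unique2)
  then show False using \<phi> linear_diff[OF \<phi>(1), of a b] by simp
qed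

section \<open>Conjugation by an exponential\<close>

definition ad :: "'a::ring_1 \<Rightarrow> 'a \<Rightarrow> 'a" where
  "ad B a = B * a - a * B"

lemma superexp_nth: "fps_nth (superexp B) d = B ^ d /\<^sub>R fact d"
  by (simp add: superexp_def)

lemma exp_coeff_Suc:
  fixes B :: "'a::real_algebra_1"
  shows "real (Suc k) *\<^sub>R (B ^ Suc k /\<^sub>R fact (Suc k)) = B * (B ^ k /\<^sub>R fact k)"
    and "real (Suc k) *\<^sub>R (B ^ Suc k /\<^sub>R fact (Suc k)) = (B ^ k /\<^sub>R fact k) * B"
  by (simp_all add: field_simps power_commutes del: of_nat_Suc)

text \<open>This is the coefficient of \<open>t\<^sup>k\<close> in \<open>e\<^sup>t\<^sup>B a e\<^sup>-\<^sup>t\<^sup>B = e\<^sup>t\<^sup>a\<^sup>d\<^sup>B a\<close>. Differentiation in \<open>t\<close> shows that the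
  coefficients \<open>F\<^sub>k\<close> of the left-hand side satisfy \<open>(k + 1) F\<^sub>k\<^sub>+\<^sub>1 = B F\<^sub>k - F\<^sub>k B\<close>; the proof
  checks this recursion on the sums.\<close>

lemma conj_coeff:
  fixes B :: "'a::real_algebra_1"
  shows "(\<Sum>i=0..k. (B ^ i /\<^sub>R fact i) * a * ((- B) ^ (k - i) /\<^sub>R fact (k - i)))
    = (ad B ^^ k) a /\<^sub>R fact k"
proof (induction k)
  case (Suc k)
  let ?P = "\<lambda>i. B ^ i /\<^sub>R fact i" and ?Q = "\<lambda>i. (- B) ^ i /\<^sub>R fact i"
  let ?F = "\<lambda>k. \<Sum>i=0..k. ?P i * a * ?Q (k - i)"
  have "real (Suc k) *\<^sub>R ?F (Suc k) =
     (\<Sum>i=0..Suc k. (real i *\<^sub>R ?P i) * a * ?Q (Suc k - i) + ?P i * a * (real (Suc k - i) *\<^sub>R ?Q (Suc k - i)))"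
    unfolding scaleR_sum_right
  proof (intro sum.cong refl)
    fix i assume "i \<in> {0..Suc k}"
    then have "real (Suc k) = real i + real (Suc k - i)" by auto
    then have "real (Suc k) *\<^sub>R (p * a * q) = (real i *\<^sub>R p) * a * q + p * a * (real (Suc k - i) *\<^sub>R q)"
      for p q by (simp only: scaleR_add_left mult_scaleR_left mult_scaleR_right)
    then show "real (Suc k) *\<^sub>R (?P i * a * ?Q (Suc k - i)) =
      (real i *\<^sub>R ?P i) * a * ?Q (Suc k - i) + ?P i * a * (real (Suc k - i) *\<^sub>R ?Q (Suc k - i))" .
  qed
  also have "\<dots> = (\<Sum>i=0..Suc k. (real i *\<^sub>R ?P i) * a * ?Q (Suc k - i))
      + (\<Sum>i=0..Suc k. ?P i * a * (real (Suc k - i) *\<^sub>R ?Q (Suc k - i)))"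
    by (rule sum.distrib)
  also have "(\<Sum>i=0..Suc k. (real i *\<^sub>R ?P i) * a * ?Q (Suc k - i)) =
      (\<Sum>i=0..k. (real (Suc i) *\<^sub>R ?P (Suc i)) * a * ?Q (k - i))"
    by (subst sum.atLeast0_atMost_Suc_shift) simp
  also have "\<dots> = B * ?F k"
    unfolding exp_coeff_Suc(1) by (simp only: sum_distrib_left mult.assoc)
  also have "(\<Sum>i=0..Suc k. ?P i * a * (real (Suc k - i) *\<^sub>R ?Q (Suc k - i))) =
      (\<Sum>i=0..k. ?P i * a * (real (Suc (k - i)) *\<^sub>R ?Q (Suc (k - i))))"
    by (auto simp: Suc_diff_le intro!: sum.cong)
  also have "\<dots> = - (?F k * B)"
    unfolding exp_coeff_Suc(2) by (simp only: sum_distrib_right mult.assoc mult_minus_right sum_negf)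
  finally have "real (Suc k) *\<^sub>R ?F (Suc k) = ad B (?F k)" by (simp add: ad_def)
  also have "\<dots> = ad B ((ad B ^^ k) a /\<^sub>R fact k)" by (simp only: Suc)
  also have "\<dots> = (ad B ^^ Suc k) a /\<^sub>R fact k" by (simp add: ad_def scaleR_diff_right)
  finally have "inverse (real (Suc k)) *\<^sub>R real (Suc k) *\<^sub>R ?F (Suc k)
     = inverse (real (Suc k)) *\<^sub>R ((ad B ^^ Suc k) a /\<^sub>R fact k)" by (simp only:)
  then show ?case by (simp del: of_nat_Suc)
qed simp

text \<open>The formal sum \<open>u\<close> is conjugated summand by summand, after the triple sum has been ordered by
  the index of the summand of \<open>u\<close>.\<close>

lemma superexp_conj_nth:
  "fps_nth (superexp B * u * superexp (- B)) d
    = (\<Sum>j=0..d. (ad B ^^ (d - j)) (fps_nth u j) /\<^sub>R fact (d - j))"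
proof -
  let ?P = "\<lambda>i. B ^ i /\<^sub>R fact i" and ?Q = "\<lambda>i. (- B) ^ i /\<^sub>R fact i"
  have "fps_nth (superexp B * u * superexp (- B)) d
      = (\<Sum>l=0..d. (\<Sum>i=0..l. ?P i * fps_nth u (l - i)) * ?Q (d - l))"
    by (simp add: fps_mult_nth superexp_nth)
  also have "\<dots> = (\<Sum>l=0..d. \<Sum>i=0..l. ?P (l - i) * fps_nth u i * ?Q (d - l))"
  proof (intro sum.cong refl)
    fix l
    have "(\<Sum>i=0..l. ?P i * fps_nth u (l - i)) = (\<Sum>i=0..l. ?P (l - i) * fps_nth u i)"
      by (subst sum.atLeastAtMost_rev) (auto intro!: sum.cong)
    then show "(\<Sum>i=0..l. ?P i * fps_nth u (l - i)) * ?Q (d - l) =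
      (\<Sum>i=0..l. ?P (l - i) * fps_nth u i * ?Q (d - l))"
      by (simp only: sum_distrib_right)
  qed
  also have "\<dots> = (\<Sum>j=0..d. \<Sum>i=0..d - j. ?P i * fps_nth u j * ?Q (d - j - i))"
    by (rule fps_mult_assoc_lemma[where f = "\<lambda>i j k. ?P j * fps_nth u i * ?Q k" and k = d and n = d])
  also have "\<dots> = (\<Sum>j=0..d. (ad B ^^ (d - j)) (fps_nth u j) /\<^sub>R fact (d - j))"
    by (intro sum.cong refl conj_coeff)
  finally show ?thesis .
qed

text \<open>Conjugation fixes \<open>1\<close>, because \<open>ad B 1 = 0\<close>.\<close>

lemma superexp_inverse: "superexp B * superexp (- B) = 1"
proof (rule fps_ext)
  fix d
  have "(ad B ^^ k) 1 = (if k = 0 then 1 else 0)" for k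
    by (induction k) (simp_all add: ad_def)
  moreover have "(ad B ^^ k) 0 = 0" for k
    by (induction k) (simp_all add: ad_def)
  ultimately show "fps_nth (superexp B * superexp (- B)) d = fps_nth 1 d"
    using superexp_conj_nth[of B 1 d] by (simp add: fps_one_nth sum.delta cong: if_cong)
       (auto intro!: sum.neutral)
qed

lemma inverse_pair:
  fixes a :: "'a::monoid_mult"
  assumes "a * a' = 1" "b * b' = 1"
  shows "(a * b) * (b' * a') = 1"
proof -
  have "(a * b) * (b' * a') = a * (b * b') * a'" by (simp only: mult.assoc)
  then show ?thesis using assms by simp
qed

lemma ring_inv_eq: "a * b = 1 \<Longrightarrow> b * a = 1 \<Longrightarrow> ring_inv a = b"
  unfolding ring_inv_def by (rule the_equality) (auto, metis mult.assoc mult_1_left mult_1_right)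

section \<open>Supermatrices realised by conjugation\<close>

lemma mat_action_add: "mat_action (M + N) v = mat_action M v + mat_action N v"
  by (simp add: mat_action_def distrib_right sum.distrib)

lemma mat_action_scale: "mat_action (c *\<^sub>R M) v = c *\<^sub>R mat_action M v"
  by (simp add: mat_action_def scaleR_sum_right[symmetric])

lemma mat_action_sum: "mat_action (sum h I) v = (\<Sum>i\<in>I. mat_action (h i) v)"
proof (induction I rule: infinite_finite_induct)
  case (insert x F)
  then show ?case by (simp add: mat_action_add)
qed (simp_all add: mat_action_def)

lemma mat_action_one: "mat_action (mat 1) v = (supervector v :: ('f, 'm::{finite,linorder}, 'n::finite, 's) superalg)"
proof -
  have "(\<Sum>k\<in>UNIV. (mat 1 :: ('f, 'm, 'n, 's) smat) $ i $ k * coord v k) = coord v i" for i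
    by (simp add: mat_def if_distrib[of "\<lambda>x. x * _"] cong: if_cong)
  then show ?thesis by (simp add: mat_action_def supervector_def)
qed

text \<open>The formal sum \<open>s x s\<^sup>-\<^sup>1\<close> consists of images \<open>U\<^sub>d x\<close> of \<open>x\<close>, and the supermatrices \<open>U\<^sub>d\<close> sum up to \<open>M\<close>.
  The convergence is asked of the entries of \<open>U\<^sub>d\<close> instead of the elements \<open>U\<^sub>d x\<close>, since the next factor of
  \<open>s\<close> multiplies the \<open>U\<^sub>d\<close>.\<close>

definition orbit :: "('f::{finite,linorder}, 'm::{finite,linorder}, 'n::{finite,linorder}, 's) superalg fps
    \<Rightarrow> ('f, 'm, 'n, 's) smat \<Rightarrow> (nat \<Rightarrow> ('f, 'm, 'n, 's) smat) \<Rightarrow> bool" where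
  "orbit s M U \<longleftrightarrow> (\<forall>d. U d \<in> Mat) \<and>
     (\<forall>v d. fps_nth (s * fps_const (supervector v) * ring_inv s) d = mat_action (U d) v) \<and>
     (\<forall>i k. abs_sums (\<lambda>d. U d $ i $ k) (M $ i $ k))"

lemma orbitD:
  assumes "orbit s M U"
  shows "U d \<in> Mat"
    and "fps_nth (s * fps_const (supervector v) * ring_inv s) d = mat_action (U d) v"
    and "abs_sums (\<lambda>d. U d $ i $ k) (M $ i $ k)"
  using assms unfolding orbit_def by simp_all

definition realizes :: "('f::{finite,linorder}, 'm::{finite,linorder}, 'n::{finite,linorder}, 's) superalg fps
    \<Rightarrow> ('f, 'm, 'n, 's) smat \<Rightarrow> bool" where
  "realizes s M \<longleftrightarrow> M \<in> Mat \<and> (\<exists>U. orbit s M U)"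

text \<open>Existence of the value follows from absolute convergence of the entries; uniqueness combines
  \<open>has_value_unique\<close> with \<open>mat_action_eqD\<close>.\<close>

lemma realizes_spin_hom:
  fixes M :: "('f::{finite,linorder}, 'm::{finite,linorder}, 'n::{finite,linorder}, 's) smat"
  assumes "realizes s M"
  shows "spin_hom s = M"
proof -
  obtain U where M: "M \<in> Mat" and orb: "orbit s M U"
    using assms unfolding realizes_def by blast
  note U = orbitD(2,3)[OF orb]
  have val: "has_value (s * fps_const (supervector v) * ring_inv s) (mat_action M v)" for v
    unfolding has_value_def U(1)
  proof (intro allI impI)
    fix \<phi> :: "('f, 'm, 'n, 's) superalg \<Rightarrow> real"
    assume \<phi>: "linear \<phi>"
    have "abs_sums (\<lambda>d. mat_action (U d) v) (mat_action M v)"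
      unfolding mat_action_def by (intro abs_sums_sum abs_sums_right U(2))
    then show "(\<lambda>d. \<phi> (mat_action (U d) v)) sums \<phi> (mat_action M v)"
      by (rule abs_sums_linear[OF _ \<phi>])
  qed
  show ?thesis
    unfolding spin_hom_def
  proof (rule the_equality)
    show "M \<in> Mat \<and> (\<forall>v. has_value (s * fps_const (supervector v) * ring_inv s) (mat_action M v))"
      using M val by (intro conjI allI)
    fix M' assume M': "M' \<in> Mat \<and>
      (\<forall>v. has_value (s * fps_const (supervector v) * ring_inv s) (mat_action M' v))"
    have "mat_action M' undefined = mat_action M undefined"
      by (rule has_value_unique[OF spec[OF conjunct2[OF M']] val])
    then show "M' = M" by (rule mat_action_eqD[OF conjunct1[OF M'] M])
  qed
qed

text \<open>The commutator is prescribed on all \<open>U x\<close> with \<open>U\<close> in \<open>Mat\<close> and not only on \<open>x\<close>, because the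
  commutator with \<open>B\<close> is iterated and is also applied after other factors have acted.\<close>

definition infinitesimal :: "('f::{finite,linorder}, 'm::{finite,linorder}, 'n::{finite,linorder}, 's) superalg
    \<Rightarrow> ('f, 'm, 'n, 's) smat \<Rightarrow> bool" where
  "infinitesimal B N \<longleftrightarrow> N \<in> Mat \<and> (\<forall>U\<in>Mat. \<forall>v. ad B (mat_action U v) = mat_action (N ** U) v)"

definition exp_term :: "('f, 'm::{finite,linorder}, 'n::finite, 's) smat \<Rightarrow> nat \<Rightarrow> ('f, 'm, 'n, 's) smat" where
  "exp_term N d = (((**) N) ^^ d) (mat 1) /\<^sub>R fact d"

definition exp_sums :: "('f, 'm::{finite,linorder}, 'n::finite, 's) smat \<Rightarrow> ('f, 'm, 'n, 's) smat \<Rightarrow> bool" where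
  "exp_sums N E \<longleftrightarrow> (\<forall>i k. abs_sums (\<lambda>d. exp_term N d $ i $ k) (E $ i $ k))"

lemma exp_term_0: "exp_term N 0 = mat 1"
  by (simp add: exp_term_def)

lemma exp_term_Suc:
  fixes N :: "('f, 'm::{finite,linorder}, 'n::finite, 's) smat"
  shows "exp_term N (Suc d) = (N ** exp_term N d) /\<^sub>R real (Suc d)"
  by (simp add: exp_term_def matrix_scalar_ac scalar_matrix_assoc[symmetric] del: of_nat_Suc)

lemma exp_term_Mat:
  fixes N :: "('f::{finite,linorder}, 'm::{finite,linorder}, 'n::{finite,linorder}, 's) smat"
  assumes "N \<in> Mat" shows "exp_term N d \<in> Mat"
proof (induction d)
  case (Suc d)
  then have "N ** exp_term N d \<in> Mat_over UNIV" using assms by (simp add: Mat_mult Mat_eq[symmetric])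
  then show ?case unfolding exp_term_Suc Mat_eq by (rule Mat_over_scale)
qed (simp add: exp_term_0 Mat_one)

lemma infinitesimal_power:
  fixes U N :: "('f::{finite,linorder}, 'm::{finite,linorder}, 'n::{finite,linorder}, 's) smat"
  assumes B: "infinitesimal B N" and U: "U \<in> Mat"
  shows "(ad B ^^ k) (mat_action U v) /\<^sub>R fact k = mat_action (exp_term N k ** U) v"
proof (induction k)
  case (Suc k)
  have N: "N \<in> Mat" using B by (simp add: infinitesimal_def)
  have "(ad B ^^ Suc k) (mat_action U v) /\<^sub>R fact (Suc k)
     = ad B ((ad B ^^ k) (mat_action U v) /\<^sub>R fact k) /\<^sub>R real (Suc k)"
    by (simp add: ad_def scaleR_diff_right)
  also have "\<dots> = mat_action (N ** (exp_term N k ** U)) v /\<^sub>R real (Suc k)"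
    using B U N unfolding Suc by (simp add: infinitesimal_def Mat_mult exp_term_Mat)
  also have "\<dots> = mat_action (exp_term N (Suc k) ** U) v"
    unfolding exp_term_Suc by (simp only: scalar_matrix_assoc[symmetric] mat_action_scale matrix_mul_assoc)
  finally show ?case .
qed (simp add: exp_term_0)

text \<open>The summands of \<open>e\<^sup>B s x s\<^sup>-\<^sup>1 e\<^sup>-\<^sup>B\<close> are the Cauchy products of the \<open>N\<^sup>k / k!\<close> with the summands
  belonging to \<open>s\<close>, and Cauchy products of absolutely convergent series have the product of the
  sums as their sum.\<close>

lemma realizes_exp_mult:
  fixes M N E :: "('f::{finite,linorder}, 'm::{finite,linorder}, 'n::{finite,linorder}, 's) smat"
  assumes B: "infinitesimal B N" and E: "exp_sums N E" "E \<in> Mat"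
    and s: "s * t = 1" "t * s = 1" and M: "realizes s M"
  shows "realizes (superexp B * s) (E ** M)"
proof -
  have N: "N \<in> Mat" using B by (simp add: infinitesimal_def)
  obtain U where MM: "M \<in> Mat" and orb: "orbit s M U"
    using M unfolding realizes_def by blast
  note U = orbitD[OF orb]
  let ?U = "\<lambda>d. \<Sum>j=0..d. exp_term N j ** U (d - j)"
  have inv: "ring_inv s = t" using s by (rule ring_inv_eq)
  have e: "superexp B * superexp (- B) = 1" "superexp (- B) * superexp B = 1"
    using superexp_inverse[of B] superexp_inverse[of "- B"] by simp_all
  have "ring_inv (superexp B * s) = t * superexp (- B)"
  proof (rule ring_inv_eq)
    show "superexp B * s * (t * superexp (- B)) = 1"
      by (rule inverse_pair[OF e(1) s(1)])
    show "t * superexp (- B) * (superexp B * s) = 1"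
      by (rule inverse_pair[OF s(2) e(2)])
  qed
  then have conj: "superexp B * s * fps_const (supervector v) * ring_inv (superexp B * s)
    = superexp B * (s * fps_const (supervector v) * ring_inv s) * superexp (- B)" for v
    by (simp add: inv mult.assoc)
  have "fps_nth (superexp B * s * fps_const (supervector v) * ring_inv (superexp B * s)) d
    = mat_action (?U d) v" for v d
  proof -
    have "fps_nth (superexp B * s * fps_const (supervector v) * ring_inv (superexp B * s)) d
      = (\<Sum>j=0..d. mat_action (exp_term N (d - j) ** U j) v)"
      unfolding conj superexp_conj_nth U(2) infinitesimal_power[OF B U(1)] ..
    also have "\<dots> = (\<Sum>j=0..d. mat_action (exp_term N j ** U (d - j)) v)"
      by (subst sum.atLeastAtMost_rev) (auto intro!: sum.cong)
    finally show ?thesis by (simp add: mat_action_sum)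
  qed
  moreover have "?U d \<in> Mat" for d
    unfolding Mat_eq using U(1) N
    by (intro Mat_over_sum) (simp add: Mat_eq[symmetric] Mat_mult exp_term_Mat)
  moreover have "abs_sums (\<lambda>d. ?U d $ i $ k) ((E ** M) $ i $ k)" for i k
  proof -
    have "?U d $ i $ k = (\<Sum>l\<in>UNIV. \<Sum>j=0..d. exp_term N j $ i $ l * U (d - j) $ l $ k)" for d
      by (subst sum.swap) (simp add: matrix_matrix_mult_def)
    moreover have "abs_sums (\<lambda>d. \<Sum>l\<in>UNIV. \<Sum>j=0..d. exp_term N j $ i $ l * U (d - j) $ l $ k)
      (\<Sum>l\<in>UNIV. E $ i $ l * M $ l $ k)"
      using E(1) U(3) unfolding exp_sums_def by (intro abs_sums_sum abs_sums_cauchy) blast+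
    ultimately show ?thesis by (simp add: matrix_matrix_mult_def)
  qed
  ultimately show ?thesis
    unfolding realizes_def orbit_def using Mat_mult[OF E(2) MM] by (intro conjI exI[of _ ?U] allI)
qed

text \<open>An inverse of \<open>s\<close> is part of the condition, since the definite description \<open>ring_inv s\<close> is
  meaningful only for invertible \<open>s\<close>.\<close>

definition spin_image :: "('f::{finite,linorder}, 'm::{finite,linorder}, 'n::{finite,linorder}, 's) smat set" where
  "spin_image = {M. \<exists>s t. s \<in> Spin \<and> s * t = 1 \<and> t * s = 1 \<and> realizes s M}"

lemma spin_image_exp:
  fixes M N E :: "('f::{finite,linorder}, 'm::{finite,linorder}, 'n::{finite,linorder}, 's) smat"
  assumes B: "B \<in> bivectors" "infinitesimal B N" and E: "exp_sums N E" "E \<in> Mat"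
    and M: "M \<in> spin_image"
  shows "E ** M \<in> spin_image"
proof -
  obtain s t where s: "s \<in> Spin" "s * t = 1" "t * s = 1" "realizes s M"
    using M by (auto simp: spin_image_def)
  obtain Bs where Bs: "s = prod_list (map superexp Bs)" "set Bs \<subseteq> bivectors"
    using s(1) by (auto simp: Spin_def)
  have Spin: "superexp B * s \<in> Spin"
    unfolding Spin_def using Bs B(1) by (intro CollectI exI[of _ "B # Bs"]) simp
  have e: "superexp B * superexp (- B) = 1" "superexp (- B) * superexp B = 1"
    using superexp_inverse[of B] superexp_inverse[of "- B"] by simp_all
  show ?thesis
    unfolding spin_image_def
    by (intro CollectI exI conjI, rule Spin, rule inverse_pair[OF e(1) s(2)],
        rule inverse_pair[OF s(3) e(2)], rule realizes_exp_mult[OF B(2) E s(2-4)])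
qed

lemma spin_image_one:
  assumes "(0 :: ('f::{finite,linorder}, 'm::{finite,linorder}, 'n::{finite,linorder}, 's) superalg) \<in> bivectors"
  shows "(mat 1 :: ('f, 'm, 'n, 's) smat) \<in> spin_image"
proof -
  have "superexp 0 = (1 :: ('f, 'm, 'n, 's) superalg fps)"
    by (rule fps_ext) (simp add: superexp_nth fps_one_nth power_0_left)
  then have Spin: "(1 :: ('f, 'm, 'n, 's) superalg fps) \<in> Spin"
    unfolding Spin_def using assms by (intro CollectI exI[of _ "[0]"]) simp
  have "ring_inv 1 = (1 :: ('f, 'm, 'n, 's) superalg fps)" by (rule ring_inv_eq) simp_all
  then have "realizes 1 (mat 1 :: ('f, 'm, 'n, 's) smat)"
    unfolding realizes_def orbit_def
  proof (intro conjI exI[of _ "\<lambda>d. if d = 0 then mat 1 else 0"] allI)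
    fix i k
    show "abs_sums (\<lambda>d. (if d = 0 then mat 1 else 0) $ i $ k) ((mat 1 :: ('f, 'm, 'n, 's) smat) $ i $ k)"
      using abs_sums_delta[of 0 "(mat 1 :: ('f, 'm, 'n, 's) smat) $ i $ k"]
      by (simp add: if_distrib[of "\<lambda>M. M $ i $ k"] cong: if_cong)
  next
    fix d
    show "(if d = 0 then mat 1 else 0 :: ('f, 'm, 'n, 's) smat) \<in> Mat"
      by (simp add: Mat_one) (simp add: Mat_eq Mat_over_0)
  next
    fix v d
    have "mat_action (0 :: ('f, 'm, 'n, 's) smat) v = 0" by (simp add: mat_action_def)
    then show "fps_nth (1 * fps_const (supervector v) * ring_inv 1) d
      = mat_action (if d = 0 then mat 1 else 0 :: ('f, 'm, 'n, 's) smat) v"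
      using \<open>ring_inv 1 = 1\<close> by (simp add: mat_action_one)
  qed (rule Mat_one)
  then show ?thesis unfolding spin_image_def using Spin by (intro CollectI exI[of _ 1]) simp
qed

section \<open>The adjoint with respect to the metric\<close>

fun flip :: "'n dbl \<Rightarrow> 'n dbl" where
  "flip (Od j) = Ev j"
| "flip (Ev j) = Od j"

fun sg :: "'n dbl \<Rightarrow> real" where
  "sg (Od j) = 1"
| "sg (Ev j) = -1"

lemma flip_flip [simp]: "flip (flip p) = p"
  and sg_flip [simp]: "sg (flip p) = - sg p"
  and sg_sg [simp]: "sg p * sg p = 1" "sg p * (sg p * x) = x"
  by (cases p; simp)+

lemma gform_flip: "gform p q = (if q = flip p then sg p else 0)"
  by (cases p; cases q) auto

lemma gform_flip': "gform p q = (if p = flip q then - sg q else 0)"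
  by (cases p; cases q) auto

lemma sum_gform_right: "(\<Sum>q\<in>UNIV. gform p q *\<^sub>R h q) = sg p *\<^sub>R h (flip p)"
  for h :: "'n::finite dbl \<Rightarrow> 'a::real_vector"
proof -
  have "(\<Sum>q\<in>UNIV. gform p q *\<^sub>R h q) = (\<Sum>q\<in>UNIV. if q = flip p then sg p *\<^sub>R h q else 0)"
    by (rule sum.cong) (auto simp: gform_flip)
  then show ?thesis by simp
qed

lemma sum_gform_left: "(\<Sum>p\<in>UNIV. gform p q *\<^sub>R h p) = - sg q *\<^sub>R h (flip q)"
  for h :: "'n::finite dbl \<Rightarrow> 'a::real_vector"
proof -
  have "(\<Sum>p\<in>UNIV. gform p q *\<^sub>R h p) = (\<Sum>p\<in>UNIV. if p = flip q then - sg q *\<^sub>R h p else 0)"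
    by (rule sum.cong) (auto simp: gform_flip')
  then show ?thesis by simp
qed

lemma sum_UNIV_sum: "(\<Sum>k\<in>UNIV. h k) = (\<Sum>i\<in>UNIV. h (Inl i)) + (\<Sum>p\<in>UNIV. h (Inr p))"
  for h :: "'m::finite + 'p::finite \<Rightarrow> 'a::comm_monoid_add"
  unfolding UNIV_Plus_UNIV[symmetric] by (subst sum.Plus) simp_all

text \<open>On the odd indices \<open>Q\<close> is a multiple of the symplectic form, which pairs \<open>2j-1\<close> with \<open>2j\<close>.\<close>

fun conj_ix :: "'m + 'n dbl \<Rightarrow> 'm + 'n dbl" where
  "conj_ix (Inl i) = Inl i"
| "conj_ix (Inr p) = Inr (flip p)"

fun star_coeff :: "'m + 'n dbl \<Rightarrow> 'm + 'n dbl \<Rightarrow> real" where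
  "star_coeff (Inl i) (Inl j) = 1"
| "star_coeff (Inl i) (Inr q) = sg q / 2"
| "star_coeff (Inr p) (Inl j) = - 2 * sg p"
| "star_coeff (Inr p) (Inr q) = sg p * sg q"

text \<open>This is \<open>Q\<^sup>-\<^sup>1 M\<^sup>S\<^sup>T Q\<close> written out in entries, as confirmed in the proof of \<open>SO_0_star\<close>. While the
  supertranspose has order four, this adjoint is an involution; \<open>M\<close> preserves \<open>Q\<close> when
  \<open>star M ** M = 1\<close>, and \<open>N\<close> is skew for \<open>Q\<close> when \<open>star N = - N\<close>.\<close>

definition star :: "('f, 'm::finite, 'n::finite, 's) smat \<Rightarrow> ('f, 'm, 'n, 's) smat" where
  "star M = (\<chi> i j. star_coeff i j *\<^sub>R M $ conj_ix j $ conj_ix i)"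

lemma conj_ix_conj_ix [simp]: "conj_ix (conj_ix i) = i"
  by (cases i) simp_all

lemma conj_ix_eq_iff [simp]: "conj_ix i = conj_ix j \<longleftrightarrow> i = j"
  by (metis conj_ix_conj_ix)

lemma isl_conj_ix [simp]: "isl (conj_ix i) = isl i"
  by (cases i) simp_all

lemma star_star [simp]:
  fixes M :: "('f, 'm::finite, 'n::finite, 's) smat"
  shows "star (star M) = M"
proof -
  have "star_coeff i j * star_coeff (conj_ix j) (conj_ix i) = 1" for i j :: "'m + 'n dbl"
    by (cases i; cases j) (simp_all add: mult_ac)
  then show ?thesis by (simp add: star_def vec_eq_iff)
qed

lemma star_diff: "star (M - N) = star M - star N"
  and star_add: "star (M + N) = star M + star N"
  and star_scale: "star (c *\<^sub>R M) = c *\<^sub>R star M"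
  by (simp_all add: star_def vec_eq_iff algebra_simps)

lemma star_one: "star (mat 1 :: ('f, 'm::{finite,linorder}, 'n::finite, 's) smat) = mat 1"
proof -
  have "star_coeff i i = 1" for i :: "'m + 'n dbl" by (cases i) simp_all
  then show ?thesis by (auto simp: star_def vec_eq_iff mat_def)
qed

lemma star_Mat_over:
  fixes M :: "('f::{finite,linorder}, 'm::{finite,linorder}, 'n::{finite,linorder}, 's) smat"
  assumes M: "M \<in> Mat_over U"
  shows "star M \<in> Mat_over U"
proof -
  have "entry_parity (conj_ix j) (conj_ix i) = entry_parity i j" for i j :: "'m + 'n dbl"
    by (auto simp: entry_parity_def)
  then show ?thesis
    using Mat_overD[OF M, of "conj_ix j" "conj_ix i" for i j]
    by (simp add: star_def Mat_over_def grass_scale)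
qed

text \<open>Exchanging two odd entries costs a sign, and the coefficients \<open>star_coeff\<close> provide the same
  sign.\<close>

lemma star_mult:
  fixes M N :: "('f::{finite,linorder}, 'm::{finite,linorder}, 'n::{finite,linorder}, 's) smat"
  assumes "M \<in> Mat" "N \<in> Mat"
  shows "star (M ** N) = star N ** star M"
proof -
  have comm: "M $ a $ k * N $ k $ b =
     (if entry_parity a k \<and> entry_parity k b then -1 else 1) *\<^sub>R (N $ k $ b * M $ a $ k)" for a b k
    using assms unfolding Mat_eq
    by (intro grass_supercommute[OF Mat_overD _ Mat_overD]) auto
  have coeff: "star_coeff i j * (if entry_parity (conj_ix j) k \<and> entry_parity k (conj_ix i) then -1 else 1)
    = star_coeff i (conj_ix k) * star_coeff (conj_ix k) j" for i j k :: "'m + 'n dbl"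
    by (cases i; cases j; cases k) (simp_all add: entry_parity_def)
  have "star (M ** N) $ i $ j = (star N ** star M) $ i $ j" for i j
  proof -
    have "star (M ** N) $ i $ j = (\<Sum>k\<in>UNIV. star_coeff i j *\<^sub>R (M $ conj_ix j $ k * N $ k $ conj_ix i))"
      by (simp add: star_def matrix_matrix_mult_def scaleR_sum_right)
    also have "\<dots> = (\<Sum>k\<in>UNIV. (star_coeff i (conj_ix k) * star_coeff (conj_ix k) j) *\<^sub>R
        (N $ k $ conj_ix i * M $ conj_ix j $ k))"
      unfolding comm scaleR_scaleR coeff ..
    also have "\<dots> = (\<Sum>k\<in>UNIV. (star_coeff i k * star_coeff k j) *\<^sub>R
        (N $ conj_ix k $ conj_ix i * M $ conj_ix j $ conj_ix k))"
      by (rule sum.reindex_bij_witness[of _ conj_ix conj_ix]) simp_all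
    also have "\<dots> = (star N ** star M) $ i $ j"
      by (simp add: star_def matrix_matrix_mult_def mult.commute)
    finally show ?thesis .
  qed
  then show ?thesis by (simp add: vec_eq_iff)
qed

lemma SO_0_star:
  fixes M :: "('f::{finite,linorder}, 'm::{finite,linorder}, 'n::{finite,linorder}, 's) smat"
  assumes "M \<in> SO_0"
  shows "star M ** M = mat 1"
proof -
  \<comment> \<open>The matrix \<open>R\<close> is the inverse of \<open>Q_mat\<close>.\<close>
  define R where "R = ((\<chi> i j. case (i, j) of (Inl k, Inl l) \<Rightarrow> (if k = l then 1 else 0)
      | (Inr p, Inr q) \<Rightarrow> of_real (2 * gform p q) | _ \<Rightarrow> 0) :: ('f, 'm, 'n, 's) smat)"
  have left: "(R ** X) $ Inl i $ j = X $ Inl i $ j" "(R ** X) $ Inr p $ j = (2 * sg p) *\<^sub>R X $ Inr (flip p) $ j"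
    for X :: "('f, 'm, 'n, 's) smat" and i j p
  proof -
    show "(R ** X) $ Inl i $ j = X $ Inl i $ j"
      by (simp add: R_def matrix_matrix_mult_def sum_UNIV_sum if_distrib[of "\<lambda>x. x * _"] cong: if_cong)
    have "(R ** X) $ Inr p $ j = 2 *\<^sub>R (\<Sum>q\<in>UNIV. gform p q *\<^sub>R X $ Inr q $ j)"
      by (simp add: R_def matrix_matrix_mult_def sum_UNIV_sum scaleR_sum_right of_real_def)
    then show "(R ** X) $ Inr p $ j = (2 * sg p) *\<^sub>R X $ Inr (flip p) $ j"
      by (simp add: sum_gform_right)
  qed
  have right: "(X ** Q_mat) $ i $ Inl j = X $ i $ Inl j" "(X ** Q_mat) $ i $ Inr q = (sg q / 2) *\<^sub>R X $ i $ Inr (flip q)"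
    for X :: "('f, 'm, 'n, 's) smat" and i j q
  proof -
    show "(X ** Q_mat) $ i $ Inl j = X $ i $ Inl j"
      by (simp add: matrix_matrix_mult_def sum_UNIV_sum Q_mat_def if_distrib[of "\<lambda>x. _ * x"] cong: if_cong)
    have "(X ** Q_mat) $ i $ Inr q = (-1/2) *\<^sub>R (\<Sum>p\<in>UNIV. gform p q *\<^sub>R X $ i $ Inr p)"
      by (simp add: matrix_matrix_mult_def sum_UNIV_sum Q_mat_def scaleR_sum_right of_real_def)
    then show "(X ** Q_mat) $ i $ Inr q = (sg q / 2) *\<^sub>R X $ i $ Inr (flip q)"
      by (simp add: sum_gform_left)
  qed
  have star: "R ** (supertranspose M ** Q_mat) = star M"
    unfolding vec_eq_iff
  proof (intro allI)
    fix i j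
    show "(R ** (supertranspose M ** Q_mat)) $ i $ j = star M $ i $ j"
      by (cases i; cases j) (simp_all only: left right, simp_all add: supertranspose_def star_def)
  qed
  have one: "R ** Q_mat = mat 1"
    unfolding vec_eq_iff
  proof (intro allI)
    fix i j
    show "(R ** Q_mat) $ i $ j = (mat 1 :: ('f, 'm, 'n, 's) smat) $ i $ j"
      by (cases i; cases j)
        (simp_all only: left, auto simp: Q_mat_def mat_def gform_flip of_real_def)
  qed
  have "star M ** M = R ** (supertranspose M ** Q_mat ** M)"
    by (simp only: star[symmetric] matrix_mul_assoc)
  also have "supertranspose M ** Q_mat ** M = Q_mat" using assms by (simp add: SO_0_def)
  finally show ?thesis by (simp only: one)
qed

section \<open>Extended superbivectors as infinitesimal isometries\<close>

lemma ad_add: "ad (A + B) x = ad A x + ad B x"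
  and ad_sum: "ad (sum h I) x = (\<Sum>i\<in>I. ad (h i) x)"
  and ad_sum_right: "ad B (sum g J) = (\<Sum>j\<in>J. ad B (g j))"
  by (simp_all add: ad_def algebra_simps sum_distrib_left sum_distrib_right sum_subtractf)

lemma ad_scaleR: "ad (c *\<^sub>R A) x = c *\<^sub>R ad A x" for A :: "'a::real_algebra_1"
  by (simp add: ad_def scaleR_diff_right)

lemma sum_pairs:
  fixes h :: "'k::{finite,linorder} \<Rightarrow> 'k \<Rightarrow> 'a::ab_group_add"
  shows "(\<Sum>j\<in>UNIV. \<Sum>k\<in>UNIV. h j k) = (\<Sum>(j, k)\<in>{(j, k). j < k}. h j k + h k j) + (\<Sum>j\<in>UNIV. h j j)"
    and "(\<Sum>(j, k)\<in>{(j, k). j \<le> k}. h j k) = (\<Sum>(j, k)\<in>{(j, k). j < k}. h j k) + (\<Sum>j\<in>UNIV. h j j)"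
proof -
  let ?L = "{(j, k). j < (k::'k)}" and ?G = "{(j, k). k < (j::'k)}" and ?D = "range (\<lambda>j::'k. (j, j))"
  have D: "(\<Sum>(j, k)\<in>?D. h j k) = (\<Sum>j\<in>UNIV. h j j)"
    by (subst sum.reindex) (auto simp: inj_on_def)
  have G: "(\<Sum>(j, k)\<in>?G. h j k) = (\<Sum>(j, k)\<in>?L. h k j)"
    by (rule sum.reindex_bij_witness[of _ "\<lambda>(j, k). (k, j)" "\<lambda>(j, k). (k, j)"]) auto
  have "(\<Sum>j\<in>UNIV. \<Sum>k\<in>UNIV. h j k) = (\<Sum>(j, k)\<in>UNIV. h j k)"
    by (simp add: sum.cartesian_product)
  also have "(UNIV :: ('k \<times> 'k) set) = (?L \<union> ?G) \<union> ?D" by auto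
  also have "(\<Sum>(j, k)\<in>(?L \<union> ?G) \<union> ?D. h j k) = (\<Sum>(j, k)\<in>?L \<union> ?G. h j k) + (\<Sum>(j, k)\<in>?D. h j k)"
    by (rule sum.union_disjoint) auto
  also have "(\<Sum>(j, k)\<in>?L \<union> ?G. h j k) = (\<Sum>(j, k)\<in>?L. h j k) + (\<Sum>(j, k)\<in>?G. h j k)"
    by (rule sum.union_disjoint) auto
  also have "(\<Sum>(j, k)\<in>?L. h j k) + (\<Sum>(j, k)\<in>?G. h j k) = (\<Sum>(j, k)\<in>?L. h j k + h k j)"
    unfolding G by (simp add: sum.distrib[symmetric] case_prod_unfold)
  finally show "(\<Sum>j\<in>UNIV. \<Sum>k\<in>UNIV. h j k) = (\<Sum>(j, k)\<in>?L. h j k + h k j) + (\<Sum>j\<in>UNIV. h j j)"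
    unfolding D .
  have "{(j, k). j \<le> (k::'k)} = ?L \<union> ?D" by (auto simp: image_iff)
  then have "(\<Sum>(j, k)\<in>{(j, k). j \<le> k}. h j k) = (\<Sum>(j, k)\<in>?L \<union> ?D. h j k)" by (simp only:)
  also have "\<dots> = (\<Sum>(j, k)\<in>?L. h j k) + (\<Sum>(j, k)\<in>?D. h j k)"
    by (rule sum.union_disjoint) auto
  finally show "(\<Sum>(j, k)\<in>{(j, k). j \<le> k}. h j k) = (\<Sum>(j, k)\<in>?L. h j k) + (\<Sum>j\<in>UNIV. h j j)"
    unfolding D .
qed

text \<open>Superbivectors are defined by sums over ordered pairs of indices. For an antisymmetric, respectively
  symmetric, family of coefficients, the sum over all pairs is of this form: the terms of
  \<open>(j, k)\<close> and \<open>(k, j)\<close> coincide.\<close>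

lemma bivectorsI:
  fixes a :: "'m::{finite,linorder} \<Rightarrow> 'm \<Rightarrow> ('f::{finite,linorder}, 'm, 'n::{finite,linorder}, 's) superalg"
  assumes ev: "\<And>j k. a j k \<in> grass_ev" "\<And>p q. c p q \<in> grass_ev" and odd: "\<And>j q. b j q \<in> grass_odd"
    and anti: "\<And>j k. a k j = - a j k" and sym: "\<And>p q. c q p = c p q"
  shows "(\<Sum>j\<in>UNIV. \<Sum>k\<in>UNIV. a j k * (e_gen j * e_gen k))
    + (\<Sum>j\<in>UNIV. \<Sum>q\<in>UNIV. b j q * (e_gen j * e'_gen q))
    + (\<Sum>p\<in>UNIV. \<Sum>q\<in>UNIV. c p q * ((1/2) *\<^sub>R (e'_gen p * e'_gen q + e'_gen q * e'_gen p)))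
    \<in> bivectors"
proof -
  let ?o = "\<lambda>p q. (1/2) *\<^sub>R (e'_gen p * e'_gen q + e'_gen q * e'_gen p) :: ('f, 'm, 'n, 's) superalg"
  have diag: "a j j = 0" for j
  proof -
    have "2 *\<^sub>R a j j = 0" using anti[of j j] by (simp add: scaleR_2 eq_neg_iff_add_eq_0)
    then show ?thesis by simp
  qed
  have "a j k * (e_gen j * e_gen k) + a k j * (e_gen k * e_gen j) = (2 *\<^sub>R a j k) * e_gen j * e_gen k"
    if "j < k" for j k
    using that unfolding anti[of j k] using e_e[of k j, where ?'f='f and ?'n='n and ?'s='s] by (simp add: scaleR_2 mult.assoc distrib_right left_diff_distrib less_imp_neq[symmetric])
  then have A: "(\<Sum>j\<in>UNIV. \<Sum>k\<in>UNIV. a j k * (e_gen j * e_gen k))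
      = (\<Sum>(j, k)\<in>{(j, k). j < k}. (2 *\<^sub>R a j k) * e_gen j * e_gen k)"
    unfolding sum_pairs(1) by (auto simp: diag intro!: sum.cong)
  have "c p q * ?o p q + c q p * ?o q p = (if p = q then c p q else 2 *\<^sub>R c p q) * ?o p q" if "p < q" for p q
  proof -
    have "?o q p = ?o p q" by (simp only: add.commute)
    then have "c p q * ?o p q + c q p * ?o q p = (2 *\<^sub>R c p q) * ?o p q"
      by (simp only: sym[of p q] scaleR_2 distrib_right)
    then show ?thesis using that by (simp only: less_imp_neq if_False)
  qed
  then have C: "(\<Sum>p\<in>UNIV. \<Sum>q\<in>UNIV. c p q * ?o p q)
      = (\<Sum>(p, q)\<in>{(p, q). p \<le> q}. (if p = q then c p q else 2 *\<^sub>R c p q) * ?o p q)"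
    unfolding sum_pairs by (auto intro!: sum.cong arg_cong2[where f = "(+)"])
  have scale: "2 *\<^sub>R x \<in> grass_ev" if "x \<in> grass_ev" for x :: "('f, 'm, 'n, 's) superalg"
    using that unfolding grass_ev_eq by (rule grass_scale)
  show ?thesis
    unfolding A C bivectors_def mult.assoc[of "b _ _", symmetric]
    by (rule CollectI, rule exI[of _ "\<lambda>j k. 2 *\<^sub>R a j k"], rule exI[of _ b],
        rule exI[of _ "\<lambda>p q. if p = q then c p q else 2 *\<^sub>R c p q"])
      (intro conjI refl allI, simp_all add: ev odd scale)
qed

lemma ad_e_e:
  "ad (e_gen j * e_gen k) (e_gen l) = (if k = l then - 2 else 0) *\<^sub>R e_gen j +
    ((if j = l then 2 else 0) *\<^sub>R e_gen k :: ('f, 'm::{finite,linorder}, 'n, 's) superalg)"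
proof -
  let ?e = "e_gen :: 'm \<Rightarrow> ('f, 'm, 'n, 's) superalg"
  have "ad (?e j * ?e k) (?e l) = ?e j * (?e k * ?e l) - (?e l * ?e j) * ?e k"
    by (simp add: ad_def mult.assoc)
  also have "\<dots> = (if k = l then - 2 else 0) *\<^sub>R ?e j + (if j = l then 2 else 0) *\<^sub>R ?e k"
    unfolding e_e[of k l] e_e[of l j] by (auto simp: algebra_simps)
  finally show ?thesis .
qed

lemma ad_e_e_e':
  "ad (e_gen j * e_gen k) (e'_gen q) = (0 :: ('f, 'm::{finite,linorder}, 'n, 's) superalg)"
proof -
  let ?e = "e_gen :: 'm \<Rightarrow> ('f, 'm, 'n, 's) superalg" and ?e' = "e'_gen q :: ('f, 'm, 'n, 's) superalg"
  have "?e' * (?e j * ?e k) = - (?e j * (?e' * ?e k))"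
    by (simp add: mult.assoc[symmetric] e_e'[of q j])
  also have "\<dots> = (?e j * ?e k) * ?e'"
    by (simp add: mult.assoc e_e'[of q k])
  finally have "?e' * (?e j * ?e k) = (?e j * ?e k) * ?e'" .
  then show ?thesis by (simp add: ad_def)
qed

lemma ad_e_e'_e:
  "ad (e_gen k * e'_gen q) (e_gen l) =
    ((if k = l then 2 else 0) *\<^sub>R e'_gen q :: ('f, 'm::{finite,linorder}, 'n, 's) superalg)"
proof -
  let ?e = "e_gen :: 'm \<Rightarrow> ('f, 'm, 'n, 's) superalg" and ?e' = "e'_gen q :: ('f, 'm, 'n, 's) superalg"
  have "ad (?e k * ?e') (?e l) = ?e k * (?e' * ?e l) - (?e l * ?e k) * ?e'"
    by (simp add: ad_def mult.assoc)
  also have "\<dots> = - (?e k * ?e l) * ?e' - (?e l * ?e k) * ?e'"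
    unfolding e_e'[of q l] by (simp add: mult.assoc)
  also have "\<dots> = (if k = l then 2 else 0) *\<^sub>R ?e'"
    unfolding e_e[of k l] by (auto simp: algebra_simps)
  finally show ?thesis .
qed

lemma anti_e_e'_e':
  "e_gen k * e'_gen q * e'_gen r + e'_gen r * (e_gen k * e'_gen q) =
    (gform q r *\<^sub>R e_gen k :: ('f, 'm::{finite,linorder}, 'n, 's) superalg)"
proof -
  let ?e = "e_gen k :: ('f, 'm, 'n, 's) superalg" and ?e' = "e'_gen :: _ \<Rightarrow> ('f, 'm, 'n, 's) superalg"
  have "?e * ?e' q * ?e' r + ?e' r * (?e * ?e' q) = ?e * (?e' q * ?e' r) + (?e' r * ?e) * ?e' q"
    by (simp add: mult.assoc)
  also have "\<dots> = gform q r *\<^sub>R ?e"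
    unfolding e_e'[of r k] e'_e'[of q r] by (simp add: algebra_simps)
  finally show ?thesis .
qed

lemma ad_e'_e':
  "ad ((1/2) *\<^sub>R (e'_gen p * e'_gen q + e'_gen q * e'_gen p)) (e'_gen r) =
    (gform q r *\<^sub>R e'_gen p + gform p r *\<^sub>R e'_gen q :: ('f, 'm::{finite,linorder}, 'n, 's) superalg)"
proof -
  let ?e' = "e'_gen :: _ \<Rightarrow> ('f, 'm, 'n, 's) superalg"
  have *: "ad (?e' p * ?e' q) (?e' r) = gform q r *\<^sub>R ?e' p + gform p r *\<^sub>R ?e' q" for p q
  proof -
    have "ad (?e' p * ?e' q) (?e' r) = ?e' p * (?e' q * ?e' r) - (?e' r * ?e' p) * ?e' q"
      by (simp add: ad_def mult.assoc)
    also have "?e' p * (?e' q * ?e' r) = (?e' p * ?e' r) * ?e' q + gform q r *\<^sub>R ?e' p"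
      unfolding e'_e'[of q r] by (simp add: algebra_simps)
    also have "(?e' p * ?e' r) * ?e' q = (?e' r * ?e' p) * ?e' q + gform p r *\<^sub>R ?e' q"
      unfolding e'_e'[of p r] by (simp add: algebra_simps)
    finally show ?thesis by (simp add: algebra_simps)
  qed
  show ?thesis
    unfolding ad_scaleR ad_add * by (simp add: scaleR_add_right[symmetric] scaleR_2[symmetric] add_ac)
qed

lemma ad_e'_e'_e:
  "ad ((1/2) *\<^sub>R (e'_gen p * e'_gen q + e'_gen q * e'_gen p)) (e_gen k) =
    (0 :: ('f, 'm::{finite,linorder}, 'n, 's) superalg)"
proof -
  let ?e = "e_gen k :: ('f, 'm, 'n, 's) superalg" and ?e' = "e'_gen :: _ \<Rightarrow> ('f, 'm, 'n, 's) superalg"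
  have "ad (?e' p * ?e' q) ?e = 0" for p q
  proof -
    have "?e' p * ?e' q * ?e = - (?e' p * ?e) * ?e' q"
      by (simp add: mult.assoc e_e'[of q k])
    also have "\<dots> = ?e * (?e' p * ?e' q)"
      by (simp add: mult.assoc e_e'[of p k])
    finally show ?thesis by (simp add: ad_def)
  qed
  then show ?thesis by (simp add: ad_scaleR ad_add)
qed

text \<open>The coefficients solve \<open>[B, y e\<^sub>i] = \<Sum>\<^sub>j N\<^sub>j\<^sub>i y e\<^sub>j\<close> for the unknown superbivector \<open>B\<close>. The
  coefficients of \<open>e\<^sub>k e'\<^sub>q\<close> are taken from the lower left block of \<open>N\<close>; the relation \<open>star N = - N\<close>
  expresses the upper right block by it.\<close>

definition bivector_of ::
  "('f, 'm::{finite,linorder}, 'n::finite, 's) smat \<Rightarrow> ('f, 'm, 'n, 's) superalg" where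
  "bivector_of N =
    (\<Sum>j\<in>UNIV. \<Sum>k\<in>UNIV. ((-1/4) *\<^sub>R N $ Inl j $ Inl k) * (e_gen j * e_gen k))
    + (\<Sum>k\<in>UNIV. \<Sum>q\<in>UNIV. ((1/2) *\<^sub>R N $ Inr q $ Inl k) * (e_gen k * e'_gen q))
    + (\<Sum>p\<in>UNIV. \<Sum>q\<in>UNIV. ((sg q / 2) *\<^sub>R N $ Inr p $ Inr (flip q)) *
        ((1/2) *\<^sub>R (e'_gen p * e'_gen q + e'_gen q * e'_gen p)))"

lemma star_skew:
  assumes "star N = - N"
  shows "N $ Inl k $ Inl j = - N $ Inl j $ Inl k"
    and "N $ Inl k $ Inr r = (- sg r / 2) *\<^sub>R N $ Inr (flip r) $ Inl k"
    and "sg p *\<^sub>R N $ Inr q $ Inr (flip p) = sg q *\<^sub>R N $ Inr p $ Inr (flip q)"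
proof -
  have *: "N $ i $ j = - (star_coeff i j *\<^sub>R N $ conj_ix j $ conj_ix i)" for i j
    using arg_cong[OF assms, of "\<lambda>X. X $ i $ j"] by (simp add: star_def)
  show "N $ Inl k $ Inl j = - N $ Inl j $ Inl k" using *[of "Inl k" "Inl j"] by simp
  show "N $ Inl k $ Inr r = (- sg r / 2) *\<^sub>R N $ Inr (flip r) $ Inl k"
    using *[of "Inl k" "Inr r"] by simp
  show "sg p *\<^sub>R N $ Inr q $ Inr (flip p) = sg q *\<^sub>R N $ Inr p $ Inr (flip q)"
    unfolding *[of "Inr q" "Inr (flip p)"] by (simp add: mult.commute)
qed

lemma bivector_of_bivectors:
  fixes N :: "('f::{finite,linorder}, 'm::{finite,linorder}, 'n::{finite,linorder}, 's) smat"
  assumes N: "N \<in> Mat" "star N = - N"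
  shows "bivector_of N \<in> bivectors"
  unfolding bivector_of_def
proof (rule bivectorsI)
  note E = Mat_overD[OF N(1)[unfolded Mat_eq]]
  show "(-1/4) *\<^sub>R N $ Inl j $ Inl k \<in> grass_ev" for j k
    using grass_scale[OF E[of "Inl j" "Inl k"], of "-1/4"] by (simp add: grass_ev_eq entry_parity_def)
  show "(sg q / 2) *\<^sub>R N $ Inr p $ Inr (flip q) \<in> grass_ev" for p q
    using E[of "Inr p" "Inr (flip q)"] by (simp add: grass_ev_eq entry_parity_def grass_scale)
  show "(1/2) *\<^sub>R N $ Inr q $ Inl k \<in> grass_odd" for q k
    using E[of "Inr q" "Inl k"] by (simp add: grass_odd_eq entry_parity_def grass_scale)
  show "(-1/4) *\<^sub>R N $ Inl k $ Inl j = - ((-1/4) *\<^sub>R N $ Inl j $ Inl k)" for j k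
    by (simp add: star_skew(1)[OF N(2), of k j])
  show "(sg p / 2) *\<^sub>R N $ Inr q $ Inr (flip p) = (sg q / 2) *\<^sub>R N $ Inr p $ Inr (flip q)" for p q
    using arg_cong[OF star_skew(3)[OF N(2), of p q], of "\<lambda>x. (1/2) *\<^sub>R x"] by simp
qed

text \<open>What the \<open>i\<close>-th coordinate of a supervector has in common with the \<open>i\<close>-th coordinate of its
  image under a supermatrix in \<open>Mat\<close>.\<close>

definition coordinate_like :: "'m + 'n dbl \<Rightarrow> ('f, 'm::{finite,linorder}, 'n, 's) superalg \<Rightarrow> bool" where
  "coordinate_like i y \<longleftrightarrow> f_sign_comm (if isl i then 1 else -1) y \<and>
     (\<forall>j. e_gen j * y = y * e_gen j) \<and> (\<forall>q. e'_gen q * y = y * e'_gen q)"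

lemma ad_scalar:
  fixes a :: "'a::real_algebra_1"
  assumes "X * y = y * X" "u * a = a * u" "y * a = \<sigma> *\<^sub>R (a * y)"
  shows "ad (a * X) (y * u) = a * y * (X * u - \<sigma> *\<^sub>R (u * X))"
proof -
  have "a * X * (y * u) = a * (X * y) * u" by (simp only: mult.assoc)
  moreover have "y * u * (a * X) = y * (u * a) * X" by (simp only: mult.assoc)
  moreover have "y * (a * u) * X = (y * a) * u * X" by (simp only: mult.assoc)
  ultimately show ?thesis
    unfolding ad_def assms by (simp add: right_diff_distrib mult.assoc)
qed

text \<open>The commutator reduces to commutators of the \<open>e\<^sub>j\<close> and \<open>e'\<^sub>p\<close>, with one exception: an odd
  coefficient anticommutes with an odd coordinate \<open>y\<close>, so for the mixed terms \<open>b e\<^sub>k e'\<^sub>q\<close> and odd \<open>y\<close> the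
  anticommutator \<open>e\<^sub>k e'\<^sub>q e'\<^sub>r + e'\<^sub>r e\<^sub>k e'\<^sub>q\<close> appears, which is again a multiple of \<open>e\<^sub>k\<close>.\<close>

lemma ad_bivector_of:
  fixes N :: "('f::{finite,linorder}, 'm::{finite,linorder}, 'n::{finite,linorder}, 's) smat"
  assumes N: "N \<in> Mat" "star N = - N" and y: "coordinate_like i y"
  shows "ad (bivector_of N) (y * unit_vec i) = (\<Sum>j\<in>UNIV. N $ j $ i * y * unit_vec j)"
proof -
  note E = Mat_overD[OF N(1)[unfolded Mat_eq], simplified]
  have ey: "e_gen j * y = y * e_gen j" "e'_gen q * y = y * e'_gen q" for j q
    using y by (simp_all add: coordinate_like_def)
  have Xy: "(e_gen j * e_gen k) * y = y * (e_gen j * e_gen k)"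
    "(e_gen j * e'_gen q) * y = y * (e_gen j * e'_gen q)"
    "((1/2) *\<^sub>R (e'_gen p * e'_gen q + e'_gen q * e'_gen p)) * y =
       y * ((1/2) *\<^sub>R (e'_gen p * e'_gen q + e'_gen q * e'_gen p))" for j k p q
  proof -
    have *: "(A * B) * y = y * (A * B)" if "A * y = y * A" "B * y = y * B" for A B
      using that by (metis mult.assoc)
    show "(e_gen j * e_gen k) * y = y * (e_gen j * e_gen k)"
      "(e_gen j * e'_gen q) * y = y * (e_gen j * e'_gen q)"
      by (intro * ey)+
    show "((1/2) *\<^sub>R (e'_gen p * e'_gen q + e'_gen q * e'_gen p)) * y =
       y * ((1/2) *\<^sub>R (e'_gen p * e'_gen q + e'_gen q * e'_gen p))"
      using *[OF ey(2) ey(2)] by (simp add: distrib_left distrib_right)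
  qed
  have u: "unit_vec i * (c *\<^sub>R N $ j $ k) = (c *\<^sub>R N $ j $ k) * unit_vec i" for c j k
  proof -
    have "f_sign_comm 1 (unit_vec i :: ('f, 'm, 'n, 's) superalg)"
      by (cases i) (simp_all add: f_sign_comm_gens)
    from f_sign_comm_grass[OF this E[of j k] subset_refl] show ?thesis by simp
  qed
  have ysign: "f_sign_comm (if isl i then 1 else -1) y" using y by (simp add: coordinate_like_def)
  have ya: "y * (c *\<^sub>R N $ j $ k) = (if isl i \<or> isl j = isl k then 1 else -1) *\<^sub>R ((c *\<^sub>R N $ j $ k) * y)" for c j k
    using f_sign_comm_grass[OF ysign E[of j k] subset_refl] by (auto simp: entry_parity_def)
  have ee: "ad (((-1/4) *\<^sub>R N $ Inl j $ Inl k) * (e_gen j * e_gen k)) (y * unit_vec i)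
    = ((-1/4) *\<^sub>R N $ Inl j $ Inl k) * y * ad (e_gen j * e_gen k) (unit_vec i)" for j k
    by (subst ad_scalar[OF Xy(1) u ya]) (simp add: ad_def)
  have ee': "ad (((1/2) *\<^sub>R N $ Inr q $ Inl k) * (e_gen k * e'_gen q)) (y * unit_vec i)
    = ((1/2) *\<^sub>R N $ Inr q $ Inl k) * y *
      (e_gen k * e'_gen q * unit_vec i - (if isl i then 1 else -1) *\<^sub>R (unit_vec i * (e_gen k * e'_gen q)))" for k q
    by (subst ad_scalar[OF Xy(2) u ya]) simp
  have e'e': "ad (((sg q / 2) *\<^sub>R N $ Inr p $ Inr (flip q)) * ((1/2) *\<^sub>R (e'_gen p * e'_gen q + e'_gen q * e'_gen p))) (y * unit_vec i)
    = ((sg q / 2) *\<^sub>R N $ Inr p $ Inr (flip q)) * y * ad ((1/2) *\<^sub>R (e'_gen p * e'_gen q + e'_gen q * e'_gen p)) (unit_vec i)" for p q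
    by (subst ad_scalar[OF Xy(3) u ya]) (simp add: ad_def)
  have expand: "ad (bivector_of N) (y * unit_vec i) =
    (\<Sum>j\<in>UNIV. \<Sum>k\<in>UNIV. ((-1/4) *\<^sub>R N $ Inl j $ Inl k) * y * ad (e_gen j * e_gen k) (unit_vec i))
    + (\<Sum>k\<in>UNIV. \<Sum>q\<in>UNIV. ((1/2) *\<^sub>R N $ Inr q $ Inl k) * y *
      (e_gen k * e'_gen q * unit_vec i - (if isl i then 1 else -1) *\<^sub>R (unit_vec i * (e_gen k * e'_gen q))))
    + (\<Sum>p\<in>UNIV. \<Sum>q\<in>UNIV. ((sg q / 2) *\<^sub>R N $ Inr p $ Inr (flip q)) * y *
       ad ((1/2) *\<^sub>R (e'_gen p * e'_gen q + e'_gen q * e'_gen p)) (unit_vec i))"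
    unfolding bivector_of_def ad_add ad_sum ee ee' e'e' ..
  show ?thesis
  proof (cases i)
    case (Inl l)
    have "(\<Sum>j\<in>UNIV. \<Sum>k\<in>UNIV. ((-1/4) *\<^sub>R N $ Inl j $ Inl k) * y * ad (e_gen j * e_gen k) (unit_vec i))
      = (\<Sum>j\<in>UNIV. \<Sum>k\<in>UNIV. (if k = l then (1/2) *\<^sub>R (N $ Inl j $ Inl l * y * e_gen j) else 0))
       + (\<Sum>j\<in>UNIV. \<Sum>k\<in>UNIV. (if j = l then (-1/2) *\<^sub>R (N $ Inl l $ Inl k * y * e_gen k) else 0))"
      unfolding sum.distrib[symmetric] using Inl
      by (intro sum.cong refl) (auto simp: ad_e_e algebra_simps)
    also have "(\<Sum>j\<in>UNIV. \<Sum>k\<in>UNIV. (if j = l then (-1/2) *\<^sub>R (N $ Inl l $ Inl k * y * e_gen k) else 0))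
      = (\<Sum>k\<in>UNIV. \<Sum>j\<in>UNIV. (if j = l then (1/2) *\<^sub>R (N $ Inl k $ Inl l * y * e_gen k) else 0))"
      by (subst sum.swap) (intro sum.cong refl, simp add: star_skew(1)[OF N(2), of l])
    finally have 1: "(\<Sum>j\<in>UNIV. \<Sum>k\<in>UNIV. ((-1/4) *\<^sub>R N $ Inl j $ Inl k) * y * ad (e_gen j * e_gen k) (unit_vec i))
      = (\<Sum>j\<in>UNIV. N $ Inl j $ Inl l * y * e_gen j)"
      by (simp add: sum.distrib[symmetric] scaleR_add_left[symmetric])
    have "e_gen k * e'_gen q * e_gen l - e_gen l * (e_gen k * e'_gen q)
      = ((if k = l then 2 else 0) *\<^sub>R e'_gen q :: ('f, 'm, 'n, 's) superalg)" for k q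
      using ad_e_e'_e[of k q l] by (simp add: ad_def)
    then have "(\<Sum>k\<in>UNIV. \<Sum>q\<in>UNIV. ((1/2) *\<^sub>R N $ Inr q $ Inl k) * y *
      (e_gen k * e'_gen q * unit_vec i - (if isl i then 1 else -1) *\<^sub>R (unit_vec i * (e_gen k * e'_gen q))))
      = (\<Sum>k\<in>UNIV. \<Sum>q\<in>UNIV. if k = l then N $ Inr q $ Inl l * y * e'_gen q else 0)"
      using Inl by (intro sum.cong refl) auto
    also have "\<dots> = (\<Sum>q\<in>UNIV. N $ Inr q $ Inl l * y * e'_gen q)"
      by (subst sum.swap) simp
    finally show ?thesis
      unfolding expand 1 using Inl by (simp add: ad_e'_e'_e sum_UNIV_sum)
  next
    case (Inr r)
    have "(\<Sum>k\<in>UNIV. \<Sum>q\<in>UNIV. ((1/2) *\<^sub>R N $ Inr q $ Inl k) * y *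
      (e_gen k * e'_gen q * unit_vec i - (if isl i then 1 else -1) *\<^sub>R (unit_vec i * (e_gen k * e'_gen q))))
      = (\<Sum>k\<in>UNIV. \<Sum>q\<in>UNIV. gform q r *\<^sub>R ((1/2) *\<^sub>R (N $ Inr q $ Inl k * y * e_gen k)))"
      using Inr by (intro sum.cong refl) (simp add: anti_e_e'_e')
    also have "\<dots> = (\<Sum>k\<in>UNIV. N $ Inl k $ Inr r * y * e_gen k)"
      unfolding sum_gform_left star_skew(2)[OF N(2)] by simp
    finally have 2: "(\<Sum>k\<in>UNIV. \<Sum>q\<in>UNIV. ((1/2) *\<^sub>R N $ Inr q $ Inl k) * y *
      (e_gen k * e'_gen q * unit_vec i - (if isl i then 1 else -1) *\<^sub>R (unit_vec i * (e_gen k * e'_gen q))))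
      = (\<Sum>k\<in>UNIV. N $ Inl k $ Inr r * y * e_gen k)" .
    let ?c = "\<lambda>p q. (sg q / 2) *\<^sub>R N $ Inr p $ Inr (flip q)"
    have sym: "?c p q = ?c q p" for p q
      using arg_cong[OF star_skew(3)[OF N(2), of q p], of "\<lambda>x. (1/2) *\<^sub>R x"] by simp
    have half: "(\<Sum>p\<in>UNIV. \<Sum>q\<in>UNIV. gform q r *\<^sub>R (?c p q * y * e'_gen p))
        = (\<Sum>p\<in>UNIV. (1/2) *\<^sub>R (N $ Inr p $ Inr r * y * e'_gen p))"
      unfolding sum_gform_left by simp
    have "(\<Sum>p\<in>UNIV. \<Sum>q\<in>UNIV. ?c p q * y *
       ad ((1/2) *\<^sub>R (e'_gen p * e'_gen q + e'_gen q * e'_gen p)) (unit_vec i))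
      = (\<Sum>p\<in>UNIV. \<Sum>q\<in>UNIV. gform q r *\<^sub>R (?c p q * y * e'_gen p)) +
        (\<Sum>p\<in>UNIV. \<Sum>q\<in>UNIV. gform p r *\<^sub>R (?c p q * y * e'_gen q))"
      unfolding sum.distrib[symmetric] using Inr
      by (intro sum.cong refl) (simp add: ad_e'_e' distrib_left)
    also have "(\<Sum>p\<in>UNIV. \<Sum>q\<in>UNIV. gform p r *\<^sub>R (?c p q * y * e'_gen q))
      = (\<Sum>p\<in>UNIV. \<Sum>q\<in>UNIV. gform q r *\<^sub>R (?c p q * y * e'_gen p))"
      by (subst sum.swap) (intro sum.cong refl, subst sym, rule refl)
    finally have 3: "(\<Sum>p\<in>UNIV. \<Sum>q\<in>UNIV. ?c p q * y *
       ad ((1/2) *\<^sub>R (e'_gen p * e'_gen q + e'_gen q * e'_gen p)) (unit_vec i))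
      = (\<Sum>p\<in>UNIV. N $ Inr p $ Inr r * y * e'_gen p)"
      unfolding half by (simp add: sum.distrib[symmetric] scaleR_add_left[symmetric])
    show ?thesis
      unfolding expand 2 3 using Inr by (simp add: ad_e_e_e' sum_UNIV_sum)
  qed
qed

lemma f_sign_comm_sum: "(\<And>k. k \<in> K \<Longrightarrow> f_sign_comm \<sigma> (h k)) \<Longrightarrow> f_sign_comm \<sigma> (sum h K)"
  by (simp add: f_sign_comm_def sum_distrib_left sum_distrib_right scaleR_sum_right)

lemma coordinate_like_row:
  fixes U :: "('f::{finite,linorder}, 'm::{finite,linorder}, 'n::{finite,linorder}, 's) smat"
  assumes U: "U \<in> Mat"
  shows "coordinate_like i (\<Sum>k\<in>UNIV. U $ i $ k * coord v k)"
proof -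
  note E = Mat_overD[OF U[unfolded Mat_eq], simplified]
  have sign: "f_sign_comm (if isl i then 1 else -1) (U $ i $ k * coord v k)" for k
  proof -
    have "f_sign_comm (if isl k then 1 else -1) (coord v k :: ('f, 'm, 'n, 's) superalg)"
      by (cases k) (simp_all add: f_sign_comm_gens)
    from f_sign_comm_mult[OF f_sign_comm_of_grass[OF E[of i k] subset_refl] this]
    show ?thesis by (auto simp: entry_parity_def split: if_splits)
  qed
  have comm: "g * (\<Sum>k\<in>UNIV. U $ i $ k * coord v k) = (\<Sum>k\<in>UNIV. U $ i $ k * coord v k) * g"
    if "f_sign_comm 1 g" "\<And>k. g * coord v k = coord v k * g" for g
  proof -
    have "g * (U $ i $ k * coord v k) = U $ i $ k * coord v k * g" for k
      using f_sign_comm_grass[OF that(1) E[of i k] subset_refl] that(2)[of k]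
      by (simp add: mult.assoc[symmetric]) (simp add: mult.assoc)
    then show ?thesis by (simp add: sum_distrib_left sum_distrib_right)
  qed
  have "e_gen j * coord v k = (coord v k * e_gen j :: ('f, 'm, 'n, 's) superalg)"
    "e'_gen q * coord v k = (coord v k * e'_gen q :: ('f, 'm, 'n, 's) superalg)" for j q k
    by (cases k; simp add: x_central x'_e x'_e')+
  then show ?thesis
    unfolding coordinate_like_def
    by (intro conjI allI f_sign_comm_sum sign comm f_sign_comm_gens)
qed

theorem infinitesimal_bivector_of:
  fixes N :: "('f::{finite,linorder}, 'm::{finite,linorder}, 'n::{finite,linorder}, 's) smat"
  assumes N: "N \<in> Mat" "star N = - N"
  shows "infinitesimal (bivector_of N) N"
  unfolding infinitesimal_def
proof (intro conjI ballI allI N)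
  fix U :: "('f, 'm, 'n, 's) smat" and v assume U: "U \<in> Mat"
  let ?y = "\<lambda>i. \<Sum>k\<in>UNIV. U $ i $ k * coord v k"
  have row: "(\<Sum>k\<in>UNIV. (N ** U) $ j $ k * coord v k) = (\<Sum>i\<in>UNIV. N $ j $ i * ?y i)" for j
  proof -
    have "(\<Sum>k\<in>UNIV. (N ** U) $ j $ k * coord v k) = (\<Sum>k\<in>UNIV. \<Sum>i\<in>UNIV. N $ j $ i * (U $ i $ k * coord v k))"
      by (simp add: matrix_matrix_mult_def sum_distrib_right mult.assoc)
    also have "\<dots> = (\<Sum>i\<in>UNIV. N $ j $ i * ?y i)"
      by (subst sum.swap) (simp add: sum_distrib_left)
    finally show ?thesis .
  qed
  have "ad (bivector_of N) (mat_action U v) = (\<Sum>i\<in>UNIV. \<Sum>j\<in>UNIV. N $ j $ i * ?y i * unit_vec j)"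
    unfolding mat_action_def ad_sum_right ad_bivector_of[OF N coordinate_like_row[OF U]] ..
  also have "\<dots> = (\<Sum>j\<in>UNIV. (\<Sum>i\<in>UNIV. N $ j $ i * ?y i) * unit_vec j)"
    by (subst sum.swap) (simp only: sum_distrib_right)
  also have "\<dots> = mat_action (N ** U) v"
    unfolding mat_action_def row ..
  finally show "ad (bivector_of N) (mat_action U v) = mat_action (N ** U) v" .
qed

lemma zero_bivectors:
  "(0 :: ('f::{finite,linorder}, 'm::{finite,linorder}, 'n::{finite,linorder}, 's) superalg) \<in> bivectors"
proof -
  have "bivector_of (0 :: ('f, 'm, 'n, 's) smat) \<in> bivectors"
    by (rule bivector_of_bivectors) (simp_all add: Mat_eq Mat_over_0, simp add: star_def vec_eq_iff)
  then show ?thesis by (simp add: bivector_of_def)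
qed

section \<open>Plane rotations generate the special orthogonal group\<close>

definition rot :: "'m \<Rightarrow> 'm \<Rightarrow> real \<Rightarrow> real ^ 'm ^ ('m::finite)" where
  "rot j k t = (\<chi> a b. if a = j \<and> b = j \<or> a = k \<and> b = k then cos t
     else if a = j \<and> b = k then - sin t else if a = k \<and> b = j then sin t
     else if a = b then 1 else 0)"

lemma rot_mult:
  fixes A :: "real ^ 'b ^ 'm::finite"
  assumes "j \<noteq> k"
  shows "(rot j k t ** A) $ a $ b = (if a = j then cos t * A $ j $ b - sin t * A $ k $ b
    else if a = k then sin t * A $ j $ b + cos t * A $ k $ b else A $ a $ b)"
proof -
  have "(rot j k t ** A) $ a $ b = (\<Sum>l\<in>UNIV. rot j k t $ a $ l * A $ l $ b)"
    by (simp add: matrix_matrix_mult_def)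
  also have "\<dots> = (\<Sum>l\<in>UNIV. (if l = j then rot j k t $ a $ j * A $ j $ b else 0)
      + (if l = k then rot j k t $ a $ k * A $ k $ b else 0)
      + (if l = a then (if a = j \<or> a = k then 0 else A $ a $ b) else 0))"
  proof (intro sum.cong refl)
    fix l
    have 1: "rot j k t $ a $ l = (if l = a then 1 else 0)" if "l \<noteq> j" "l \<noteq> k"
      using that by (simp add: rot_def)
    show "rot j k t $ a $ l * A $ l $ b = (if l = j then rot j k t $ a $ j * A $ j $ b else 0)
      + (if l = k then rot j k t $ a $ k * A $ k $ b else 0)
      + (if l = a then (if a = j \<or> a = k then 0 else A $ a $ b) else 0)"
    proof (cases "l = j \<or> l = k")
      case True
      then show ?thesis using assms by (cases "l = j"; cases "l = a") simp_all
    next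
      case False
      then show ?thesis using 1 by (cases "l = a") simp_all
    qed
  qed
  also have "\<dots> = rot j k t $ a $ j * A $ j $ b + rot j k t $ a $ k * A $ k $ b
      + (if a = j \<or> a = k then 0 else A $ a $ b)"
    by (simp add: sum.distrib)
  also have "\<dots> = (if a = j then cos t * A $ j $ b - sin t * A $ k $ b
    else if a = k then sin t * A $ j $ b + cos t * A $ k $ b else A $ a $ b)"
    using assms by (cases "a = j"; cases "a = k") (simp_all add: rot_def)
  finally show ?thesis .
qed

lemma rot_rot: "j \<noteq> k \<Longrightarrow> rot j k s ** rot j k t = rot j k (s + t)"
proof -
  assume jk: "j \<noteq> k"
  have "(rot j k s ** rot j k t) $ a $ b = rot j k (s + t) $ a $ b" for a b
    unfolding rot_mult[OF jk] using jk
    by (cases "a = j"; cases "a = k"; cases "b = j"; cases "b = k")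
      (simp_all add: rot_def cos_add sin_add)
  then show ?thesis by (simp add: vec_eq_iff)
qed

lemma rot_0:
  assumes "j \<noteq> k" shows "rot j k 0 = mat 1"
proof -
  have "rot j k 0 $ a $ b = mat 1 $ a $ b" for a b
    using assms unfolding rot_def mat_def vec_lambda_beta cos_zero sin_zero by simp
  then show ?thesis by (simp add: vec_eq_iff)
qed

lemma orthogonal_rot: "j \<noteq> k \<Longrightarrow> orthogonal_matrix (rot j k t)"
proof -
  assume jk: "j \<noteq> k"
  have "transpose (rot j k t) $ a $ b = rot j k (- t) $ a $ b" for a b
    using jk by (cases "a = j"; cases "a = k"; cases "b = j"; cases "b = k"; cases "a = b")
      (simp_all add: rot_def transpose_def)
  then have "transpose (rot j k t) = rot j k (- t)" by (simp add: vec_eq_iff)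
  then show ?thesis using rot_rot[OF jk, of "- t" t] by (simp add: orthogonal_matrix rot_0[OF jk])
qed

text \<open>A rotation is the square of the rotation by half the angle, whose determinant is \<open>\<plusminus>1\<close>.\<close>

lemma det_rot:
  assumes "j \<noteq> k"
  shows "det (rot j k t) = 1"
proof -
  have "det (rot j k t) = det (rot j k (t/2)) * det (rot j k (t/2))"
    using rot_rot[OF assms, of "t/2" "t/2"] by (simp flip: det_mul)
  then show ?thesis
    using det_orthogonal_matrix[OF orthogonal_rot[OF assms, of "t/2"]] by auto
qed

inductive_set rotations :: "(real ^ 'm ^ 'm::finite) set" where
  one: "mat 1 \<in> rotations"
| step: "j \<noteq> k \<Longrightarrow> X \<in> rotations \<Longrightarrow> rot j k t ** X \<in> rotations"

lemma rotations_cancel: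
  assumes "j \<noteq> k" "rot j k t ** X \<in> rotations"
  shows "X \<in> rotations"
  using rotations.step[OF assms, of "- t"] rot_rot[OF assms(1), of "- t" t]
  by (simp add: matrix_mul_assoc rot_0[OF assms(1)])

lemma orthogonal_columns:
  fixes A :: "real ^ 'm ^ 'm"
  assumes "orthogonal_matrix A"
  shows "(\<Sum>k\<in>UNIV. A $ k $ a * A $ k $ b) = (if a = b then 1 else 0)"
proof -
  have "(transpose A ** A) $ a $ b = mat 1 $ a $ b" using assms by (simp add: orthogonal_matrix)
  then show ?thesis by (simp add: matrix_matrix_mult_def transpose_def mat_def)
qed

lemma orthogonal_mult_rot:
  assumes "j \<noteq> k" "orthogonal_matrix A" "det A = 1"
  shows "orthogonal_matrix (rot j k t ** A)" "det (rot j k t ** A) = 1"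
  using assms by (simp_all add: orthogonal_matrix_mul orthogonal_rot det_mul det_rot)

text \<open>Givens elimination. The outer induction is over the set \<open>S\<close> of columns that may differ from those of the
  identity. For a chosen \<open>i\<close> in \<open>S\<close>, rotations in the planes \<open>(i, k)\<close> clear the entries of column
  \<open>i\<close> outside the diagonal one by one, which leaves \<open>\<plusminus>1\<close> on the diagonal. A sign \<open>-1\<close> is removed by a rotation
  by \<open>\<pi>\<close> as long as a second index is left in \<open>S\<close>; for the last index it would contradict
  \<open>det A = 1\<close>.\<close>

theorem special_orthogonal_rotations:
  fixes A :: "real ^ 'm ^ 'm"
  assumes "orthogonal_matrix A" "det A = 1"
  shows "A \<in> rotations"
proof -
  have main: "A \<in> rotations"
    if "finite S" "orthogonal_matrix A" "det A = 1" "\<And>k l. l \<notin> S \<Longrightarrow> A $ k $ l = (if k = l then 1 else 0)"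
    for S and A :: "real ^ 'm ^ 'm"
    using that
  proof (induction S arbitrary: A rule: finite_psubset_induct)
    case (psubset S)
    show ?case
    proof (cases "S = {}")
      case True
      then have "A = mat 1" using psubset.prems(3) by (simp add: vec_eq_iff mat_def)
      then show ?thesis by (simp add: rotations.one)
    next
      case False
      then obtain i where i: "i \<in> S" by blast
      have less: "S - {i} \<subset> S" using i by blast
      have done_if: "B \<in> rotations" if B: "orthogonal_matrix B" "det B = 1"
          "\<And>k l. l \<notin> S \<Longrightarrow> B $ k $ l = (if k = l then 1 else 0)" "\<And>k. k \<noteq> i \<Longrightarrow> B $ k $ i = 0" "B $ i $ i = 1"
        for B :: "real ^ 'm ^ 'm"
        using psubset.IH[OF less B(1,2)] B(3-5) by (metis DiffI singletonD)
      have "A \<in> rotations" if "finite T" "orthogonal_matrix A" "det A = 1"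
          "\<And>k l. l \<notin> S \<Longrightarrow> A $ k $ l = (if k = l then 1 else 0)"
          "{k \<in> S - {i}. A $ k $ i \<noteq> 0} = T" for T and A :: "real ^ 'm ^ 'm"
        using that
      proof (induction T arbitrary: A rule: finite_psubset_induct)
        case (psubset T)
        note A = psubset.prems
        show ?case
        proof (cases "T = {}")
          case True
          have off: "A $ k $ i = 0" if "k \<noteq> i" for k
          proof (cases "k \<in> S")
            case True
            then show ?thesis using A(4) \<open>T = {}\<close> that by blast
          next
            case False
            have "(\<Sum>l\<in>UNIV. A $ l $ k * A $ l $ i) = (\<Sum>l\<in>UNIV. if l = k then A $ k $ i else 0)"
              using A(3)[OF False] by (intro sum.cong) auto
            then show ?thesis using orthogonal_columns[OF A(1), of k i] that by simp
          qed
          have "(\<Sum>l\<in>UNIV. A $ l $ i * A $ l $ i) = (\<Sum>l\<in>UNIV. if l = i then A $ i $ i * A $ i $ i else 0)"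
            using off by (intro sum.cong) auto
          then have "A $ i $ i * A $ i $ i = 1" using orthogonal_columns[OF A(1), of i i] by simp
          then consider "A $ i $ i = 1" | "A $ i $ i = - 1" using square_eq_1_iff by blast
          then show ?thesis
          proof cases
            case 1
            then show ?thesis using done_if[OF A(1-3)] off by blast
          next
            case 2
            show ?thesis
            proof (cases "S = {i}")
              case True
              have "A $ k $ l = 0" if "k \<noteq> l" for k l
                using that off A(3)[of l k] True by (cases "l = i") auto
              then have "det A = (\<Prod>k\<in>UNIV. A $ k $ k)" by (rule det_diagonal)
              also have "\<dots> = (\<Prod>k\<in>UNIV. if k = i then - 1 else 1)"
                using 2 A(3) True by (intro prod.cong) auto
              finally show ?thesis using A(2) by simp
            next
              case False
              then obtain k where k: "k \<in> S" "k \<noteq> i" using i by blast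
              have "rot i k pi ** A \<in> rotations"
              proof (rule done_if)
                show "orthogonal_matrix (rot i k pi ** A)" "det (rot i k pi ** A) = 1"
                  using orthogonal_mult_rot[OF k(2)[symmetric] A(1,2)] .
                show "(rot i k pi ** A) $ l $ l' = (if l = l' then 1 else 0)" if "l' \<notin> S" for l l'
                  using that k i A(3)[OF that] by (auto simp: rot_mult)
                show "(rot i k pi ** A) $ l $ i = 0" if "l \<noteq> i" for l
                  using that k off by (auto simp: rot_mult)
                show "(rot i k pi ** A) $ i $ i = 1" using k 2 by (simp add: rot_mult)
              qed
              then show ?thesis using rotations_cancel k by metis
            qed
          qed
        next
          case False
          then obtain k where kT: "k \<in> T" by blast
          then have k: "k \<in> S" "k \<noteq> i" "A $ k $ i \<noteq> 0" using A(4) by auto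
          let ?x = "A $ i $ i" and ?y = "A $ k $ i"
          let ?r = "sqrt (?x\<^sup>2 + ?y\<^sup>2)"
          have r: "?r > 0" using k(3) by (simp add: sum_power2_gt_zero_iff)
          have "(?x / ?r)\<^sup>2 + (- ?y / ?r)\<^sup>2 = 1"
            using r k(3) by (simp add: power_divide add_divide_distrib[symmetric])
          then obtain t where t: "?x / ?r = cos t" "- ?y / ?r = sin t"
            using sincos_total_2pi by metis
          have zero: "sin t * ?x + cos t * ?y = 0"
            unfolding t[symmetric] by simp
          let ?B = "rot i k t ** A"
          have "?B \<in> rotations"
          proof (rule psubset.IH[OF _ _ _ _ refl])
            show "orthogonal_matrix ?B" "det ?B = 1"
              using orthogonal_mult_rot[OF k(2)[symmetric] A(1,2)] .
            show "?B $ l $ l' = (if l = l' then 1 else 0)" if "l' \<notin> S" for l l'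
              using that k i A(3)[OF that] by (auto simp: rot_mult)
            have "{l \<in> S - {i}. ?B $ l $ i \<noteq> 0} = T - {k}"
              using k zero A(4) by (auto simp: rot_mult split: if_splits)
            then show "{l \<in> S - {i}. ?B $ l $ i \<noteq> 0} \<subset> T" using kT by blast
          qed
          then show ?thesis using rotations_cancel k by metis
        qed
      qed
      then show ?thesis using psubset.prems by simp
    qed
  qed
  show ?thesis by (rule main[of UNIV]) (use assms in auto)
qed

section \<open>Transvections generate the symplectic group\<close>

definition symp_form :: "real ^ 'n dbl \<Rightarrow> real ^ ('n::finite) dbl \<Rightarrow> real" where
  "symp_form x y = (\<Sum>p\<in>UNIV. sg p * x $ p * y $ flip p)"

lemma symp_add: "symp_form (x + y) z = symp_form x z + symp_form y z" "symp_form z (x + y) = symp_form z x + symp_form z y"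
  and symp_diff: "symp_form (x - y) z = symp_form x z - symp_form y z" "symp_form z (x - y) = symp_form z x - symp_form z y"
  and symp_scale: "symp_form (c *\<^sub>R x) z = c * symp_form x z" "symp_form z (c *\<^sub>R x) = c * symp_form z x"
  by (simp_all add: symp_form_def algebra_simps sum.distrib sum_subtractf sum_distrib_left)

lemma symp_antisym: "symp_form y x = - symp_form x y"
proof -
  have "symp_form y x = (\<Sum>p\<in>UNIV. sg (flip p) * y $ flip p * x $ flip (flip p))"
    unfolding symp_form_def by (rule sum.reindex_bij_witness[of _ flip flip]) simp_all
  then show ?thesis by (simp add: symp_form_def sum_negf mult_ac)
qed

lemma symp_self [simp]: "symp_form x x = 0"
  using symp_antisym[of x x] by simp

lemma flip_eq_iff: "flip p = q \<longleftrightarrow> p = flip q"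
  by auto

lemma symp_axis: "symp_form x (axis q 1) = - sg q * x $ flip q"
proof -
  have "symp_form x (axis q 1) = (\<Sum>p\<in>UNIV. if p = flip q then sg p * x $ p else 0)"
    unfolding symp_form_def by (intro sum.cong refl) (auto simp: axis_def flip_eq_iff)
  then show ?thesis by simp
qed

lemma symp_axis_axis: "symp_form (axis p 1) (axis q 1) = gform p q"
  by (simp add: symp_axis gform_flip') (auto simp: axis_def)

definition transvection :: "real \<Rightarrow> real ^ 'n dbl \<Rightarrow> real ^ 'n dbl ^ ('n::finite) dbl" where
  "transvection c u = (\<chi> a b. (if a = b then 1 else 0) + c * u $ a * symp_form u (axis b 1))"

lemma transvection_apply: "transvection c u *v x = x + (c * symp_form u x) *\<^sub>R u"
proof -
  have "symp_form u x = (\<Sum>b\<in>UNIV. x $ b * symp_form u (axis b 1))"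
    unfolding symp_axis unfolding symp_form_def
    by (rule sum.reindex_bij_witness[of _ flip flip]) simp_all
  then have "(\<Sum>b\<in>UNIV. c * u $ a * symp_form u (axis b 1) * x $ b) = c * symp_form u x * u $ a" for a
    by (simp add: sum_distrib_left sum_distrib_right mult_ac)
  then show ?thesis
    by (simp add: vec_eq_iff matrix_vector_mult_def transvection_def distrib_right sum.distrib
        if_distrib[of "\<lambda>x. x * _"] cong: if_cong)
qed

lemma symp_transvection: "symp_form (transvection c u *v x) (transvection c u *v y) = symp_form x y"
  unfolding transvection_apply symp_add symp_scale
  using symp_antisym[of x u] by simp

text \<open>For vectors the set \<open>S\<close> of index pairs plays the role of a hyperbolic subspace; transvections along
  its vectors act trivially on the complementary one.\<close>

definition supported :: "'n set \<Rightarrow> (real ^ ('n::finite) dbl) set" where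
  "supported S = {x. \<forall>p. half p \<notin> S \<longrightarrow> x $ p = 0}"

lemma half_flip [simp]: "half (flip p) = half p"
  by (cases p) simp_all

lemma supported_add: "x \<in> supported S \<Longrightarrow> y \<in> supported S \<Longrightarrow> x + y \<in> supported S"
  and supported_diff: "x \<in> supported S \<Longrightarrow> y \<in> supported S \<Longrightarrow> x - y \<in> supported S"
  and supported_axis: "half p \<in> S \<Longrightarrow> axis p 1 \<in> supported S"
  by (auto simp: supported_def axis_def)

inductive_set transvections :: "'n set \<Rightarrow> (real ^ 'n dbl ^ ('n::finite) dbl) set" for S where
  one: "mat 1 \<in> transvections S"
| step: "u \<in> supported S \<Longrightarrow> X \<in> transvections S \<Longrightarrow> transvection c u ** X \<in> transvections S"

lemma transvections_single: "u \<in> supported S \<Longrightarrow> transvection c u \<in> transvections S"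
  using transvections.step[OF _ transvections.one] by force

lemma transvections_mult:
  "X \<in> transvections S \<Longrightarrow> Y \<in> transvections S \<Longrightarrow> X ** Y \<in> transvections S"
  by (induction rule: transvections.induct)
    (auto simp: matrix_mul_assoc[symmetric] intro: transvections.step)

lemma transvection_inverse: "transvection (- c) u ** transvection c u = mat 1"
  unfolding matrix_eq
  by (simp add: matrix_vector_mul_assoc[symmetric] transvection_apply symp_add symp_scale)

lemma transvections_cancel:
  assumes "X \<in> transvections S" "X ** D \<in> transvections UNIV"
  shows "D \<in> transvections UNIV"
  using assms
proof (induction arbitrary: D rule: transvections.induct)
  case (step u X c)
  have "transvection (- c) u ** (transvection c u ** (X ** D)) \<in> transvections UNIV"
    using step.prems by (intro transvections.step[of _ UNIV "transvection c u ** (X ** D)"])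
      (simp_all add: supported_def matrix_mul_assoc)
  then show ?case
    using step.IH by (simp add: matrix_mul_assoc transvection_inverse)
qed simp

lemma transvections_symp: "X \<in> transvections S \<Longrightarrow> symp_form (X *v x) (X *v y) = symp_form x y"
  by (induction rule: transvections.induct)
    (simp_all add: matrix_vector_mul_assoc[symmetric] symp_transvection)

lemma transvections_fix:
  assumes "X \<in> transvections S" "half p \<notin> S"
  shows "X *v axis p 1 = axis p 1"
  using assms(1)
proof (induction rule: transvections.induct)
  case (step u X c)
  then show ?case using assms(2)
    by (simp add: matrix_vector_mul_assoc[symmetric] transvection_apply symp_axis supported_def)
qed simp

text \<open>The transvection along \<open>w - v\<close> with factor \<open>1 / \<omega>(w, v)\<close> adds \<open>w - v\<close> to \<open>v\<close>. It fixes all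
  vectors orthogonal to \<open>w - v\<close>.\<close>

lemma transvection_move:
  assumes "symp_form v w \<noteq> 0" "v \<in> supported S" "w \<in> supported S"
  obtains X where "X \<in> transvections S" "X *v v = w"
    "\<And>x. symp_form x v = symp_form x w \<Longrightarrow> X *v x = x"
proof
  let ?X = "transvection (1 / symp_form w v) (w - v)"
  show "?X \<in> transvections S" using assms by (intro transvections_single supported_diff)
  show "?X *v v = w"
    using assms(1) symp_antisym[of v w] by (simp add: transvection_apply symp_diff)
  show "?X *v x = x" if "symp_form x v = symp_form x w" for x
    using that symp_antisym[of x v] symp_antisym[of x w] by (simp add: transvection_apply symp_diff)
qed

lemma symp_nonzero_partner:
  assumes "v \<noteq> 0" "v \<in> supported S"
  obtains a where "a \<in> supported S" "symp_form v a \<noteq> 0"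
proof -
  obtain p where p: "v $ p \<noteq> 0" using assms(1) by (auto simp: vec_eq_iff)
  then have "half p \<in> S" using assms(2) by (auto simp: supported_def)
  then have "axis (flip p) 1 \<in> supported S" by (simp add: supported_axis)
  moreover have "symp_form v (axis (flip p) 1) \<noteq> 0" using p by (cases p) (simp_all add: symp_axis)
  ultimately show ?thesis using that by blast
qed

text \<open>Move \<open>v\<close> to \<open>w\<close> through an intermediate vector \<open>z\<close> that is orthogonal to neither of them.\<close>

lemma transvections_transitive:
  assumes v: "v \<noteq> 0" "v \<in> supported S" and w: "w \<noteq> 0" "w \<in> supported S"
  obtains X where "X \<in> transvections S" "X *v v = w"
proof -
  obtain a where a: "a \<in> supported S" "symp_form v a \<noteq> 0" using symp_nonzero_partner[OF v] by blast
  obtain b where b: "b \<in> supported S" "symp_form w b \<noteq> 0" using symp_nonzero_partner[OF w] by blast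
  have "\<exists>z\<in>supported S. symp_form v z \<noteq> 0 \<and> symp_form w z \<noteq> 0"
  proof (cases "symp_form w a \<noteq> 0 \<or> symp_form v b \<noteq> 0")
    case True
    then show ?thesis using a b by blast
  next
    case False
    then show ?thesis using a b by (intro bexI[of _ "a + b"]) (simp_all add: symp_add supported_add)
  qed
  then obtain z where z: "z \<in> supported S" "symp_form v z \<noteq> 0" "symp_form z w \<noteq> 0"
    using symp_antisym[of w] by fastforce
  obtain X where X: "X \<in> transvections S" "X *v v = z"
    using transvection_move[OF z(2) v(2) z(1)] by blast
  obtain Y where Y: "Y \<in> transvections S" "Y *v z = w"
    using transvection_move[OF z(3) z(1) w(2)] by blast
  show ?thesis
    using that[OF transvections_mult[OF Y(1) X(1)]] X(2) Y(2)
    by (simp add: matrix_vector_mul_assoc[symmetric])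
qed

text \<open>The vectors \<open>w\<close> and \<open>f\<close> have the same product with \<open>e\<close>, so moving one to the other directly fixes
  \<open>e\<close>. If they are orthogonal to each other, \<open>e + w\<close> serves as an intermediate vector, which also
  has the product \<open>1\<close> with \<open>e\<close>.\<close>

lemma transvections_transitive_stabilizer:
  assumes e: "e \<in> supported S" and w: "w \<in> supported S" "symp_form e w = 1"
    and f: "f \<in> supported S" "symp_form e f = 1"
  obtains X where "X \<in> transvections S" "X *v e = e" "X *v w = f"
proof (cases "symp_form w f = 0")
  case False
  then show ?thesis
    using transvection_move[OF False w(1) f(1)] w(2) f(2) that by metis
next
  case True
  let ?z = "e + w"
  have z: "?z \<in> supported S" using e w by (intro supported_add)
  have 1: "symp_form w ?z \<noteq> 0" using symp_antisym[of w e] w(2) by (simp add: symp_add)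
  have 2: "symp_form ?z f \<noteq> 0" using True f(2) by (simp add: symp_add)
  obtain X where X: "X \<in> transvections S" "X *v w = ?z" "X *v e = e"
    using transvection_move[OF 1 w(1) z] by (metis add.left_neutral symp_add(2) symp_self)
  obtain Y where Y: "Y \<in> transvections S" "Y *v ?z = f" "Y *v e = e"
    using transvection_move[OF 2 z f(1)] w(2) f(2) by (metis add.left_neutral symp_add(2) symp_self)
  show ?thesis
    using that[OF transvections_mult[OF Y(1) X(1)]] X(2,3) Y(2,3)
    by (simp add: matrix_vector_mul_assoc[symmetric])
qed

definition symplectic :: "real ^ 'n dbl ^ ('n::finite) dbl \<Rightarrow> bool" where
  "symplectic D \<longleftrightarrow> (\<forall>p q. symp_form (D *v axis p 1) (D *v axis q 1) = gform p q)"

text \<open>Induction over the set of index pairs whose basis vectors are not known to be fixed. For one such pair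
  \<open>i\<close>, the images of the two basis vectors form a hyperbolic pair; transvections move first the one
  and then, in the stabilizer of the first, the other to the basis vectors themselves, without
  disturbing the vectors fixed before.\<close>

theorem symplectic_transvections:
  fixes D :: "real ^ 'n dbl ^ ('n::finite) dbl"
  assumes "symplectic D"
  shows "D \<in> transvections UNIV"
proof -
  have "D \<in> transvections UNIV"
    if "finite S" "symplectic D" "\<And>p. half p \<notin> S \<Longrightarrow> D *v axis p 1 = axis p 1"
    for S and D :: "real ^ 'n dbl ^ 'n dbl"
    using that
  proof (induction S arbitrary: D rule: finite_psubset_induct)
    case (psubset S)
    note D = psubset.prems(1)[unfolded symplectic_def, rule_format] and fixed = psubset.prems(2)
    show ?case
    proof (cases "S = {}")
      case True
      then have "D *v axis p 1 = axis p 1" for p using fixed by simp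
      then have "D $ a $ p = mat 1 $ a $ p" for a p
        unfolding matrix_vector_mult_basis by (auto simp: column_def vec_eq_iff axis_def mat_def)
      then have "D = mat 1" by (simp add: vec_eq_iff)
      then show ?thesis by (simp add: transvections.one)
    next
      case False
      then obtain i where i: "i \<in> S" by blast
      have supp: "D *v axis p 1 \<in> supported S" if "half p \<in> S" for p
        unfolding supported_def
      proof (intro CollectI allI impI)
        fix q assume q: "half q \<notin> S"
        have "symp_form (D *v axis p 1) (D *v axis (flip q) 1) = gform p (flip q)" by (rule D)
        moreover have "p \<noteq> q" using that q by auto
        ultimately have "symp_form (D *v axis p 1) (axis (flip q) 1) = 0"
          using fixed[of "flip q"] q by (simp add: gform_flip flip_eq_iff)
        then show "(D *v axis p 1) $ q = 0"
          unfolding symp_axis by (cases q) simp_all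
      qed
      let ?e = "axis (Od i) 1 :: real ^ 'n dbl" and ?f = "axis (Ev i) 1 :: real ^ 'n dbl"
      have ef: "?e \<in> supported S" "?f \<in> supported S" using i by (simp_all add: supported_axis)
      have vw: "D *v ?e \<in> supported S" "D *v ?f \<in> supported S" using i by (simp_all add: supp)
      have one: "symp_form (D *v ?e) (D *v ?f) = 1" by (simp add: D)
      then have "D *v ?e \<noteq> 0" by (auto simp: symp_form_def)
      moreover have "?e \<noteq> 0" by simp
      ultimately obtain X where X: "X \<in> transvections S" "X *v (D *v ?e) = ?e"
        using transvections_transitive vw(1) ef(1) by metis
      have supX: "Y *v x \<in> supported S" if "Y \<in> transvections S" "x \<in> supported S" for Y x
        using that
        by (induction rule: transvections.induct)
          (auto simp: matrix_vector_mul_assoc[symmetric] transvection_apply supported_def)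
      have "symp_form ?e (X *v (D *v ?f)) = 1"
        using transvections_symp[OF X(1), of "D *v ?e" "D *v ?f"] X(2) one by simp
      moreover have "symp_form ?e ?f = 1" by (simp add: symp_axis_axis)
      ultimately obtain Y where Y: "Y \<in> transvections S" "Y *v ?e = ?e" "Y *v (X *v (D *v ?f)) = ?f"
        using transvections_transitive_stabilizer[OF ef(1) supX[OF X(1) vw(2)] _ ef(2)] by metis
      let ?Z = "Y ** X"
      have Z: "?Z \<in> transvections S" by (rule transvections_mult[OF Y(1) X(1)])
      have "?Z ** D \<in> transvections UNIV"
      proof (rule psubset.IH[of "S - {i}"])
        show "S - {i} \<subset> S" using i by blast
        show "symplectic (?Z ** D)"
          unfolding symplectic_def using D transvections_symp[OF Z]
          by (simp add: matrix_vector_mul_assoc[symmetric])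
        fix p assume p: "half p \<notin> S - {i}"
        show "?Z ** D *v axis p 1 = axis p 1"
        proof (cases "half p = i")
          case True
          then show ?thesis using X(2) Y(2,3)
            by (cases p) (simp_all add: matrix_vector_mul_assoc[symmetric])
        next
          case False
          then have "half p \<notin> S" using p by simp
          then show ?thesis using fixed transvections_fix[OF Z]
            by (simp add: matrix_vector_mul_assoc[symmetric])
        qed
      qed
      then show ?thesis by (rule transvections_cancel[OF Z])
    qed
  qed
  from this[of UNIV D] assms show ?thesis by simp
qed

definition symp_matrix :: "real ^ 'n dbl ^ ('n::finite) dbl" where
  "symp_matrix = (\<chi> p q. gform p q)"

lemma symp_congruence:
  "symp_form (A *v axis p 1) (B *v axis q 1) = (transpose A ** (symp_matrix ** B)) $ p $ q"
proof -
  have "(symp_matrix ** B) $ k $ q = sg k * B $ flip k $ q" for k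
    using sum_gform_right[of k "\<lambda>l. B $ l $ q"] by (simp add: symp_matrix_def matrix_matrix_mult_def)
  then show ?thesis
    unfolding matrix_vector_mult_basis matrix_matrix_mult_def[of "transpose A"]
    by (simp add: symp_form_def column_def transpose_def mult_ac)
qed

lemma det_symp_matrix: "det (symp_matrix :: real ^ 'n dbl ^ ('n::finite) dbl) \<noteq> 0"
proof -
  have "transpose symp_matrix ** symp_matrix = (mat 1 :: real ^ 'n dbl ^ 'n dbl)"
  proof -
    have "(transpose symp_matrix ** symp_matrix) $ p $ q = (mat 1 :: real ^ 'n dbl ^ 'n dbl) $ p $ q" for p q
      using sum_gform_left[of p "\<lambda>k. gform k q"]
      by (auto simp: symp_matrix_def matrix_matrix_mult_def transpose_def mat_def gform_flip)
    then show ?thesis by (simp add: vec_eq_iff)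
  qed
  then have "orthogonal_matrix (symp_matrix :: real ^ 'n dbl ^ 'n dbl)" by (simp add: orthogonal_matrix)
  then show ?thesis using det_orthogonal_matrix by force
qed

lemma det_symplectic_square:
  assumes "symplectic D"
  shows "det D * det D = 1"
proof -
  have "transpose D ** (symp_matrix ** D) = symp_matrix"
    using assms unfolding symplectic_def symp_congruence by (simp add: vec_eq_iff symp_matrix_def)
  then have "det (transpose D ** (symp_matrix ** D)) = det (symp_matrix :: real ^ 'a dbl ^ 'a dbl)" by simp
  then have "det D * (det (symp_matrix :: real ^ 'a dbl ^ 'a dbl) * det D) = det (symp_matrix :: real ^ 'a dbl ^ 'a dbl)"
    by (simp add: det_mul)
  then show ?thesis using det_symp_matrix[where ?'n='a] by (simp add: mult_ac)
qed

lemma symplectic_transvection: "symplectic (transvection c u)"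
  by (simp add: symplectic_def symp_transvection symp_axis_axis)

text \<open>A symplectic matrix has determinant \<open>\<plusminus>1\<close>, and a transvection is a square of a transvection.\<close>

lemma det_transvection: "det (transvection c u) = 1"
proof -
  have "transvection c u = transvection (c/2) u ** transvection (c/2) u"
    unfolding matrix_eq
    by (simp add: matrix_vector_mul_assoc[symmetric] transvection_apply symp_add symp_scale
        vec_eq_iff)
  then have "det (transvection c u) = det (transvection (c/2) u) * det (transvection (c/2) u)"
    by (simp add: det_mul)
  then show ?thesis using det_symplectic_square[OF symplectic_transvection, of "c/2" u] by simp
qed

theorem det_symplectic:
  assumes "symplectic D"
  shows "det D = 1"
proof -
  have "det X = 1" if "X \<in> transvections UNIV" for X :: "real ^ 'a dbl ^ 'a dbl"
    using that by (induction rule: transvections.induct) (simp_all add: det_mul det_transvection)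
  then show ?thesis using symplectic_transvections[OF assms] by blast
qed

section \<open>Two exponentials in closed form\<close>

lemma smat_diff_mult:
  fixes A B C :: "('f, 'm::{finite,linorder}, 'n::finite, 's) smat"
  shows "(A - B) ** C = A ** C - B ** C" "C ** (A - B) = C ** A - C ** B" "(A + B) ** C = A ** C + B ** C"
  by (simp_all add: matrix_matrix_mult_def vec_eq_iff algebra_simps sum.distrib sum_subtractf)

lemma smat_zero_mult:
  fixes A :: "('f, 'm::{finite,linorder}, 'n::finite, 's) smat"
  shows "0 ** A = 0" "A ** 0 = 0"
  by (simp_all add: matrix_matrix_mult_def vec_eq_iff)

theorem spin_image_square_zero:
  fixes M N :: "('f::{finite,linorder}, 'm::{finite,linorder}, 'n::{finite,linorder}, 's) smat"
  assumes N: "N \<in> Mat" "star N = - N" "N ** N = 0" and M: "M \<in> spin_image"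
  shows "(mat 1 + N) ** M \<in> spin_image"
proof (rule spin_image_exp[OF bivector_of_bivectors infinitesimal_bivector_of _ _ M])
  have e1: "exp_term N (Suc 0) = N" by (simp add: exp_term_Suc exp_term_0)
  have e2: "exp_term N (Suc (Suc d)) = 0" for d
    by (induction d) (simp_all add: exp_term_Suc exp_term_0 matrix_scalar_ac N(3) smat_zero_mult)
  have "exp_term N d $ i $ k = (if d = 0 then mat 1 $ i $ k else 0) + (if d = 1 then N $ i $ k else 0)" for d i k
    by (cases d rule: old.nat.exhaust; cases "d - 1" rule: old.nat.exhaust)
      (auto simp: exp_term_0 e1 e2)
  then show "exp_sums N (mat 1 + N)"
    unfolding exp_sums_def by (simp add: abs_sums.add abs_sums_delta)
  show "mat 1 + N \<in> Mat" using N(1) Mat_one unfolding Mat_eq by (intro Mat_over_add)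
qed (fact N)+

text \<open>The two equations for \<open>J\<close> and \<open>P\<close> say that \<open>J\<close> is a complex structure on the image of the projection \<open>P\<close>
  and zero on its complement, so the exponential series of \<open>t J\<close> splits into those of cosine and sine.\<close>

theorem spin_image_rotation:
  fixes M J P :: "('f::{finite,linorder}, 'm::{finite,linorder}, 'n::{finite,linorder}, 's) smat"
  assumes J: "J \<in> Mat" "star J = - J" and P: "P \<in> Mat" "J ** J = - P" "J ** P = J"
    and M: "M \<in> spin_image"
  shows "(mat 1 - P + cos t *\<^sub>R P + sin t *\<^sub>R J) ** M \<in> spin_image"
proof (rule spin_image_exp[OF bivector_of_bivectors infinitesimal_bivector_of _ _ M])
  let ?N = "t *\<^sub>R J"
  show N: "?N \<in> Mat" using J(1) unfolding Mat_eq by (rule Mat_over_scale)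
  show "star ?N = - ?N" by (simp add: star_scale J(2))
  have e: "exp_term ?N d = (if d = 0 then mat 1 - P else 0) + (cos_coeff d * t ^ d) *\<^sub>R P + (sin_coeff d * t ^ d) *\<^sub>R J" for d
  proof (induction d)
    case 0
    show ?case by (simp add: exp_term_0)
  next
    case (Suc d)
    have "?N ** exp_term ?N d = (t * (cos_coeff d * t ^ d)) *\<^sub>R J - (t * (sin_coeff d * t ^ d)) *\<^sub>R P"
      unfolding Suc by (simp add: matrix_add_ldistrib smat_diff_mult smat_zero_mult matrix_scalar_ac
          scalar_matrix_assoc[symmetric] P mult_ac)
    moreover have "cos_coeff (Suc d) * t ^ Suc d = - (inverse (real (Suc d)) * (t * (sin_coeff d * t ^ d)))"
      "sin_coeff (Suc d) * t ^ Suc d = inverse (real (Suc d)) * (t * (cos_coeff d * t ^ d))"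
      by (simp_all add: cos_coeff_Suc sin_coeff_Suc divide_inverse del: of_nat_Suc)
    ultimately show ?case
      by (simp add: exp_term_Suc scaleR_diff_right del: of_nat_Suc power_Suc)
  qed
  have sums: "abs_sums (\<lambda>d. (cos_coeff d * t ^ d) *\<^sub>R x) (cos t *\<^sub>R x)"
    "abs_sums (\<lambda>d. (sin_coeff d * t ^ d) *\<^sub>R x) (sin t *\<^sub>R x)" for x :: "('f, 'm, 'n, 's) superalg"
  proof -
    have "suminf (\<lambda>d. cos_coeff d * t ^ d) = cos t" "suminf (\<lambda>d. sin_coeff d * t ^ d) = sin t"
      using cos_converges[of t] sin_converges[of t] by (simp_all add: sums_iff)
    moreover have "summable (\<lambda>d. \<bar>cos_coeff d * t ^ d\<bar>)" "summable (\<lambda>d. \<bar>sin_coeff d * t ^ d\<bar>)"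
      using summable_norm_cos[of t] summable_norm_sin[of t] by simp_all
    ultimately show "abs_sums (\<lambda>d. (cos_coeff d * t ^ d) *\<^sub>R x) (cos t *\<^sub>R x)"
      "abs_sums (\<lambda>d. (sin_coeff d * t ^ d) *\<^sub>R x) (sin t *\<^sub>R x)"
      using abs_sums.single[of "\<lambda>d. cos_coeff d * t ^ d" x] abs_sums.single[of "\<lambda>d. sin_coeff d * t ^ d" x]
      by simp_all
  qed
  show "exp_sums ?N (mat 1 - P + cos t *\<^sub>R P + sin t *\<^sub>R J)"
    unfolding exp_sums_def
  proof (intro allI)
    fix i k
    have "exp_term ?N d $ i $ k = (if d = 0 then (mat 1 - P) $ i $ k else 0)
        + (cos_coeff d * t ^ d) *\<^sub>R P $ i $ k + (sin_coeff d * t ^ d) *\<^sub>R J $ i $ k" for d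
      unfolding e by simp
    then show "abs_sums (\<lambda>d. exp_term ?N d $ i $ k) ((mat 1 - P + cos t *\<^sub>R P + sin t *\<^sub>R J) $ i $ k)"
      using abs_sums.add[OF abs_sums.add[OF abs_sums_delta sums(1)] sums(2), of 0 "(mat 1 - P) $ i $ k" "P $ i $ k" "J $ i $ k"]
      by (simp only: vector_add_component vector_scaleR_component)
  qed
  show "mat 1 - P + cos t *\<^sub>R P + sin t *\<^sub>R J \<in> Mat"
    using Mat_one P(1) J(1) unfolding Mat_eq by (intro Mat_over_add Mat_over_diff Mat_over_scale)
  show "?N \<in> Mat" "star ?N = - ?N" by fact+
qed

section \<open>Real block matrices\<close>

definition body_mat :: "real ^ ('m::{finite,linorder}) ^ ('m::{finite,linorder}) \<Rightarrow> real ^ 'n dbl ^ ('n::finite) dbl \<Rightarrow>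
    ('f, 'm::{finite,linorder}, 'n::finite, 's) smat" where
  "body_mat A D = (\<chi> i j. case (i, j) of
      (Inl k, Inl l) \<Rightarrow> A $ k $ l *\<^sub>R 1
    | (Inr p, Inr q) \<Rightarrow> D $ p $ q *\<^sub>R 1
    | _ \<Rightarrow> 0)"

lemma body_mat_nth [simp]:
  "body_mat A D $ Inl k $ Inl l = A $ k $ l *\<^sub>R 1"
  "body_mat A D $ Inr p $ Inr q = D $ p $ q *\<^sub>R 1"
  "body_mat A D $ Inl k $ Inr q = 0"
  "body_mat A D $ Inr p $ Inl l = 0"
  by (simp_all add: body_mat_def)

lemma smat_eqI:
  fixes M N :: "('f, 'm::finite, 'n::finite, 's) smat"
  assumes "\<And>k l. M $ Inl k $ Inl l = N $ Inl k $ Inl l" "\<And>k q. M $ Inl k $ Inr q = N $ Inl k $ Inr q"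
    "\<And>p l. M $ Inr p $ Inl l = N $ Inr p $ Inl l" "\<And>p q. M $ Inr p $ Inr q = N $ Inr p $ Inr q"
  shows "M = N"
proof -
  have "M $ i $ j = N $ i $ j" for i j by (cases i; cases j) (simp_all add: assms)
  then show ?thesis by (simp add: vec_eq_iff)
qed

lemma body_mat_mult: "body_mat A D ** body_mat A' D' = body_mat (A ** A') (D ** D')"
  by (rule smat_eqI) (simp_all add: matrix_matrix_mult_def sum_UNIV_sum scaleR_sum_left)

lemma body_mat_one: "body_mat (mat 1) (mat 1) = mat 1"
  by (rule smat_eqI) (simp_all add: mat_def)

lemma body_mat_add: "body_mat (A + A') (D + D') = body_mat A D + body_mat A' D'"
  and body_mat_diff: "body_mat (A - A') (D - D') = body_mat A D - body_mat A' D'"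
  and body_mat_scale: "body_mat (c *\<^sub>R A) (c *\<^sub>R D) = c *\<^sub>R body_mat A D"
  and body_mat_minus: "body_mat (- A) (- D) = - body_mat A D"
  and body_mat_zero: "body_mat 0 0 = 0"
  by (rule smat_eqI; simp add: scaleR_add_left scaleR_diff_left)+

lemma body_mat_Mat_over:
  "(body_mat A D :: ('f::{finite,linorder}, 'm::{finite,linorder}, 'n::{finite,linorder}, 's) smat) \<in> Mat_over {{}}"
  unfolding Mat_over_def
proof (intro CollectI allI)
  fix i j :: "'m + 'n dbl"
  have one: "c *\<^sub>R 1 \<in> grass ({{}} \<inter> parity_sets False :: 'f set set)" for c
    unfolding f_mono_empty[symmetric] by (intro grass_scale grass_mono) (simp add: parity_sets_def)
  show "(body_mat A D :: ('f, 'm, 'n, 's) smat) $ i $ j \<in> grass ({{}} \<inter> parity_sets (entry_parity i j))"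
    by (cases i; cases j) (simp_all add: entry_parity_def one grass_0)
qed

lemma body_mat_Mat:
  "(body_mat A D :: ('f::{finite,linorder}, 'm::{finite,linorder}, 'n::{finite,linorder}, 's) smat) \<in> Mat"
  unfolding Mat_eq by (rule Mat_over_subset[OF _ body_mat_Mat_over]) simp

lemma star_body_mat:
  "star (body_mat A D) = body_mat (transpose A) (\<chi> p q. sg p * sg q * D $ flip q $ flip p)"
  by (rule smat_eqI) (simp_all add: star_def transpose_def)

lemma body_mat_eq_iff: "body_mat A D = (body_mat A' D' :: ('f, 'm::{finite,linorder}, 'n::finite, 's) smat)
    \<longleftrightarrow> A = A' \<and> D = D'"
proof
  assume eq: "body_mat A D = (body_mat A' D' :: ('f, 'm, 'n, 's) smat)"
  have "A $ k $ l = A' $ k $ l" for k l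
    using arg_cong[OF eq, of "\<lambda>X. X $ Inl k $ Inl l"] by simp
  moreover have "D $ p $ q = D' $ p $ q" for p q
    using arg_cong[OF eq, of "\<lambda>X. X $ Inr p $ Inr q"] by simp
  ultimately show "A = A' \<and> D = D'" by (simp add: vec_eq_iff)
qed simp

text \<open>The rotation in the \<open>(j, k)\<close>-plane is the exponential of \<open>t J\<close>, where \<open>J\<close> is the rotation by a right
  angle in this plane and zero on its complement, and \<open>P\<close> is the projection to the plane.\<close>

lemma spin_image_body_rotations:
  fixes M :: "('f::{finite,linorder}, 'm::{finite,linorder}, 'n::{finite,linorder}, 's) smat"
  assumes "X \<in> rotations" "M \<in> spin_image"
  shows "body_mat X (mat 1) ** M \<in> spin_image"
  using assms(1)
proof (induction rule: rotations.induct)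
  case one
  then show ?case using assms(2) by (simp add: body_mat_one)
next
  case (step j k X t)
  let ?J = "(\<chi> a b. if a = j \<and> b = k then -1 else if a = k \<and> b = j then 1 else 0) :: real ^ ('m::{finite,linorder}) ^ ('m::{finite,linorder})"
  let ?P = "(\<chi> a b. if a = b \<and> (a = j \<or> a = k) then 1 else 0) :: real ^ ('m::{finite,linorder}) ^ ('m::{finite,linorder})"
  have J: "(?J ** X) $ a $ b = (if a = j then - X $ k $ b else if a = k then X $ j $ b else 0)"
    for X :: "real ^ ('m::{finite,linorder}) ^ ('m::{finite,linorder})" and a b
  proof -
    have "(?J ** X) $ a $ b = (\<Sum>l\<in>UNIV. (if l = k then (if a = j then - X $ k $ b else 0) else 0)
       + (if l = j then (if a = k then X $ j $ b else 0) else 0))"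
      unfolding matrix_matrix_mult_def vec_lambda_beta using step(1)
      by (intro sum.cong refl) simp
    then show ?thesis using step(1) by (simp add: sum.distrib)
  qed
  have JJ: "?J ** ?J = - ?P"
    unfolding vec_eq_iff J using step(1) by simp
  have JP: "?J ** ?P = ?J"
    unfolding vec_eq_iff J using step(1) by simp
  have rot: "rot j k t = mat 1 - ?P + cos t *\<^sub>R ?P + sin t *\<^sub>R ?J"
    unfolding vec_eq_iff rot_def mat_def using step(1) by simp
  have tr: "transpose ?J = - ?J"
    unfolding vec_eq_iff transpose_def using step(1) by simp
  have zero: "(\<chi> p q. sg p * sg q * (0 :: real ^ 'n dbl ^ 'n dbl) $ flip q $ flip p) = 0"
    by (simp add: vec_eq_iff)
  let ?j = "body_mat ?J 0 :: ('f, 'm, 'n, 's) smat" and ?p = "body_mat ?P 0 :: ('f, 'm, 'n, 's) smat"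
  have "(mat 1 - ?p + cos t *\<^sub>R ?p + sin t *\<^sub>R ?j) ** (body_mat X (mat 1) ** M) \<in> spin_image"
  proof (rule spin_image_rotation[OF body_mat_Mat _ body_mat_Mat])
    show "star ?j = - ?j"
      unfolding star_body_mat tr zero using body_mat_minus[of ?J 0] by simp
    show "?j ** ?j = - ?p"
      unfolding body_mat_mult JJ using body_mat_minus[of ?P 0] by simp
    show "?j ** ?p = ?j"
      unfolding body_mat_mult JP by simp
    show "body_mat X (mat 1) ** M \<in> spin_image" by fact
  qed
  moreover have "body_mat (rot j k t ** X) (mat 1) = (mat 1 - ?p + cos t *\<^sub>R ?p + sin t *\<^sub>R ?j) ** body_mat X (mat 1)"
  proof -
    have "mat 1 - ?p + cos t *\<^sub>R ?p + sin t *\<^sub>R ?j = body_mat (rot j k t) (mat 1 - 0 + cos t *\<^sub>R 0 + sin t *\<^sub>R 0)"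
      unfolding rot body_mat_add body_mat_diff body_mat_scale body_mat_one ..
    then show ?thesis by (simp add: body_mat_mult)
  qed
  ultimately show ?case by (simp add: matrix_mul_assoc)
qed

text \<open>A transvection is the identity plus a matrix of square zero, because the symplectic form vanishes
  on the diagonal.\<close>

lemma spin_image_body_transvections:
  fixes M :: "('f::{finite,linorder}, 'm::{finite,linorder}, 'n::{finite,linorder}, 's) smat"
  assumes "X \<in> transvections UNIV" "M \<in> spin_image"
  shows "body_mat (mat 1) X ** M \<in> spin_image"
  using assms(1)
proof (induction rule: transvections.induct)
  case one
  then show ?case using assms(2) by (simp add: body_mat_one)
next
  case (step u X c)
  let ?T = "(\<chi> a b. c * u $ a * symp_form u (axis b 1)) :: real ^ 'n dbl ^ 'n dbl"
  have T: "transvection c u = mat 1 + ?T"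
    by (simp add: transvection_def vec_eq_iff mat_def)
  have TT: "?T ** ?T = 0"
  proof -
    have "transvection c u *v (transvection c u *v x) = x + (2 * c * symp_form u x) *\<^sub>R u" for x
      by (simp add: transvection_apply symp_add symp_scale vec_eq_iff)
    moreover have "transvection c u *v (transvection c u *v x) = x + ?T *v x + ?T *v x + ?T *v (?T *v x)" for x
      by (simp add: T matrix_vector_mult_add_rdistrib matrix_vector_right_distrib)
    moreover have "x + ?T *v x = x + (c * symp_form u x) *\<^sub>R u" for x
      using transvection_apply[of c u x] by (simp add: T matrix_vector_mult_add_rdistrib)
    ultimately have "?T *v (?T *v x) = 0 *v x" for x
      by (simp add: vec_eq_iff)
    then show ?thesis unfolding matrix_eq by (simp add: matrix_vector_mul_assoc[symmetric])
  qed
  have skew: "(\<chi> p q. sg p * sg q * ?T $ flip q $ flip p) = - ?T"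
    by (simp add: vec_eq_iff symp_axis mult_ac)
  have tz: "transpose (0 :: real ^ ('m::{finite,linorder}) ^ ('m::{finite,linorder})) = 0"
    by (simp add: vec_eq_iff transpose_def)
  let ?t = "body_mat 0 ?T :: ('f, 'm, 'n, 's) smat"
  have "(mat 1 + ?t) ** (body_mat (mat 1) X ** M) \<in> spin_image"
  proof (rule spin_image_square_zero[OF body_mat_Mat])
    show "star ?t = - ?t"
      unfolding star_body_mat skew tz using body_mat_minus[of 0 ?T] by simp
    show "?t ** ?t = 0"
      unfolding body_mat_mult TT by (simp add: body_mat_zero)
    show "body_mat (mat 1) X ** M \<in> spin_image" by fact
  qed
  moreover have "body_mat (mat 1) (transvection c u ** X) = (mat 1 + ?t) ** body_mat (mat 1) X"
  proof -
    have "mat 1 + ?t = body_mat (mat 1 + 0) (transvection c u)"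
      unfolding T body_mat_add body_mat_one ..
    then show ?thesis by (simp add: body_mat_mult)
  qed
  ultimately show ?case by (simp add: matrix_mul_assoc)
qed

section \<open>Isometries congruent to the identity\<close>

lemma grass_empty: "a \<in> grass {} \<Longrightarrow> a = 0"
  by (simp add: grass_def)

lemma Mat_over_empty: "M \<in> Mat_over {} \<Longrightarrow> M = 0"
  by (simp add: Mat_over_def vec_eq_iff) (metis grass_empty)

lemma grass_split:
  assumes "a \<in> grass (U \<inter> Q)"
  shows "\<exists>b c. a = b + c \<and> b \<in> grass ({A} \<inter> Q) \<and> c \<in> grass ((U - {A}) \<inter> Q)"
  using assms
proof (induction rule: grass_induct)
  case zero
  show ?case by (intro exI[of _ 0]) (simp add: grass_0)
next
  case (add a a')
  then obtain b c b' c' where "a = b + c" "b \<in> grass ({A} \<inter> Q)" "c \<in> grass ((U - {A}) \<inter> Q)"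
    "a' = b' + c'" "b' \<in> grass ({A} \<inter> Q)" "c' \<in> grass ((U - {A}) \<inter> Q)" by blast
  then show ?case
    by (intro exI[of _ "b + b'"] exI[of _ "c + c'"]) (simp add: grass_add)
next
  case (scale r B)
  show ?case
  proof (cases "B = A")
    case True
    then show ?thesis using scale
      by (intro exI[of _ "r *\<^sub>R f_mono B"] exI[of _ 0]) (simp add: grass_0 grass_scale grass_mono)
  next
    case False
    then show ?thesis using scale
      by (intro exI[of _ "r *\<^sub>R f_mono B"] exI[of _ 0]) (simp add: grass_0 grass_scale grass_mono)
  qed
qed

lemma Mat_over_split:
  fixes M :: "('f::{finite,linorder}, 'm::{finite,linorder}, 'n::{finite,linorder}, 's) smat"
  assumes "M \<in> Mat_over U"
  shows "\<exists>X Y. M = X + Y \<and> X \<in> Mat_over {A} \<and> Y \<in> Mat_over (U - {A})"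
proof -
  have "\<forall>i j. \<exists>b c. M $ i $ j = b + c \<and> b \<in> grass ({A} \<inter> parity_sets (entry_parity i j))
     \<and> c \<in> grass ((U - {A}) \<inter> parity_sets (entry_parity i j))"
    using grass_split[OF Mat_overD[OF assms]] by blast
  then obtain f g where fg: "\<forall>i j. M $ i $ j = f i j + g i j \<and>
     f i j \<in> grass ({A} \<inter> parity_sets (entry_parity i j)) \<and>
     g i j \<in> grass ((U - {A}) \<inter> parity_sets (entry_parity i j))" by metis
  show ?thesis
    by (intro exI[of _ "\<chi> i j. f i j"] exI[of _ "\<chi> i j. g i j"])
      (use fg in \<open>simp add: Mat_over_def vec_eq_iff\<close>)
qed

text \<open>Induction on the number of monomials that may occur in \<open>M - 1\<close>. Let \<open>f\<^sub>A\<close> be one of minimal degree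
  and \<open>X\<close> the part of \<open>M - 1\<close> with this monomial. The linear term of \<open>star M ** M = 1\<close> shows that
  \<open>X + star X\<close> can be written with the remaining monomials, so \<open>X\<close> may be replaced by its skew part
  \<open>L\<close>. Multiplication by \<open>1 - L\<close>, the inverse of \<open>1 + L\<close>, removes the monomial \<open>f\<^sub>A\<close> from
  \<open>M - 1\<close>.\<close>

theorem spin_image_unipotent:
  fixes M :: "('f::{finite,linorder}, 'm::{finite,linorder}, 'n::{finite,linorder}, 's) smat"
  assumes "{} \<notin> U" "\<And>A B. A \<in> U \<Longrightarrow> A \<subseteq> B \<Longrightarrow> B \<in> U"
    and "M \<in> Mat" "star M ** M = mat 1" "M - mat 1 \<in> Mat_over U"
  shows "M \<in> spin_image"
  using finite[of U] assms
proof (induction U arbitrary: M rule: finite_psubset_induct)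
  case (psubset U)
  note U = psubset.prems(1,2) and M = psubset.prems(3,4,5)
  show ?case
  proof (cases "U = {}")
    case True
    then have "M = mat 1" using Mat_over_empty M(3) by fastforce
    then show ?thesis using spin_image_one[OF zero_bivectors] by simp
  next
    case False
    obtain A where A: "A \<in> U" "\<And>B. B \<in> U \<Longrightarrow> card A \<le> card B"
      using ex_has_least_nat[of "\<lambda>A. A \<in> U" _ card] False by blast
    have A0: "A \<noteq> {}" using A(1) U(1) by blast
    let ?V = "U - {A}"
    have V: "B \<in> ?V" if "B' \<in> ?V" "B' \<subseteq> B" for B B'
    proof -
      have "B \<noteq> A"
      proof
        assume "B = A"
        then have "B' \<subset> A" using that by blast
        then have "card B' < card A" by (intro psubset_card_mono) simp_all
        then show False using A(2)[of B'] that by simp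
      qed
      then show ?thesis using that U(2) by blast
    qed
    define P where "P = M - mat 1"
    have P: "P \<in> Mat_over U" "M = mat 1 + P" using M(3) by (simp_all add: P_def)
    obtain X R where XR: "P = X + R" "X \<in> Mat_over {A}" "R \<in> Mat_over ?V"
      using Mat_over_split[OF P(1)] by blast
    have sX: "star X \<in> Mat_over {A}" by (rule star_Mat_over[OF XR(2)])
    define L where "L = (1/2) *\<^sub>R (X - star X)"
    have LA: "L \<in> Mat_over {A}"
      unfolding L_def by (intro Mat_over_scale Mat_over_diff XR(2) sX)
    have L: "L \<in> Mat" unfolding Mat_eq by (rule Mat_over_subset[OF _ LA]) simp
    have skew: "star L = - L" by (simp add: L_def star_scale star_diff scaleR_diff_right)
    have "L ** L \<in> Mat_over {}" by (rule Mat_over_mult[OF LA LA]) (use A0 in auto)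
    then have LL: "L ** L = 0" by (rule Mat_over_empty)
    let ?M = "(mat 1 - L) ** M"
    have Em: "mat 1 - L \<in> Mat" using Mat_one L unfolding Mat_eq by (rule Mat_over_diff)
    have inv: "(mat 1 + L) ** (mat 1 - L) = mat 1"
      by (simp add: smat_diff_mult matrix_add_ldistrib LL)
    have "?M \<in> spin_image"
    proof (rule psubset.IH[of ?V])
      show "?V \<subset> U" using A(1) by blast
      show "{} \<notin> ?V" using U(1) by blast
      show "B \<in> ?V" if "B' \<in> ?V" "B' \<subseteq> B" for B B' using V that by blast
      show "?M \<in> Mat" by (rule Mat_mult[OF Em M(1)])
      have "star ?M ** ?M = star M ** (((mat 1 + L) ** (mat 1 - L)) ** M)"
        by (simp add: star_mult[OF Em M(1)] star_diff star_one skew matrix_mul_assoc)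
      then show "star ?M ** ?M = mat 1" by (simp add: inv M(2))
      have LP: "L ** P \<in> Mat_over ?V"
      proof (rule Mat_over_mult[OF LA P(1)])
        fix B C assume BC: "B \<in> {A}" "C \<in> U" "B \<inter> C = {}"
        then have "C \<noteq> {}" using U(1) by blast
        then have "A \<union> C \<noteq> A" using BC by blast
        then show "B \<union> C \<in> ?V" using BC(1) U(2)[OF A(1), of "A \<union> C"] by blast
      qed
      \<comment> \<open>Products of two monomials have a degree above the minimal one, so they differ from \<open>f\<^sub>A\<close>.\<close>
      have PP: "star P ** P \<in> Mat_over ?V"
      proof (rule Mat_over_mult[OF star_Mat_over[OF P(1)] P(1)])
        fix B C assume BC: "B \<in> U" "C \<in> U" "B \<inter> C = {}"
        then have "card (B \<union> C) = card B + card C" by (intro card_Un_disjoint) auto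
        moreover have "card C > 0" using BC(2) U(1) by (auto simp: card_gt_0_iff)
        ultimately have "B \<union> C \<noteq> A" using A(2)[OF BC(1)] by auto
        then show "B \<union> C \<in> ?V" using U(2)[OF BC(1), of "B \<union> C"] by blast
      qed
      have "mat 1 = (mat 1 + star P) ** (mat 1 + P)" using M(2) by (simp add: P(2) star_add star_one)
      then have "star P + P + star P ** P = 0"
        by (simp add: smat_diff_mult matrix_add_ldistrib add.assoc)
      then have "X + star X = - (R + star R + star P ** P)"
        by (simp add: XR(1) star_add add_eq_0_iff algebra_simps)
      moreover have "X - L = (1/2) *\<^sub>R (X + star X)"
      proof -
        have "2 *\<^sub>R (X - L) = X + star X" by (simp add: L_def scaleR_diff_right scaleR_2)
        then have "(1/2) *\<^sub>R (2 *\<^sub>R (X - L)) = (1/2) *\<^sub>R (X + star X)" by (simp only:)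
        then show ?thesis by simp
      qed
      ultimately have "X - L = (- 1/2) *\<^sub>R (R + star R + star P ** P)"
        by (simp only: scaleR_minus_right scaleR_minus_left minus_divide_left[symmetric])
      moreover have "R + star R + star P ** P \<in> Mat_over ?V"
        by (intro Mat_over_add XR(3) star_Mat_over PP)
      ultimately have XL: "X - L \<in> Mat_over ?V" by (simp only: Mat_over_scale)
      have "?M - mat 1 = (X - L) + R - L ** P"
        by (simp add: P(2) smat_diff_mult matrix_add_ldistrib XR(1))
      then show "?M - mat 1 \<in> Mat_over ?V"
        using Mat_over_diff[OF Mat_over_add[OF XL XR(3)] LP] by simp
    qed
    then have "(mat 1 + L) ** ?M \<in> spin_image"
      by (rule spin_image_square_zero[OF L skew LL])
    then show ?thesis by (simp add: matrix_mul_assoc inv)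
  qed
qed

lemma nilpotent_one_diff_inverse:
  fixes x :: "'a::ring_1"
  assumes "x ^ n = 0"
  shows "\<exists>y. (1 - x) * y = 1 \<and> y * (1 - x) = 1"
proof -
  have "(1 - x) * (\<Sum>i<k. x ^ i) = 1 - x ^ k" for k
    by (induction k) (simp_all add: distrib_left, simp add: algebra_simps)
  moreover have "(\<Sum>i<k. x ^ i) * (1 - x) = 1 - x ^ k" for k
    by (induction k) (simp_all add: distrib_right, simp add: algebra_simps power_commutes)
  ultimately show ?thesis using assms by (intro exI[of _ "\<Sum>i<n. x ^ i"]) simp
qed

lemma grass_nilpotent:
  fixes x :: "('f::{finite,linorder}, 'm::{finite,linorder}, 'n, 's) superalg"
  assumes "x \<in> grass U" "{} \<notin> U"
  shows "x ^ Suc CARD('f) = 0"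
proof -
  have "x ^ k \<in> grass {A. k \<le> card A}" for k
  proof (induction k)
    case 0
    show ?case using grass_mono[of "{}" "{A. 0 \<le> card A}"] by (simp add: f_mono_empty)
  next
    case (Suc k)
    show ?case
      unfolding power_Suc
    proof (rule grass_mult[OF assms(1) Suc])
      fix A B assume AB: "A \<in> U" "B \<in> {A. k \<le> card A}" "A \<inter> B = {}"
      then have "card (A \<union> B) = card A + card B" by (intro card_Un_disjoint) auto
      moreover have "card A > 0" using AB(1) assms(2) by (auto simp: card_gt_0_iff)
      ultimately show "A \<union> B \<in> {A. Suc k \<le> card A}" using AB(2) by simp
    qed
  qed
  then have "x ^ Suc CARD('f) \<in> grass {A :: 'f set. Suc CARD('f) \<le> card A}" .
  moreover have "{A :: 'f set. Suc CARD('f) \<le> card A} = {}"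
    using card_mono[OF finite subset_UNIV] by (auto simp: not_less_eq_eq[symmetric])
  ultimately show ?thesis using grass_empty by metis
qed

lemma grass_body:
  fixes a :: "('f::{finite,linorder}, 'm::{finite,linorder}, 'n, 's) superalg"
  assumes "a \<in> grass {{}}"
  shows "\<exists>c. a = c *\<^sub>R 1"
  using assms
proof (induction rule: grass_induct)
  case zero
  show ?case by (rule exI[of _ 0]) simp
next
  case (add a b)
  then show ?case by (metis scaleR_add_left)
next
  case (scale c A)
  then show ?case by (intro exI[of _ c]) (simp add: f_mono_empty)
qed

lemma Mat_over_body:
  fixes X :: "('f::{finite,linorder}, 'm::{finite,linorder}, 'n::{finite,linorder}, 's) smat"
  assumes "X \<in> Mat_over {{}}"
  shows "\<exists>A D. X = body_mat A D"
proof -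
  have "\<exists>c. X $ i $ j = c *\<^sub>R 1" for i j
    using grass_body grass_subset[OF Int_lower1 Mat_overD[OF assms]] by blast
  then obtain c where c: "\<And>i j. X $ i $ j = c i j *\<^sub>R 1" by metis
  have "X $ i $ j = 0" if "entry_parity i j" for i j
  proof -
    have "{{}} \<inter> parity_sets (entry_parity i j) = ({} :: 'f set set)"
      using that by (auto simp: parity_sets_def)
    then show ?thesis using Mat_overD[OF assms, of i j] grass_empty by metis
  qed
  then have "X = body_mat (\<chi> k l. c (Inl k) (Inl l)) (\<chi> p q. c (Inr p) (Inr q))"
    by (intro smat_eqI) (simp_all add: c[symmetric] entry_parity_def)
  then show ?thesis by blast
qed

lemma Mat_over_body_zero:
  fixes X :: "('f::{finite,linorder}, 'm::{finite,linorder}, 'n::{finite,linorder}, 's) smat"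
  assumes "X \<in> Mat_over {{}}" "X \<in> Mat_over U" "{} \<notin> U"
  shows "X = 0"
proof -
  obtain A D where X: "X = body_mat A D" using Mat_over_body[OF assms(1)] by blast
  have *: "c = 0" if "X $ i $ j = c *\<^sub>R 1" for c i j
    using grass_body_zero[of c "U \<inter> parity_sets (entry_parity i j)"] Mat_overD[OF assms(2), of i j] assms(3) that
    by simp
  have "A $ k $ l = 0" for k l using *[of "Inl k" "Inl l" "A $ k $ l"] by (simp add: X)
  moreover have "D $ p $ q = 0" for p q using *[of "Inr p" "Inr q" "D $ p $ q"] by (simp add: X)
  ultimately have "A = 0" "D = 0" by (simp_all add: vec_eq_iff)
  then show ?thesis by (simp add: X body_mat_zero)
qed

section \<open>The superdeterminant and the body\<close>

abbreviation top_act :: "('f::{finite,linorder}, 'm::{finite,linorder}, 'n, 's) superalg \<Rightarrow>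
    ('f, 'm, 'n) state \<Rightarrow> real" where
  "top_act a \<equiv> sep.act (Inl undefined) a (point (UNIV, True, {}, \<lambda>_. 0))"

lemma top_act_prod_list:
  assumes "\<And>i. i \<in> set ks \<Longrightarrow> top_act (h i) = (\<lambda>x. c i * point (UNIV, True, {}, \<lambda>_. 0) x)"
  shows "top_act (prod_list (map h ks)) = (\<lambda>x. prod_list (map c ks) * point (UNIV, True, {}, \<lambda>_. 0) x)"
  using assms
proof (induction ks)
  case Nil
  show ?case by (simp add: sep.act_one)
next
  case (Cons i ks)
  then have "top_act (prod_list (map h ks)) = (\<lambda>x. prod_list (map c ks) * point (UNIV, True, {}, \<lambda>_. 0) x)"
    "top_act (h i) = (\<lambda>x. c i * point (UNIV, True, {}, \<lambda>_. 0) x)" by simp_all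
  then show ?case
    by (simp only: list.map prod_list.Cons sep.act_mult sep.act_scale mult_ac)
qed

lemma top_act_det_comm:
  fixes X :: "('f::{finite,linorder}, 'm::{finite,linorder}, 'n, 's) superalg ^ ('k::{finite,linorder}) ^ ('k::{finite,linorder})"
  assumes X: "\<And>i j. top_act (X $ i $ j) = (\<lambda>x. A $ i $ j * point (UNIV, True, {}, \<lambda>_. 0) x)"
  shows "top_act (det_comm X) = (\<lambda>x. det A * point (UNIV, True, {}, \<lambda>_. 0) x)"
proof -
  let ?\<Omega> = "point (UNIV, True, {}, \<lambda>_. 0) :: ('f, 'm, 'n) state \<Rightarrow> real"
  let ?ks = "sorted_list_of_set (UNIV :: 'k set)"
  have "top_act (of_int (sign p) * prod_list (map (\<lambda>i. X $ i $ p i) ?ks))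
    = (\<lambda>x. of_int (sign p) * (\<Prod>i\<in>UNIV. A $ i $ p i) * ?\<Omega> x)" for p
  proof -
    have "of_int (sign p) * y = of_int (sign p) *\<^sub>R y" for y :: "('f, 'm, 'n, 's) superalg"
      by (simp add: sign_def)
    moreover have "top_act (prod_list (map (\<lambda>i. X $ i $ p i) ?ks))
      = (\<lambda>x. prod_list (map (\<lambda>i. A $ i $ p i) ?ks) * ?\<Omega> x)"
      by (rule top_act_prod_list) (rule X)
    moreover have "prod_list (map (\<lambda>i. A $ i $ p i) ?ks) = (\<Prod>i\<in>UNIV. A $ i $ p i)"
      using prod.distinct_set_conv_list[of ?ks "\<lambda>i. A $ i $ p i"] by simp
    ultimately show ?thesis by (simp only: sep.act_scaleR mult.assoc)
  qed
  then show ?thesis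
    unfolding det_comm_def det_def sep.act_sum by (simp only: sum_distrib_right)
qed

lemma det_comm_grass_ev:
  fixes X :: "('f::{finite,linorder}, 'm::{finite,linorder}, 'n, 's) superalg ^ ('k::{finite,linorder}) ^ ('k::{finite,linorder})"
  assumes X: "\<And>i j. X $ i $ j \<in> grass_ev"
  shows "det_comm X \<in> grass_ev"
proof -
  have one: "c *\<^sub>R 1 \<in> (grass_ev :: ('f, 'm, 'n, 's) superalg set)" for c
    unfolding grass_ev_eq f_mono_empty[symmetric]
    by (intro grass_scale grass_mono) (simp add: parity_sets_def)
  have mult: "a * b \<in> grass_ev" if "a \<in> grass_ev" "b \<in> grass_ev" for a b :: "('f, 'm, 'n, 's) superalg"
    using that unfolding grass_ev_eq
    by (rule grass_mult) (auto simp: parity_sets_def card_Un_disjoint)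
  have "prod_list (map (\<lambda>i. X $ i $ p i) ks) \<in> grass_ev" for p ks
    using one[of 1] by (induction ks) (simp_all add: X mult)
  moreover have "of_int (sign p) \<in> (grass_ev :: ('f, 'm, 'n, 's) superalg set)" for p :: "'k \<Rightarrow> 'k"
    using one[of 1] one[of "- 1"] by (simp add: sign_def)
  ultimately show ?thesis
    unfolding det_comm_def grass_ev_eq by (intro grass_sum) (simp add: grass_ev_eq[symmetric] mult)
qed

lemma top_act_even:
  assumes "a - c *\<^sub>R 1 \<in> grass U" "{} \<notin> U"
  shows "top_act a = (\<lambda>x. c * point (UNIV, True, {}, \<lambda>_. 0) x)"
proof -
  have "top_act (a - c *\<^sub>R 1) = (\<lambda>x. 0)" by (rule grass_top[OF assms])
  then show ?thesis by (simp add: sep.act_diff sep.act_scaleR sep.act_one fun_eq_iff)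
qed

text \<open>An element with body \<open>1\<close> is \<open>1\<close> plus a nilpotent element.\<close>

lemma grass_invertible:
  fixes d :: "('f::{finite,linorder}, 'm::{finite,linorder}, 'n, 's) superalg"
  assumes d: "d \<in> grass U" and top: "top_act d = (\<lambda>x. 1 * point (UNIV, True, {}, \<lambda>_. 0) x)"
  shows "\<exists>y. d * y = 1 \<and> y * d = 1"
proof -
  have "d \<in> grass (U \<inter> UNIV)" using d by simp
  from grass_split[OF this, of "{}"] obtain b n where bn: "d = b + n" "b \<in> grass {{}}" "n \<in> grass (U - {{}})"
    by auto
  obtain c where c: "b = c *\<^sub>R 1" using grass_body[OF bn(2)] by blast
  have "top_act d = (\<lambda>x. c * point (UNIV, True, {}, \<lambda>_. 0) x)"
    by (rule top_act_even[of _ _ "U - {{}}"]) (simp_all add: bn(1,3) c)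
  from fun_cong[OF this[unfolded top], of "(UNIV, True, {}, \<lambda>_. 0)"] have "c = 1" by simp
  then have "d = 1 - (- n)" using bn(1) c by simp
  moreover have "(- n) ^ Suc CARD('f) = 0"
    by (rule grass_nilpotent[OF grass_minus[OF bn(3)]]) simp
  ultimately show ?thesis using nilpotent_one_diff_inverse by blast
qed

text \<open>On the state of top degree, \<open>C'\<close> acts as zero. Hence \<open>B' D\<^sup>-\<^sup>1 C'\<close> acts as zero too, whatever
  elements \<open>matrix_inv D\<close> consists of, and the two determinants act as the real determinants of the
  blocks of the body. The determinant of \<open>D\<close> is invertible, so \<open>sdet M = 1\<close> says that the two are equal.\<close>

lemma sdet_body:
  fixes M :: "('f::{finite,linorder}, 'm::{finite,linorder}, 'n::{finite,linorder}, 's) smat"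
  assumes M: "M \<in> Mat" "sdet M = 1" and body: "M - body_mat A D \<in> Mat_over U" "{} \<notin> U" and D: "det D = 1"
  shows "det A = 1"
proof -
  let ?\<Omega> = "point (UNIV, True, {}, \<lambda>_. 0) :: ('f, 'm, 'n) state \<Rightarrow> real"
  let ?A = "(\<chi> i j. M $ Inl i $ Inl j) :: ('f, 'm, 'n, 's) superalg ^ ('m::{finite,linorder}) ^ ('m::{finite,linorder})"
  let ?B = "(\<chi> i q. M $ Inl i $ Inr q) :: ('f, 'm, 'n, 's) superalg ^ 'n dbl ^ ('m::{finite,linorder})"
  let ?C = "(\<chi> p j. M $ Inr p $ Inl j) :: ('f, 'm, 'n, 's) superalg ^ ('m::{finite,linorder}) ^ 'n dbl"
  let ?D = "(\<chi> p q. M $ Inr p $ Inr q) :: ('f, 'm, 'n, 's) superalg ^ 'n dbl ^ 'n dbl"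
  let ?X = "?A - ?B ** matrix_inv ?D ** ?C"
  have entry: "top_act (M $ i $ j) = (\<lambda>x. c * ?\<Omega> x)" if "body_mat A D $ i $ j = (c *\<^sub>R 1 :: ('f, 'm, 'n, 's) superalg)" for i j c
    using Mat_overD[OF body(1), of i j] body(2) that
    by (intro top_act_even[of _ _ "U \<inter> parity_sets (entry_parity i j)"]) auto
  have C: "top_act (?C $ p $ j) = (\<lambda>x. 0)" for p j
    using entry[of "Inr p" "Inl j" 0] by simp
  have zero: "sep.act (Inl undefined) a (\<lambda>x. 0) = (\<lambda>x. 0)" for a :: "('f, 'm, 'n, 's) superalg"
    using sep.act_scale[of "Inl undefined" a 0 "\<lambda>x. 0"] by simp
  have "top_act ((?B ** matrix_inv ?D ** ?C) $ i $ j) = (\<lambda>x. 0)" for i j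
    unfolding matrix_matrix_mult_def[of _ ?C] vec_lambda_beta sep.act_sum sep.act_mult
    using C by (simp add: zero)
  then have "top_act (?X $ i $ j) = (\<lambda>x. A $ i $ j * ?\<Omega> x)" for i j
    using entry[of "Inl i" "Inl j" "A $ i $ j"] by (simp add: sep.act_diff)
  then have X: "top_act (det_comm ?X) = (\<lambda>x. det A * ?\<Omega> x)" by (rule top_act_det_comm)
  have "top_act (?D $ p $ q) = (\<lambda>x. D $ p $ q * ?\<Omega> x)" for p q
    using entry[of "Inr p" "Inr q" "D $ p $ q"] by simp
  then have Dt: "top_act (det_comm ?D) = (\<lambda>x. 1 * ?\<Omega> x)" unfolding D[symmetric] by (rule top_act_det_comm)
  have "det_comm ?D \<in> grass (parity_sets False)"
    unfolding grass_ev_eq[symmetric] using M(1) by (intro det_comm_grass_ev) (simp add: Mat_def)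
  from grass_invertible[OF this Dt] obtain y where y': "det_comm ?D * y = 1 \<and> y * det_comm ?D = 1"
    by (elim exE)
  note y = conjunct1[OF y'] conjunct2[OF y']
  have "det_comm ?X * y = 1"
    using M(2) ring_inv_eq[OF y] by (simp add: sdet_def Let_def)
  then have "det_comm ?X * (y * det_comm ?D) = det_comm ?D" by (simp add: mult.assoc[symmetric])
  then have eq: "det_comm ?X = det_comm ?D" using y(2) by simp
  have "(\<lambda>x. det A * ?\<Omega> x) = (\<lambda>x. 1 * ?\<Omega> x)"
    by (rule trans[OF X[symmetric, unfolded eq] Dt])
  from fun_cong[OF this, of "(UNIV, True, {}, \<lambda>_. 0)"] show ?thesis by simp
qed

lemma body_mat_star_inverse:
  fixes A :: "real ^ ('m::{finite,linorder}) ^ ('m::{finite,linorder})" and D :: "real ^ ('n::{finite,linorder}) dbl ^ 'n dbl"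
  assumes "star (body_mat A D) ** body_mat A D = (mat 1 :: ('f::{finite,linorder}, 'm, 'n, 's) smat)"
  shows "orthogonal_matrix A" "symplectic D"
    "body_mat A D ** star (body_mat A D) = (mat 1 :: ('f, 'm, 'n, 's) smat)"
proof -
  let ?D = "(\<chi> p q. sg p * sg q * D $ flip q $ flip p)"
  have AD: "transpose A ** A = mat 1" "?D ** D = mat 1"
    using assms unfolding star_body_mat body_mat_mult body_mat_one[symmetric] body_mat_eq_iff by simp_all
  then show "orthogonal_matrix A" by (simp add: orthogonal_matrix)
  have "A ** transpose A = mat 1" "D ** ?D = mat 1"
    using AD matrix_left_right_inverse by blast+
  then show "body_mat A D ** star (body_mat A D) = (mat 1 :: ('f, 'm, 'n, 's) smat)"
    unfolding star_body_mat body_mat_mult by (simp add: body_mat_one)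
  show "symplectic D"
    unfolding symplectic_def
  proof (intro allI)
    fix p q
    have "(?D ** D) $ flip p $ q = (mat 1 :: real ^ 'n dbl ^ 'n dbl) $ flip p $ q" by (simp only: AD(2))
    then have "(\<Sum>k\<in>UNIV. sg (flip p) * sg k * D $ flip k $ p * D $ k $ q) = (if flip p = q then 1 else 0)"
      by (simp add: matrix_matrix_mult_def mat_def)
    moreover have "(\<Sum>k\<in>UNIV. sg (flip p) * sg k * D $ flip k $ p * D $ k $ q)
      = (\<Sum>k\<in>UNIV. sg (flip p) * sg (flip k) * D $ k $ p * D $ flip k $ q)"
      by (rule sum.reindex_bij_witness[of _ flip flip]) simp_all
    moreover have "\<dots> = sg p * symp_form (D *v axis p 1) (D *v axis q 1)"
      unfolding matrix_vector_mult_basis symp_form_def by (simp add: column_def sum_distrib_left mult_ac)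
    ultimately have "sg p * (sg p * symp_form (D *v axis p 1) (D *v axis q 1)) = sg p * (if flip p = q then 1 else 0)"
      by simp
    then show "symp_form (D *v axis p 1) (D *v axis q 1) = gform p q"
      by (auto simp: gform_flip)
  qed
qed

section \<open>Every isometry is realised\<close>

text \<open>The body \<open>X\<close> of \<open>M\<close> is itself an isometry: \<open>1 - star X ** X\<close> is real, and it has no
  monomial of degree zero. So \<open>M\<close> is the product of the isometries \<open>X\<close> and \<open>star X ** M\<close>, and the latter has
  body \<open>1\<close>.\<close>

theorem SO_0_spin_image:
  fixes M :: "('f::{finite,linorder}, 'm::{finite,linorder}, 'n::{finite,linorder}, 's) smat"
  assumes "M \<in> SO_0"
  shows "M \<in> spin_image"
proof -
  let ?U = "UNIV - {{}} :: 'f set set"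
  have M: "M \<in> Mat" "sdet M = 1" and star: "star M ** M = mat 1"
    using assms SO_0_star by (simp_all add: SO_0_def)
  obtain X P where XP: "M = X + P" "X \<in> Mat_over {{}}" "P \<in> Mat_over ?U"
    using Mat_over_split[OF M(1)[unfolded Mat_eq], of "{}"] by blast
  obtain A D where X: "X = body_mat A D" using Mat_over_body[OF XP(2)] by blast
  have XM: "X \<in> Mat" "star X \<in> Mat_over {{}}" "star X \<in> Mat"
    using XP(2) star_Mat_over[OF XP(2)] Mat_over_subset[of "{{}}" UNIV] by (auto simp: Mat_eq)
  have sP: "star P \<in> Mat_over ?U" by (rule star_Mat_over[OF XP(3)])
  have "mat 1 - star X ** X = star X ** P + star P ** X + star P ** P"
    using star by (simp add: XP(1) star_add smat_diff_mult matrix_add_ldistrib algebra_simps)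
  moreover have XsP: "star X ** P \<in> Mat_over ?U"
    by (rule Mat_over_mult[OF XM(2) XP(3)]) auto
  moreover have "star P ** X \<in> Mat_over ?U" "star P ** P \<in> Mat_over ?U"
    by (rule Mat_over_mult[OF sP XP(2)], auto)+ (rule Mat_over_mult[OF sP XP(3)], auto)
  ultimately have "mat 1 - star X ** X \<in> Mat_over ?U" by (simp only: Mat_over_add)
  moreover have "mat 1 - star X ** X \<in> Mat_over {{}}"
    by (intro Mat_over_diff mat_1_over Mat_over_mult[OF XM(2) XP(2)]) simp
  ultimately have "mat 1 - star X ** X = 0" by (intro Mat_over_body_zero[of _ ?U]) simp_all
  then have sX: "star (body_mat A D) ** body_mat A D = (mat 1 :: ('f, 'm, 'n, 's) smat)" by (simp add: X)
  note AD = body_mat_star_inverse[OF sX]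
  have "det A = 1"
    by (rule sdet_body[OF M _ _ det_symplectic[OF AD(2)], of A ?U]) (simp_all add: XP(1,3) X[symmetric])
  then have A: "A \<in> rotations" by (rule special_orthogonal_rotations[OF AD(1)])
  have Dt: "D \<in> transvections UNIV" by (rule symplectic_transvections[OF AD(2)])
  let ?M = "star X ** M"
  have "?M \<in> spin_image"
  proof (rule spin_image_unipotent[of ?U])
    show "?M \<in> Mat" by (rule Mat_mult[OF XM(3) M(1)])
    have "star ?M ** ?M = star M ** ((X ** star X) ** M)"
      by (simp add: star_mult[OF XM(3) M(1)] matrix_mul_assoc)
    then show "star ?M ** ?M = mat 1" using AD(3) by (simp add: X star)
    have "?M - mat 1 = star X ** P"
      using sX by (simp add: XP(1) X matrix_add_ldistrib)
    then show "?M - mat 1 \<in> Mat_over ?U" using XsP by simp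
  qed auto
  then have "body_mat A (mat 1) ** (body_mat (mat 1) D ** ?M) \<in> spin_image"
    by (intro spin_image_body_rotations[OF A] spin_image_body_transvections[OF Dt])
  moreover have "body_mat A (mat 1) ** (body_mat (mat 1) D ** ?M) = M"
  proof -
    have "body_mat A (mat 1) ** (body_mat (mat 1) D ** ?M) = (X ** star X) ** M"
      by (simp add: matrix_mul_assoc body_mat_mult X)
    then show ?thesis using AD(3) by (simp add: X)
  qed
  ultimately show ?thesis by simp
qed

theorem theorem5:
  fixes M :: "('f::{finite,linorder}, 'm::{finite,linorder}, 'n::{finite,linorder}, 's::finite) smat"
  assumes "CARD('s) > 1"
    and "M \<in> SO_0"
  shows "\<exists>s\<in>Spin. spin_hom s = M"
proof -
  obtain s where "s \<in> Spin" "realizes s M"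
    using SO_0_spin_image[OF assms(2)] by (auto simp: spin_image_def)
  then show ?thesis using realizes_spin_hom by blast
qed

end
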